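(* Let $n,m\ge 1$ be integers and let $(\mathfrak g,\mathfrak g_0)=(\mathfrak{so}_{n+m},\mathfrak{so}_n\oplus\mathfrak{so}_m)$ with symmetric decomposition $\mathfrak g=\mathfrak g_0\oplus\mathfrak g_1$. Then the commuting variety $\mathfrak C(\mathfrak g_1)=\{(x,y)\in\mathfrak g_1\times\mathfrak g_1\mid [x,y]=0\}$ is irreducible.
   Context: The ground field $\Bbbk$ is algebraically closed of characteristic zero. A symmetric pair $(\mathfrak g,\mathfrak g_0)$ consists of a reductive algebraic Lie algebra $\mathfrak g$ over $\Bbbk$ with an involutory automorphism $\sigma$; $\mathfrak g=\mathfrak g_0\oplus\mathfrak g_1$ is the decomposition into the $(+1)$- and $(-1)$-eigenspaces of $\sigma$. For $(\mathfrak{so}_{n+m},\mathfrak{so}_n\oplus\mathfrak{so}_m)$: let $V=\Bbbk^{n+m}$ carry a non-degenerate symmetric bilinear form, and let $V=V_a\oplus V_b$ be an orthogonal decomposition with $\dim V_a=n$, $\dim V_b=m$; $\mathfrak g=\mathfrak{so}(V)$ and $\sigma$ is conjugation by $A\in \mathrm O(V)$ with $A|_{V_a}=-\mathrm{id}$, $A|_{V_b}=\mathrm{id}$. Thus $\mathfrak g_0=\mathfrak{so}(V_a)\oplus\mathfrak{so}(V_b)$. Irreducibility is in the Zariski topology. *)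

theory Defs
  imports "HOL-Analysis.Analysis" "HOL-Computational_Algebra.Polynomial"
begin

section \<open>Quadratic spaces\<close>

definition bilinear_form :: "('a::field^'d \<Rightarrow> 'a^'d \<Rightarrow> 'a) \<Rightarrow> bool" where
  "bilinear_form B \<longleftrightarrow>
     (\<forall>u. Vector_Spaces.linear (*s) (*) (\<lambda>v. B u v)) \<and>
     (\<forall>v. Vector_Spaces.linear (*s) (*) (\<lambda>u. B u v))"

definition symmetric_form :: "('a^'d \<Rightarrow> 'a^'d \<Rightarrow> 'a) \<Rightarrow> bool" where
  "symmetric_form B \<longleftrightarrow> (\<forall>u v. B u v = B v u)"

definition nondegenerate_form :: "('a::field^'d \<Rightarrow> 'a^'d \<Rightarrow> 'a) \<Rightarrow> bool" where
  "nondegenerate_form B \<longleftrightarrow> (\<forall>u. (\<forall>v. B u v = 0) \<longrightarrow> u = 0)"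

definition orthogonal_decomposition ::
  "('a::field^'d \<Rightarrow> 'a^'d \<Rightarrow> 'a) \<Rightarrow> ('a^'d) set \<Rightarrow> ('a^'d) set \<Rightarrow> bool" where
  "orthogonal_decomposition B Va Vb \<longleftrightarrow>
     vec.subspace Va \<and> vec.subspace Vb \<and>
     {a + b | a b. a \<in> Va \<and> b \<in> Vb} = UNIV \<and> Va \<inter> Vb = {0} \<and>
     (\<forall>a\<in>Va. \<forall>b\<in>Vb. B a b = 0)"

definition orthogonal_group :: "('a::field^'d \<Rightarrow> 'a^'d \<Rightarrow> 'a) \<Rightarrow> ('a^'d^'d) set" where
  "orthogonal_group B = {A. invertible A \<and> (\<forall>u v. B (A *v u) (A *v v) = B u v)}"


section \<open>The Lie algebra, its involution, and the commuting variety\<close>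

definition lie_bracket :: "'a::field^'d^'d \<Rightarrow> 'a^'d^'d \<Rightarrow> 'a^'d^'d" where
  "lie_bracket X Y = X ** Y - Y ** X"

definition so :: "('a::field^'d \<Rightarrow> 'a^'d \<Rightarrow> 'a) \<Rightarrow> ('a^'d^'d) set" where
  "so B = {X. \<forall>u v. B (X *v u) v + B u (X *v v) = 0}"

definition conjugation :: "'a::field^'d^'d \<Rightarrow> 'a^'d^'d \<Rightarrow> 'a^'d^'d" where
  "conjugation A X = A ** X ** matrix_inv A"

definition minus_eigenspace :: "'v::ab_group_add set \<Rightarrow> ('v \<Rightarrow> 'v) \<Rightarrow> 'v set" where
  "minus_eigenspace \<gg> \<sigma> = {x \<in> \<gg>. \<sigma> x = - x}"

definition commuting_variety :: "('a::field^'d^'d) set \<Rightarrow> (('a^'d^'d) \<times> ('a^'d^'d)) set" where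
  "commuting_variety S = {(x, y). x \<in> S \<and> y \<in> S \<and> lie_bracket x y = 0}"


section \<open>Zariski topology\<close>

text \<open>Polynomial functions in the entries of a pair of matrices.\<close>

inductive_set polynomial_functions :: "(('a::field^'d^'d) \<times> ('a^'d^'d) \<Rightarrow> 'a) set" where
  const: "(\<lambda>p. c) \<in> polynomial_functions"
| fst: "(\<lambda>p. fst p $ i $ j) \<in> polynomial_functions"
| snd: "(\<lambda>p. snd p $ i $ j) \<in> polynomial_functions"
| add: "f \<in> polynomial_functions \<Longrightarrow> g \<in> polynomial_functions
          \<Longrightarrow> (\<lambda>p. f p + g p) \<in> polynomial_functions"
| mult: "f \<in> polynomial_functions \<Longrightarrow> g \<in> polynomial_functions
          \<Longrightarrow> (\<lambda>p. f p * g p) \<in> polynomial_functions"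

definition zariski :: "(('a::field^'d^'d) \<times> ('a^'d^'d)) topology" where
  "zariski = topology (\<lambda>U. \<exists>P \<subseteq> polynomial_functions. U = - {p. \<forall>f\<in>P. f p = 0})"

lemma openin_zariski:
  fixes U :: "(('a::field^'d^'d) \<times> ('a^'d^'d)) set"
  shows "openin zariski U \<longleftrightarrow> (\<exists>P \<subseteq> polynomial_functions. U = - {p. \<forall>f\<in>P. f p = 0})"
proof -
  let ?L = "\<lambda>U :: (('a^'d^'d) \<times> ('a^'d^'d)) set.
              \<exists>P \<subseteq> polynomial_functions. U = - {p. \<forall>f\<in>P. f p = 0}"
  have inter: "?L (S \<inter> T)" if ST: "?L S" "?L T" for S T
  proof -
    obtain P Q where P: "P \<subseteq> polynomial_functions" "S = - {p. \<forall>f\<in>P. f p = 0}"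
      and Q: "Q \<subseteq> polynomial_functions" "T = - {p. \<forall>f\<in>Q. f p = 0}"
      using ST by auto
    let ?R = "{\<lambda>p. f p * g p | f g. f \<in> P \<and> g \<in> Q}"
    have "?R \<subseteq> polynomial_functions"
      using P(1) Q(1) by (auto intro!: polynomial_functions.mult)
    moreover have "S \<inter> T = - {p. \<forall>h\<in>?R. h p = 0}"
    proof (intro set_eqI iffI)
      fix p assume "p \<in> S \<inter> T"
      then obtain f g where fg: "f \<in> P" "f p \<noteq> 0" "g \<in> Q" "g p \<noteq> 0"
        by (auto simp: P(2) Q(2))
      then have R: "(\<lambda>p. f p * g p) \<in> ?R" and nz: "(\<lambda>p. f p * g p) p \<noteq> 0"
        by auto
      show "p \<in> - {p. \<forall>h\<in>?R. h p = 0}"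
      proof
        assume "p \<in> {p. \<forall>h\<in>?R. h p = 0}"
        then have "\<forall>h\<in>?R. h p = 0"
          by (rule CollectD)
        from this R have "(\<lambda>p. f p * g p) p = 0"
          by (rule bspec)
        with nz show False
          by contradiction
      qed
    next
      fix p assume "p \<in> - {p. \<forall>h\<in>?R. h p = 0}"
      then obtain f g where "f \<in> P" "g \<in> Q" "f p * g p \<noteq> 0"
        by auto
      then show "p \<in> S \<inter> T"
        by (auto simp: P(2) Q(2))
    qed
    ultimately show ?thesis
      by (intro exI[of _ ?R]) simp
  qed
  have union: "?L (\<Union>K)" if K: "\<forall>U\<in>K. ?L U" for K
  proof -
    obtain P where P: "\<forall>U\<in>K. P U \<subseteq> polynomial_functions \<and> U = - {p. \<forall>f\<in>P U. f p = 0}"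
      using bchoice[OF K] by blast
    have "\<Union>K = (\<Union>U\<in>K. - {p. \<forall>f\<in>P U. f p = 0})"
      using P by auto
    also have "\<dots> = - {p. \<forall>f\<in>(\<Union>U\<in>K. P U). f p = 0}"
      by auto
    finally show ?thesis
      using P by (intro exI[of _ "\<Union>U\<in>K. P U"]) auto
  qed
  have "istopology ?L"
    unfolding istopology_def using inter union by blast
  then show ?thesis
    by (simp add: zariski_def)
qed

lemma topspace_zariski [simp]: "topspace zariski = (UNIV :: (('a::field^'d^'d) \<times> ('a^'d^'d)) set)"
proof -
  have "openin zariski (UNIV :: (('a^'d^'d) \<times> ('a^'d^'d)) set)"
    unfolding openin_zariski
    by (intro exI[of _ "{\<lambda>p. 1}"]) (auto intro: polynomial_functions.const)
  then show ?thesis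
    using openin_subset by blast
qed

lemma closedin_zariski:
  "closedin zariski C \<longleftrightarrow> (\<exists>P \<subseteq> polynomial_functions. C = {p. \<forall>f\<in>P. f p = 0})"
proof -
  have "closedin zariski C \<longleftrightarrow> openin zariski (- C)"
    by (simp add: closedin_def Compl_eq_Diff_UNIV)
  also have "\<dots> \<longleftrightarrow> (\<exists>P \<subseteq> polynomial_functions. C = {p. \<forall>f\<in>P. f p = 0})"
    unfolding openin_zariski by simp
  finally show ?thesis .
qed

definition irreducible_space :: "'p topology \<Rightarrow> bool" where
  "irreducible_space T \<longleftrightarrow> topspace T \<noteq> {} \<and>
     (\<forall>C D. closedin T C \<longrightarrow> closedin T D \<longrightarrow> topspace T = C \<union> D
        \<longrightarrow> C = topspace T \<or> D = topspace T)"

end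

theory Submission
  imports Defs
begin

text \<open>
  For the symmetric form \<open>b u v = B (A u) v\<close> the elements of \<open>\<gg>\<^sub>1\<close> are the self-adjoint operators that
  anticommute with \<open>A\<close>. The pairs \<open>(x, r x)\<close> with \<open>x \<in> \<gg>\<^sub>1\<close> and \<open>r\<close> an odd polynomial form the image of an
  affine space, so it suffices that they are Zariski dense in the commuting variety. This is shown for
  all nondegenerate \<open>A\<close>-stable subspaces \<open>W\<close> of \<open>V\<close> by induction on \<open>dim W\<close>.

  Let \<open>(x, y)\<close> be a commuting pair on \<open>W\<close>. If \<open>x\<close> is neither nilpotent nor invertible, its Fitting
  decomposition splits the pair. If \<open>x\<close> is invertible and commutes with a proper orthogonal
  projection \<open>e'\<close>, the generic member of the line through \<open>y\<close> and \<open>x e'\<close> splits together with \<open>x\<close>;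
  without such \<open>e'\<close>, the operator \<open>x\<^sup>2\<close> is cyclic on \<open>V\<^sub>a\<close> and \<open>y\<close> is an odd polynomial in \<open>x\<close>.

  If \<open>x\<close> and \<open>y\<close> are nilpotent, they have a common kernel vector in \<open>V\<^sub>a\<close> or in \<open>V\<^sub>b\<close>, say in \<open>V\<^sub>b\<close>. An
  anisotropic one can be split off. Otherwise the common kernel \<open>N\<close> in \<open>V\<^sub>b\<close> is totally isotropic and
  \<open>V\<^sub>b = N + V\<^sub>0 + N'\<close> with \<open>N'\<close> dual to \<open>N\<close>. If \<open>V\<^sub>0 \<noteq> 0\<close>, the induction hypothesis deforms the part of
  \<open>(x, y)\<close> on \<open>V\<^sub>a + V\<^sub>0\<close> to nonnilpotent pairs, and the remaining part can be carried along polynomially.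
  If \<open>V\<^sub>0 = 0\<close>, there is a line of commuting pairs through \<open>(x, y)\<close>, in a direction made of operators
  \<open>u \<mapsto> b c u v + b v u c\<close> with fixed \<open>v \<in> N'\<close>, on which the common kernel shrinks or ceases to be
  isotropic.
\<close>

section \<open>Square matrices as a ring\<close>

text \<open>For \<open>x\<close> in the (-1)-eigenspace, \<open>B (x u) v = - B u (x v)\<close> and
  \<open>A x = - x A\<close> combine to \<open>b (x u) v = b u (x v)\<close>: passing from
  \<open>B\<close> to \<open>b\<close> turns skew operators into self-adjoint ones. Then all
  polynomials in \<open>x\<close> are self-adjoint, the odd ones stay in the space, and idempotents
  among them are orthogonal projections. Moreover \<open>- A\<close> may replace \<open>A\<close>,
  so the two eigenspaces play symmetric roles. Density is not argued topologically: a polynomial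
  function that vanishes at all pairs \<open>(x, r x)\<close> is shown to vanish at a given
  commuting pair, by running a polynomial curve of commuting pairs through it and using that a
  polynomial in one variable with infinitely many zeros is zero. The obstacle is a nilpotent pair,
  where no Fitting component splits off; the deformation has to create a nonnilpotent member or an
  anisotropic kernel vector. For \<open>V\<^sub>0 = 0\<close> the line may achieve neither, but then
  the common kernel gets smaller. Hence the induction on \<open>dim W\<close> contains a second one,
  on the dimension of the common kernel.\<close>

typedef ('a, 'n::finite) endo = "UNIV :: ('a^'n^'n) set"
  morphisms matrix_of Endo
  by simp

setup_lifting type_definition_endo

text \<open>On nested vectors \<open>*\<close> is the componentwise product. In the copy it is
  composition, so that powers and the ring laws apply to operators.\<close>

instantiation endo :: (field, finite) ring_1
begin
lift_definition zero_endo :: "('a, 'b) endo" is 0 .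
lift_definition one_endo :: "('a, 'b) endo" is "mat 1" .
lift_definition plus_endo :: "('a, 'b) endo \<Rightarrow> ('a, 'b) endo \<Rightarrow> ('a, 'b) endo" is "(+)" .
lift_definition minus_endo :: "('a, 'b) endo \<Rightarrow> ('a, 'b) endo \<Rightarrow> ('a, 'b) endo" is "(-)" .
lift_definition uminus_endo :: "('a, 'b) endo \<Rightarrow> ('a, 'b) endo" is "uminus" .
lift_definition times_endo :: "('a, 'b) endo \<Rightarrow> ('a, 'b) endo \<Rightarrow> ('a, 'b) endo" is "(**)" .
instance
proof
  fix a b c :: "('a, 'b) endo"
  show "a * b * c = a * (b * c)"
    by transfer (simp add: matrix_mul_assoc)
  show "(a + b) * c = a * c + b * c" "a * (b + c) = a * b + a * c"
    by (transfer, simp add: vec_eq_iff matrix_matrix_mult_def distrib_left distrib_right sum.distrib)+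
  show "1 * a = a" "a * 1 = a"
    by (transfer, simp)+
  show "(0::('a, 'b) endo) \<noteq> 1"
    by transfer (auto simp: mat_def vec_eq_iff)
qed (transfer; simp)+
end

lift_definition act :: "('a::field, 'n::finite) endo \<Rightarrow> 'a^'n \<Rightarrow> 'a^'n" is "(*v)" .
lift_definition smul :: "'a::field \<Rightarrow> ('a, 'n::finite) endo \<Rightarrow> ('a, 'n) endo" (infixr \<open>*e\<close> 75)
  is "\<lambda>c M. \<chi> i j. c * M $ i $ j" .
lift_definition entry :: "('a::field, 'n::finite) endo \<Rightarrow> 'n \<Rightarrow> 'n \<Rightarrow> 'a" is "\<lambda>M i j. M $ i $ j" .
lift_definition tr :: "('a::field, 'n::finite) endo \<Rightarrow> 'a" is trace .
lift_definition detm :: "('a::field, 'n::finite) endo \<Rightarrow> 'a" is det .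

lemma endo_eqI: "(\<And>u. act x u = act y u) \<Longrightarrow> x = y"
  by transfer (simp add: matrix_eq)

lemma matrix_of_Endo [simp]: "matrix_of (Endo M) = M"
  by (simp add: Endo_inverse)

lemma entry_Endo [simp]: "entry (Endo M) i j = M $ i $ j"
  by (simp add: entry.rep_eq)

lemma act_vec_nth: "act x u $ i = (\<Sum>j\<in>UNIV. entry x i j * u $ j)"
  by transfer (simp add: matrix_vector_mult_def)

lemma entry_simps [simp]:
  "entry (x + y) i j = entry x i j + entry y i j"
  "entry (x - y) i j = entry x i j - entry y i j"
  "entry (- x) i j = - entry x i j"
  "entry 0 i j = 0"
  "entry (c *e x) i j = c * entry x i j"
proof goal_cases
qed (transfer, simp)+

lemma act_1 [simp]: "act 1 u = u" and act_mult [simp]: "act (x * y) u = act x (act y u)"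
  by (transfer, simp add: matrix_vector_mul_assoc)+

lemma act_simps [simp]:
  "act 0 u = 0" "act (x + y) u = act x u + act y u" "act (x - y) u = act x u - act y u"
  "act (- x) u = - act x u" "act (c *e x) u = c *s act x u"
  by (simp_all add: vec_eq_iff act_vec_nth distrib_right left_diff_distrib sum.distrib
      sum_subtractf sum_negf sum_distrib_left mult.assoc)

lemma act_linear [simp]:
  "act x (u + v) = act x u + act x v" "act x (u - v) = act x u - act x v" "act x (- u) = - act x u"
  "act x (c *s u) = c *s act x u" "act x 0 = 0"
  by (simp_all add: vec_eq_iff act_vec_nth distrib_left right_diff_distrib sum.distrib
      sum_subtractf sum_negf sum_distrib_left mult.left_commute)

lemma linear_act: "Vector_Spaces.linear (*s) (*s) (act x)"
  by transfer (rule matrix_vector_mul_linear_gen)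

lemma endo_of_linear:
  assumes "Vector_Spaces.linear (*s) (*s) g"
  obtains x where "act x = g"
proof
  show "act (Endo (matrix g)) = g"
    using assms by (simp add: act.abs_eq fun_eq_iff matrix_works)
qed

lemma smul_simps [simp]:
  "(c *e x) * y = c *e (x * y)" "x * (c *e y) = c *e (x * y)" "c *e d *e x = (c * d) *e x"
  "1 *e x = x" "0 *e x = 0" "c *e (0::('a::field,'n::finite) endo) = 0" "(- c) *e x = - (c *e x)" "c *e (- x) = - (c *e x)"
proof goal_cases
qed (rule endo_eqI, simp add: vec.scale_minus_left)+

lemma smul_add: "c *e (x + y) = c *e x + c *e y" "(c + d) *e x = c *e x + d *e x"
    "c *e (x - y) = c *e x - c *e y" "(c - d) *e x = c *e x - d *e x"
proof goal_cases
qed (rule endo_eqI, simp add: vec.scale_right_distrib vec.scale_left_distrib vec.scale_right_diff_distrib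
      vec.scale_left_diff_distrib)+

lemma smul_2: "2 *e x = x + x"
  using smul_add(2)[of 1 1 x] by simp

lemma smul_eq_0_iff [simp]: "c *e x = 0 \<longleftrightarrow> c = 0 \<or> x = (0::('a::field,'n::finite) endo)"
  by transfer (auto simp: vec_eq_iff)

lemma entry_mult: "entry (x * y) i j = (\<Sum>k\<in>UNIV. entry x i k * entry y k j)"
  by transfer (simp add: matrix_matrix_mult_def)

lemma entry_act: "entry x i j = act x (axis j 1) $ i"
  by transfer (simp add: matrix_vector_mult_def axis_def if_distrib cong: if_cong)

lemma endo_eqI_axis: "(\<And>j. act x (axis j 1) = act y (axis j 1)) \<Longrightarrow> x = y"
  by (metis entry.rep_eq entry_act matrix_of_inject vec_eq_iff)

lemma tr_eq_sum_entry: "tr x = (\<Sum>i\<in>UNIV. entry x i i)"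
  by transfer (simp add: trace_def)

lemma tr_simps [simp]:
  "tr (x + y) = tr x + tr y" "tr (x - y) = tr x - tr y" "tr (- x) = - tr x" "tr 0 = 0"
  "tr (c *e x) = c * tr x"
  by (simp_all add: tr_eq_sum_entry sum.distrib sum_subtractf sum_negf sum_distrib_left)

lemma tr_mult_commute: "tr (x * y) = tr (y * x)"
  by transfer (rule trace_mul_sym)

lemma mult_ext: "a * b = c \<Longrightarrow> a * (b * w) = c * (w :: 'r :: semigroup_mult)"
  by (simp flip: mult.assoc)

lemma square_power_0: "X ^ k = 0 \<Longrightarrow> (X * X :: 'r::ring_1) ^ k = 0"
proof -
  assume "X ^ k = 0"
  moreover have "(X * X) ^ k = X ^ (k + k)"
    by (simp only: mult_2[symmetric] power_mult power2_eq_square)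
  ultimately show ?thesis
    by (simp add: power_add)
qed

section \<open>Polynomials in a matrix\<close>

text \<open>Coefficients and argument live in different rings, so \<open>poly\<close> does not
  apply; this is Horner's scheme with the scalars \<open>a *e 1\<close>.\<close>

definition meval :: "'a::field poly \<Rightarrow> ('a, 'n::finite) endo \<Rightarrow> ('a, 'n) endo" where
  "meval p x = fold_coeffs (\<lambda>a y. a *e 1 + x * y) p 0"

lemma meval_0 [simp]: "meval 0 x = 0"
  by (simp add: meval_def)

lemma meval_pCons [simp]: "meval (pCons a p) x = a *e 1 + x * meval p x"
  by (cases "a = 0 \<and> p = 0") (auto simp: meval_def)

lemma meval_1 [simp]: "meval 1 x = 1"
  by (simp add: one_pCons)

lemma meval_add: "meval (p + q) x = meval p x + meval q x"
  by (induction p q rule: poly_induct2) (simp_all add: smul_add algebra_simps)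

lemma meval_smult: "meval (smult c p) x = c *e meval p x"
  by (induction p) (simp_all add: smul_add)

lemma meval_commute: "x * y = y * x \<Longrightarrow> meval p x * y = y * meval p x"
proof (induction p)
  case (pCons a p)
  then show ?case
    by (simp add: algebra_simps) (metis mult.assoc)
qed simp

lemma meval_mult: "meval (p * q) x = meval p x * meval q x"
proof (induction p)
  case (pCons a p)
  then show ?case
    by (simp add: meval_add meval_smult algebra_simps)
qed simp

lemma meval_diff: "meval (p - q) x = meval p x - meval q x"
  using meval_add[of "p - q" q x] by (simp add: algebra_simps)

text \<open>\<open>N\<close> is the restriction of \<open>M\<close> to the invariant block
  \<open>e\<close>. In this way a polynomial of a direct sum is computed one summand at a
  time.\<close>

lemma meval_block:
  assumes "M * e = N" "N * e = N" "e * N = N"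
  shows "meval q M * e = meval q N * e"
proof (induction q)
  case (pCons a q)
  have "meval q N * e = e * meval q N"
    using assms by (intro meval_commute) simp
  moreover from this have "M * (meval q N * e) = N * (meval q N * e)"
    using assms by (metis mult.assoc)
  ultimately show ?case
    using pCons by (simp add: distrib_right mult.assoc)
qed simp

lemma meval_monom: "meval (monom 1 k) x = x ^ k"
  by (induction k) (simp_all add: monom_Suc monom_0)

lemma meval_pcompose_scale: "meval (pcompose p [:0, c:]) x = meval p (c *e x)"
  by (induction p) (simp_all add: pcompose_pCons meval_add meval_mult meval_smult algebra_simps)

lemma meval_pcompose_shift: "meval (pcompose p [:c, 1:]) x = meval p (c *e 1 + x)"
  by (induction p) (simp_all add: pcompose_pCons meval_add meval_mult meval_smult algebra_simps)

section \<open>Annihilating polynomials and Fitting idempotents\<close>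

lemma vec_ex_poly_annihilator:
  fixes x :: "('a::field, 'n::finite) endo"
  obtains p where "p \<noteq> 0" "act (meval p x) u = 0"
proof -
  let ?f = "\<lambda>i. act (x ^ i) u"
  let ?n = "CARD('n)"
  have "\<exists>c. (\<exists>i\<le>?n. c i \<noteq> 0) \<and> (\<Sum>i\<le>?n. c i *s ?f i) = 0"
  \<comment> \<open>\<open>vec.dependent\<close> speaks of sets, so a repetition in the family of
    powers is a linear relation that needs its own case.\<close>
  proof (cases "inj_on ?f {..?n}")
    case True
    have "vec.dependent (?f ` {..?n})"
    proof (rule ccontr)
      assume "vec.independent (?f ` {..?n})"
      then have "card (?f ` {..?n}) \<le> vec.dim (UNIV :: ('a^'n) set)"
        by (intro vec.independent_card_le_dim) auto
      also have "\<dots> = ?n"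
        by (rule vec_dim_card)
      finally show False
        using True by (simp add: card_image)
    qed
    then obtain c where c: "\<exists>v\<in>?f ` {..?n}. c v \<noteq> 0" "(\<Sum>v\<in>?f ` {..?n}. c v *s v) = 0"
      using vec.dependent_finite[of "?f ` {..?n}"] by auto
    then show ?thesis
      using True by (intro exI[of _ "\<lambda>i. c (?f i)"]) (auto simp: sum.reindex)
  next
    case False
    then obtain i j where ij: "i \<le> ?n" "j \<le> ?n" "i \<noteq> j" "?f i = ?f j"
      by (auto simp: inj_on_def)
    let ?c = "\<lambda>k. if k = i then 1 else if k = j then -1 else (0::'a)"
    have "(\<Sum>k\<le>?n. ?c k *s ?f k) = (\<Sum>k\<in>{i, j}. ?c k *s ?f k)"
      by (rule sum.mono_neutral_right) (use ij in auto)
    also have "\<dots> = 0"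
      using ij by simp
    finally show ?thesis
      using ij by (intro exI[of _ ?c]) auto
  qed
  then obtain c i where c: "i \<le> ?n" "c i \<noteq> 0" "(\<Sum>i\<le>?n. c i *s ?f i) = 0"
    by blast
  define p where "p = (\<Sum>k\<le>?n. smult (c k) (monom 1 k))"
  have "coeff p i = c i"
    using c(1) by (simp add: p_def coeff_sum if_distrib cong: if_cong)
  then have "p \<noteq> 0"
    using c(2) by auto
  moreover have "act (meval (\<Sum>k\<in>K. smult (c k) (monom 1 k)) x) u = (\<Sum>k\<in>K. c k *s ?f k)" if "finite K" for K
    using that by (induction K) (simp_all add: meval_add meval_smult meval_monom)
  ultimately show ?thesis
    using that[of p] c(3) by (simp add: p_def)
qed

text \<open>Polynomials in \<open>x\<close> commute, so a product of annihilators of the basis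
  vectors kills all of them.\<close>

lemma ex_poly_annihilator:
  fixes x :: "('a::field, 'n::finite) endo"
  obtains p where "p \<noteq> 0" "meval p x = 0"
proof -
  have "\<exists>p. p \<noteq> 0 \<and> (\<forall>j\<in>J. act (meval p x) (axis j 1) = 0)" if "finite J" for J :: "'n set"
    using that
  proof (induction J)
    case empty
    show ?case
      by (intro exI[of _ 1]) simp
  next
    case (insert j J)
    then obtain p where p: "p \<noteq> 0" "\<forall>j\<in>J. act (meval p x) (axis j 1) = 0"
      by blast
    obtain q where q: "q \<noteq> 0" "act (meval q x) (axis j 1) = 0"
      using vec_ex_poly_annihilator[of x] by blast
    have "act (meval (p * q) x) (axis i 1) = 0" if "i \<in> insert j J" for i
    proof (cases "i = j")
      case False
      then show ?thesis
        using p that by (subst mult.commute) (simp add: meval_mult)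
    qed (simp add: meval_mult q)
    then show ?case
      using p(1) q(1) by (intro exI[of _ "p * q"]) auto
  qed
  from this[of UNIV] show ?thesis
    using that endo_eqI_axis[of _ 0] by (metis UNIV_I act_simps(1) finite)
qed

text \<open>Over an algebraically closed field coprime means without common root. The roots of
  \<open>q\<close> are stripped one at a time; modulo each linear factor \<open>p\<close> is a
  nonzero constant.\<close>

lemma poly_bezout:
  fixes p q :: "'a::alg_closed_field poly"
  assumes "\<And>a. poly p a = 0 \<Longrightarrow> poly q a \<noteq> 0"
  shows "\<exists>h g. h * q + g * p = 1"
  using assms
proof (induction "degree q" arbitrary: q)
  case 0
  then obtain c where q: "q = [:c:]"
    by (metis degree_eq_zeroE)
  show ?case
  proof (cases "c = 0")
    case False
    then show ?thesis
      by (intro exI[of _ "[:1 / c:]"] exI[of _ 0]) (simp add: q one_pCons)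
  next
    case True
    then have "\<And>a. poly p a \<noteq> 0"
      using 0 q by auto
    then have "degree p = 0"
      using alg_closed_imp_poly_has_root[of p] by blast
    then obtain d where d: "p = [:d:]"
      by (metis degree_eq_zeroE)
    then have "d \<noteq> 0"
      using \<open>\<And>a. poly p a \<noteq> 0\<close> by auto
    then show ?thesis
      by (intro exI[of _ 0] exI[of _ "[:1 / d:]"]) (simp add: d one_pCons)
  qed
next
  case (Suc n)
  then obtain a where "poly q a = 0"
    using alg_closed_imp_poly_has_root[of q] by auto
  then obtain q' where q': "q = [:- a, 1:] * q'"
    by (auto simp: poly_eq_0_iff_dvd)
  moreover have "q' \<noteq> 0"
    using Suc.hyps(2) q' by auto
  ultimately have "degree q = Suc (degree q')"
    by (simp add: q' degree_mult_eq del: mult_pCons_left mult_pCons_right)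
  then obtain h g where hg: "h * q' + g * p = 1"
    using Suc.hyps(1)[of q'] Suc.hyps(2) Suc.prems q' by auto
  define c where "c = poly p a"
  have "c \<noteq> 0"
    using Suc.prems[of a] \<open>poly q a = 0\<close> by (auto simp: c_def)
  have "p = [:- a, 1:] * synthetic_div p a + [:c:]"
    unfolding c_def by (rule synthetic_div_correct'[symmetric])
  then have "[:1 / c:] * (p - [:- a, 1:] * synthetic_div p a) = [:1 / c:] * [:c:]"
    by (metis add_diff_cancel_left')
  also have "\<dots> = 1"
    using \<open>c \<noteq> 0\<close> by (simp add: one_pCons)
  finally have *: "[:1 / c:] * (p - [:- a, 1:] * synthetic_div p a) = 1" .
  \<comment> \<open>The product of the relation for \<open>q'\<close> and the one for the linear
    factor \<open>L\<close> consists of a multiple of \<open>L * q'\<close> and a multiple of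
    \<open>p\<close>.\<close>
  have eq: "(h * q' + g * p) * (C * (p - L * s)) = - (h * C * s) * (L * q') + (h * q' * C + g * (C * (p - L * s))) * p"
    for C L s :: "'a poly"
    by (simp add: left_diff_distrib right_diff_distrib distrib_left distrib_right ac_simps)
  have one: "1 = (h * q' + g * p) * ([:1 / c:] * (p - [:- a, 1:] * synthetic_div p a))"
    unfolding * hg by simp
  show ?case
    using one[unfolded eq] unfolding q' by (intro exI) (rule sym)
qed

text \<open>The idempotent projects onto the part on which \<open>x\<close> is invertible.\<close>

lemma fitting_idempotent:
  fixes x :: "('a::alg_closed_field, 'n::finite) endo"
  obtains q k g where "meval q x * x * (meval q x * x) = meval q x * x"
    "x ^ k * (1 - meval q x * x) = 0" "meval g x * (meval q x * x) = 0" "poly g 0 \<noteq> 0"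
proof -
  obtain p where p: "p \<noteq> 0" "meval p x = 0"
    using ex_poly_annihilator by blast
  define k where "k = order 0 p"
  obtain g where g: "p = [:- 0, 1:] ^ k * g" "\<not> [:- 0, 1:] dvd g"
    using order_decomp[OF p(1), of 0] by (auto simp: k_def)
  have g0: "poly g 0 \<noteq> 0"
    using g(2) by (simp add: poly_eq_0_iff_dvd)
  define t where "t = ([:0, 1:] :: 'a poly)"
  have x: "meval t x = x"
    by (simp add: t_def)
  have xk: "meval (t ^ n) x = x ^ n" for n
    by (induction n) (simp_all add: meval_mult x)
  have "poly g a = 0 \<Longrightarrow> poly (t ^ Suc k) a \<noteq> 0" for a
    using g0 by (auto simp: t_def)
  \<comment> \<open>With the exponent \<open>Suc k\<close> instead of \<open>k\<close>, the
    idempotent \<open>h * t ^ Suc k\<close> is divisible by \<open>t\<close> also for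
    \<open>k = 0\<close>, as the form \<open>meval q x * x\<close> demands.\<close>
  then obtain h b where hb: "h * t ^ Suc k + b * g = 1"
    using poly_bezout[of g "t ^ Suc k"] by blast
  define q where "q = h * t ^ k"
  have tp: "t ^ Suc k * g = t * p"
    using g(1) by (simp add: t_def)
  have e: "meval q x * x = meval (h * t ^ Suc k) x"
    by (simp add: q_def meval_mult x xk power_commutes mult.assoc)
  have one_e: "1 - meval q x * x = meval (b * g) x"
    unfolding e using hb by (metis add_diff_cancel_left' meval_1 meval_diff)
  show thesis
  proof (rule that[of q "Suc k" g])
    have "meval q x * x * (1 - meval q x * x) = meval (h * b * (t ^ Suc k * g)) x"
      by (subst one_e, subst e) (simp add: algebra_simps flip: meval_mult)
    also have "\<dots> = 0"
      unfolding tp by (simp add: meval_mult p)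
    finally show "meval q x * x * (meval q x * x) = meval q x * x"
      by (simp add: algebra_simps)
    have "x ^ Suc k * (1 - meval q x * x) = meval (b * (t ^ Suc k * g)) x"
      unfolding one_e by (simp only: flip: meval_mult xk) (simp only: algebra_simps)
    then show "x ^ Suc k * (1 - meval q x * x) = 0"
      unfolding tp by (simp add: meval_mult p)
    have "meval g x * (meval q x * x) = meval (h * (t ^ Suc k * g)) x"
      unfolding e by (simp only: flip: meval_mult) (simp only: algebra_simps)
    then show "meval g x * (meval q x * x) = 0"
      unfolding tp by (simp add: meval_mult p)
  qed (rule g0)
qed

text \<open>An eigenvalue of \<open>x\<close> on the range of \<open>e\<close>, phrased through
  invertibility. If every shift were invertible in the ring with unit \<open>e\<close>, so would be
  every nonzero polynomial in \<open>x\<close>, being a product of linear factors; but one of them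
  annihilates \<open>x\<close>.\<close>

lemma ex_noninvertible_shift:
  fixes x e :: "('a::alg_closed_field, 'n::finite) endo"
  assumes e: "e * e = e" "e \<noteq> 0" and x: "x * e = x" "e * x = x"
  obtains c where "\<nexists>y. (x - c *e e) * y = e"
proof (rule ccontr)
  assume "\<not> thesis"
  then have inv: "\<exists>y. (x - c *e e) * y = e" for c
    using that by blast
  have "\<exists>y. e * y = y \<and> meval p x * y = e" if "p \<noteq> 0" for p
    using that
  proof (induction "degree p" arbitrary: p)
    case 0
    then obtain c where "p = [:c:]" "c \<noteq> 0"
      by (metis degree_eq_zeroE pCons_0_0)
    then show ?case
      using e by (intro exI[of _ "(1 / c) *e e"]) simp
  next
    case (Suc n)
    then obtain a where "poly p a = 0"
      using alg_closed_imp_poly_has_root[of p] by auto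
    then obtain p' where p': "p = p' * [:- a, 1:]"
      by (metis dvd_def mult.commute poly_eq_0_iff_dvd)
    then have "p' \<noteq> 0"
      using Suc.prems by auto
    then have "degree p = Suc (degree p')"
      by (simp add: p' degree_mult_eq del: mult_pCons_left mult_pCons_right)
    then obtain y' where y': "e * y' = y'" "meval p' x * y' = e"
      using Suc.hyps \<open>p' \<noteq> 0\<close> by auto
    obtain z where z: "(x - a *e e) * z = e"
      using inv by blast
    have "(x - a *e 1) * (e * z) = e"
      using z x e by (simp add: left_diff_distrib flip: mult.assoc)
    moreover have "meval [:- a, 1:] x = x - a *e 1"
      by simp
    ultimately have "meval p x * (e * z * y') = meval p' x * (e * y')"
      unfolding p' meval_mult by (metis mult.assoc)
    then have "meval p x * (e * z * y') = e" "e * (e * z * y') = e * z * y'"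
      using y' e by (simp_all flip: mult.assoc)
    then show ?case
      by blast
  qed
  then show False
    using ex_poly_annihilator[of x] e by (metis mult_zero_left)
qed

section \<open>Rank and trace\<close>

definition rk :: "('a::field, 'n::finite) endo \<Rightarrow> nat" where
  "rk x = vec.dim (range (act x))"

lemma subspace_range_act: "vec.subspace (range (act x))"
  by (metis linear_act vec.linear_subspace_image vec.subspace_UNIV)

lemma rk_less: "range (act x) \<subset> range (act y) \<Longrightarrow> rk x < rk y"
  unfolding rk_def by (rule vec.dim_psubset) (simp add: subspace_range_act vec.span_eq_iff[THEN iffD2])

lemma ex_projection:
  fixes S :: "('a::field^'n) set"
  assumes "vec.subspace S"
  obtains P where "P * P = P" "range (act P) = S" "\<And>u. u \<in> S \<Longrightarrow> act P u = u"
proof -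
  have "Vector_Spaces.linear (*s) (*s) (id :: 'a^'n \<Rightarrow> 'a^'n)"
    by (simp add: vec.linear_id)
  then obtain g where g: "g ` UNIV \<subseteq> S" "Vector_Spaces.linear (*s) (*s) g" "\<forall>v\<in>S. g (id v) = v"
    using vec.linear_exists_left_inverse_on[of id S] assms by auto
  obtain P where P: "act P = g"
    using endo_of_linear g(2) by blast
  show thesis
  proof
    show "P * P = P"
      by (rule endo_eqI) (use P g in auto)
    show *: "act P u = u" if "u \<in> S" for u
      using P g(3) that by simp
    have "S \<subseteq> range (act P)"
      using * by (metis rangeI subsetI)
    then show "range (act P) = S"
      using P g(1) by simp
  qed
qed

text \<open>With \<open>P\<close> a projection onto the range of \<open>x\<close>,
  \<open>tr x = tr (P * x) = tr (x * P)\<close>, and \<open>x * P\<close> is nilpotent of smaller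
  rank, since \<open>x\<close> does not map its nonzero range onto itself. Used contrapositively, a
  nonzero trace is a polynomial certificate against nilpotency.\<close>

lemma tr_nilpotent:
  fixes x :: "('a::field, 'n::finite) endo"
  assumes "x ^ k = 0"
  shows "tr x = 0"
  using assms
proof (induction "rk x" arbitrary: x rule: less_induct)
  case less
  show ?case
  proof (cases "x = 0")
    case False
    obtain P where P: "P * P = P" "range (act P) = range (act x)" "\<And>u. u \<in> range (act x) \<Longrightarrow> act P u = u"
      using ex_projection[OF subspace_range_act] by metis
    have Px: "P * x = x"
      by (rule endo_eqI) (use P in auto)
    have pow: "(x * P) ^ Suc n = x ^ Suc n * P" for n
    proof (induction n)
      case (Suc n)
      have "(x * P) ^ Suc (Suc n) = x ^ Suc n * P * (x * P)"
        by (subst power_Suc2) (simp only: Suc)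
      also have "\<dots> = x ^ Suc n * (P * x) * P"
        by (simp only: mult.assoc)
      also have "\<dots> = x ^ Suc (Suc n) * P"
        unfolding Px by (subst (2) power_Suc2) (rule refl)
      finally show ?case .
    qed simp
    have "x ^ Suc k = 0"
      using less.prems by simp
    then have nil: "(x * P) ^ k = 0"
      using pow less.prems by (cases k) auto
    have "range (act (x * P)) \<subseteq> range (act x)"
      by auto
    moreover have "range (act (x * P)) \<noteq> range (act x)"
    proof
      assume eq: "range (act (x * P)) = range (act x)"
      have "range (act x) = act (x ^ n) ` range (act x)" for n
      proof (induction n)
        case (Suc n)
        have "act (x ^ Suc n) ` range (act x) = act x ` act (x ^ n) ` range (act x)"
          by (simp add: image_image)
        also have "\<dots> = act x ` range (act P)"
          using Suc P(2) by simp
        also have "\<dots> = range (act (x * P))"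
          by (simp add: image_image)
        finally show ?case
          using eq by simp
      qed simp
      from this[of k] have "act x u = 0" for u
        using less.prems by (auto simp: image_def)
      then show False
        using False endo_eqI[of x 0] by simp
    qed
    ultimately have "rk (x * P) < rk x"
      by (intro rk_less) auto
    then have "tr (x * P) = 0"
      using less.hyps nil by blast
    then show ?thesis
      using tr_mult_commute[of x P] Px by simp
  qed simp
qed

text \<open>In characteristic zero this reads off the rank from the trace: traces of proper
  projections are neither zero nor full, and a projection has the same rank as its adjoint.\<close>

lemma tr_idempotent:
  fixes e :: "('a::field, 'n::finite) endo"
  assumes "e * e = e"
  shows "tr e = of_nat (rk e)"
  using assms
proof (induction "rk e" arbitrary: e rule: less_induct)
  case less
  show ?case
  proof (cases "e = 0")
    case True
    then show ?thesis
      by (simp add: rk_def image_def)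
  next
    case False
    then obtain w where w: "act e w \<noteq> 0"
      using endo_eqI[of e 0] by auto
    define u where "u = act e w"
    have eu: "act e u = u"
      unfolding u_def by (metis act_mult less.prems)
    obtain i where i: "u $ i \<noteq> 0"
      using w by (auto simp: u_def vec_eq_iff)
    \<comment> \<open>The projection onto the line of \<open>u\<close> along the hyperplane where
      coordinate \<open>i\<close> vanishes.\<close>
    define R where "R = Endo (\<chi> j l. if l = i then u $ j / u $ i else 0)"
    have R_entry: "entry R j l = (if l = i then u $ j / u $ i else 0)" for j l
      by (simp add: R_def entry.abs_eq)
    have R: "act R v = (v $ i / u $ i) *s u" for v
    proof -
      have "entry R j l * v $ l = (if l = i then u $ j / u $ i * v $ i else 0)" for j l
        by (simp add: R_entry)
      then show ?thesis
        by (simp add: vec_eq_iff act_vec_nth)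
    qed
    have eR: "e * R = R"
      by (rule endo_eqI) (simp add: R eu)
    have RR: "R * R = R"
      by (rule endo_eqI) (simp add: R i)
    have "tr R = 1"
      using i by (simp add: tr_eq_sum_entry R_entry)
    define f where "f = e - R * e"
    have ff: "f * f = f"
    proof -
      have "e * (R * e) = R * e" "R * e * e = R * e"
        using less.prems eR by (simp_all add: mult.assoc) (simp flip: mult.assoc)
      moreover from this have "R * e * (R * e) = R * e"
        by (metis RR mult.assoc)
      ultimately show ?thesis
        by (simp add: f_def left_diff_distrib right_diff_distrib less.prems)
    qed
    have ef: "e * f = f"
      unfolding f_def using less.prems eR by (simp add: right_diff_distrib flip: mult.assoc)
    have fu: "act f u = 0"
      unfolding f_def using i by (simp add: R eu)
    have "u \<notin> range (act f)"
    proof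
      assume "u \<in> range (act f)"
      then obtain v where "u = act f v"
        by blast
      then have "act f u = u"
        using ff by (simp flip: act_mult)
      then show False
        using fu i by auto
    qed
    moreover have "act f v = act e (act f v)" for v
      using ef by (simp flip: act_mult)
    then have "u \<in> range (act e)" "range (act f) \<subseteq> range (act e)"
      by (auto simp: u_def)
    ultimately have less_rk: "rk f < rk e"
      by (intro rk_less) auto
    have "rk e \<le> Suc (rk f)"
    proof -
      have "range (act e) \<subseteq> vec.span (insert u (range (act f)))"
      proof
        fix v assume "v \<in> range (act e)"
        then obtain w where "v = act e w"
          by blast
        then have "act e v = v"
          using less.prems by (simp flip: act_mult)
        then have "v = act f v + (v $ i / u $ i) *s u"
          by (simp add: f_def R)
        then show "v \<in> vec.span (insert u (range (act f)))"
          by (metis insertI1 insertI2 rangeI vec.span_add vec.span_base vec.span_scale)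
      qed
      then have "rk e \<le> vec.dim (insert u (range (act f)))"
        unfolding rk_def by (metis vec.dim_span vec.dim_subset)
      also have "\<dots> \<le> Suc (rk f)"
        unfolding rk_def by (simp add: vec.dim_insert)
      finally show ?thesis .
    qed
    then have "rk e = Suc (rk f)"
      using less_rk by simp
    moreover have "tr e = tr f + tr (R * e)"
      by (simp add: f_def)
    moreover have "tr (R * e) = 1"
      using tr_mult_commute[of R e] eR \<open>tr R = 1\<close> by simp
    ultimately show ?thesis
      using less.hyps[OF less_rk ff] by simp
  qed
qed

lemma rk_0_iff: "rk x = 0 \<longleftrightarrow> x = 0"
proof
  assume "rk x = 0"
  then have "act x u = 0" for u
    unfolding rk_def by (metis empty_iff insertE rangeI subsetD vec.dim_eq_0)
  then show "x = 0"
    using endo_eqI[of x 0] by simp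
qed (simp add: rk_def image_def)

lemma ex_kernel:
  fixes x :: "('a::field, 'n::finite) endo"
  assumes "\<nexists>y. x * y = 1"
  obtains v where "v \<noteq> 0" "act x v = 0"
proof (rule ccontr)
  assume "\<not> thesis"
  then have "v = 0" if "act x v = 0" for v
    using that \<open>\<And>v. v \<noteq> 0 \<Longrightarrow> act x v = 0 \<Longrightarrow> thesis\<close> by blast
  then have "inj (act x)"
    by (intro injI) (metis act_linear(2) eq_iff_diff_eq_0)
  then have "\<exists>B. B ** matrix_of x = mat 1"
    by (simp add: matrix_left_invertible_injective act.rep_eq)
  then obtain B where "matrix_of x ** B = mat 1"
    using matrix_left_right_inverse by blast
  then have "x * Endo B = 1"
    by (simp flip: matrix_of_inject add: times_endo.rep_eq one_endo.rep_eq)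
  then show False
    using assms by blast
qed

text \<open>A factor \<open>t\<close> is carried along for the induction on the exponent of
  \<open>a\<close>: once \<open>a\<close> kills \<open>T\<close>, powers of \<open>a + c\<close> act
  on \<open>T\<close> as powers of \<open>c\<close>.\<close>

lemma nilpotent_add:
  fixes a c :: "'r::ring_1"
  assumes ac: "a * c = c * a" and nil: "a ^ k = 0" "c ^ l = 0"
  obtains n where "(a + c) ^ n = 0"
proof -
  have "\<exists>n. (a + c) ^ n * t = 0" if "a * t = t * a" "c * t = t * c" "a ^ k * t = 0" for t k
    using that
  proof (induction k arbitrary: t)
    case (Suc k)
    have "a ^ k * (a * t) = 0"
      using Suc.prems(3) by (simp only: power_Suc2 mult.assoc)
    moreover have "a * (a * t) = a * t * a" "c * (a * t) = a * t * c"
      using Suc.prems ac by (simp_all add: mult.assoc) (simp_all flip: mult.assoc)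
    ultimately obtain n where n: "(a + c) ^ n * (a * t) = 0"
      using Suc.IH by blast
    define T where "T = (a + c) ^ n * t"
    have "a * (a + c) ^ n = (a + c) ^ n * a"
      using power_commuting_commutes[of "a + c" a n] ac by (simp add: distrib_left distrib_right)
    then have "a * T = 0"
      using n by (simp add: T_def flip: mult.assoc)
    moreover have "a * c ^ j = c ^ j * a" for j
      using power_commuting_commutes[of c a j] ac by simp
    ultimately have acj: "a * (c ^ j * T) = 0" for j
      by (simp flip: mult.assoc) (simp add: mult.assoc)
    have "(a + c) ^ j * T = c ^ j * T" for j
    proof (induction j)
      case (Suc j)
      have "(a + c) ^ Suc j * T = (a + c) * (c ^ j * T)"
        by (simp only: power_Suc mult.assoc Suc)
      then show ?case
        using acj[of j] by (simp add: distrib_right mult.assoc)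
    qed simp
    from this[of l] have "(a + c) ^ (l + n) * t = 0"
      using nil by (simp add: T_def power_add mult.assoc)
    then show ?case
      by blast
  qed auto
  from this[of 1 k] nil show ?thesis
    using that by auto
qed

lemma nilpotent_kernel:
  assumes "x ^ k = (0 :: ('a::field, 'n::finite) endo)" "u \<noteq> 0"
  obtains i where "act (x ^ i) u \<noteq> 0" "act x (act (x ^ i) u) = 0"
proof -
  define l where "l = (LEAST l. act (x ^ l) u = 0)"
  have l: "act (x ^ l) u = 0"
    unfolding l_def by (rule LeastI[of _ k]) (simp add: assms)
  have l': "act (x ^ j) u \<noteq> 0" if "j < l" for j
    using not_less_Least that unfolding l_def by blast
  obtain i where i: "l = Suc i"
    using l assms(2) by (cases l) auto
  show thesis
    using that[of i] l l'[of i] by (simp add: i)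
qed

section \<open>Polynomial functions\<close>

text \<open>One set of closure rules serves two rings: the polynomial functions on pairs of matrices
  (\<open>pairfuns\<close>) and those of a single parameter (\<open>linefuns\<close>).\<close>

definition funring :: "('p \<Rightarrow> 'a::field) set \<Rightarrow> bool" where
  "funring R \<longleftrightarrow> (\<forall>c. (\<lambda>p. c) \<in> R) \<and>
     (\<forall>f g. f \<in> R \<longrightarrow> g \<in> R \<longrightarrow> (\<lambda>p. f p + g p) \<in> R \<and> (\<lambda>p. f p * g p) \<in> R)"

definition entries_in :: "('p \<Rightarrow> 'a::field) set \<Rightarrow> ('p \<Rightarrow> ('a, 'n::finite) endo) \<Rightarrow> bool" where
  "entries_in R X \<longleftrightarrow> (\<forall>i j. (\<lambda>p. entry (X p) i j) \<in> R)"

context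
  fixes R :: "('p \<Rightarrow> 'a::field) set"
  assumes R: "funring R"
begin

lemma funring_const: "(\<lambda>p. c) \<in> R"
  using R by (simp add: funring_def)

lemma funring_add: "f \<in> R \<Longrightarrow> g \<in> R \<Longrightarrow> (\<lambda>p. f p + g p) \<in> R"
  using R by (simp add: funring_def)

lemma funring_mult: "f \<in> R \<Longrightarrow> g \<in> R \<Longrightarrow> (\<lambda>p. f p * g p) \<in> R"
  using R by (simp add: funring_def)

lemma funring_sum: "(\<And>i. i \<in> I \<Longrightarrow> f i \<in> R) \<Longrightarrow> (\<lambda>p. \<Sum>i\<in>I. f i p) \<in> R"
  by (induction I rule: infinite_finite_induct) (simp_all add: funring_const funring_add)

lemma funring_prod: "(\<And>i. i \<in> I \<Longrightarrow> f i \<in> R) \<Longrightarrow> (\<lambda>p. \<Prod>i\<in>I. f i p) \<in> R"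
  by (induction I rule: infinite_finite_induct) (simp_all add: funring_const funring_mult)

lemma entries_const: "entries_in R (\<lambda>p. x)"
  by (simp add: entries_in_def funring_const)

lemma entries_add: "entries_in R X \<Longrightarrow> entries_in R Y \<Longrightarrow> entries_in R (\<lambda>p. X p + Y p)"
  by (simp add: entries_in_def funring_add)

lemma entries_smul: "f \<in> R \<Longrightarrow> entries_in R X \<Longrightarrow> entries_in R (\<lambda>p. f p *e X p)"
  by (simp add: entries_in_def funring_mult)

lemma entries_mult:
  "entries_in R X \<Longrightarrow> entries_in R Y \<Longrightarrow> entries_in R (\<lambda>p. X p * Y p)"
  by (simp add: entries_in_def entry_mult funring_mult funring_sum)

lemma entries_diff: "entries_in R X \<Longrightarrow> entries_in R Y \<Longrightarrow> entries_in R (\<lambda>p. X p - Y p)"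
  using entries_add[OF _ entries_smul[OF funring_const, of Y "-1"], of X] by simp

lemma entries_meval: "entries_in R X \<Longrightarrow> entries_in R (\<lambda>p. meval q (X p))"
  by (induction q) (simp_all add: entries_const entries_add entries_mult)

lemma funring_tr: "entries_in R X \<Longrightarrow> (\<lambda>p. tr (X p)) \<in> R"
  by (simp add: tr_eq_sum_entry entries_in_def funring_sum)

lemma funring_detm: "entries_in R X \<Longrightarrow> (\<lambda>p. detm (X p)) \<in> R"
  unfolding entries_in_def detm.rep_eq det_def entry.rep_eq
  by (intro funring_sum funring_mult funring_const funring_prod) auto

end

text \<open>The adjugate, written by Cramer's rule. Its entries, unlike those of the inverse, are
  polynomial in the matrix, so a linear system can be solved inside a polynomial
  deformation.\<close>

lift_definition adjm :: "('a::field, 'n::finite) endo \<Rightarrow> ('a, 'n) endo" is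
  "\<lambda>M. \<chi> k j. det (\<chi> i l. if l = k then axis j 1 $ i else M $ i $ l)" .

lemma mult_adjm:
  fixes M :: "('a::field, 'n::finite) endo"
  assumes "detm M \<noteq> 0"
  shows "M * adjm M = detm M *e 1"
proof (rule endo_eqI_axis)
  fix j
  have *: "N *v (\<chi> k. det (\<chi> i l. if l = k then axis j 1 $ i else N $ i $ l)) = det N *s axis j 1"
    if N: "det N \<noteq> 0" for N :: "'a^'n^'n"
  proof -
    define c where "c = (\<chi> k. det (\<chi> i l. if l = k then axis j 1 $ i else N $ i $ l))"
    have "N *v (\<chi> k. c $ k / det N) = axis j 1"
      by (subst cramer[OF N]) (simp add: c_def)
    moreover have "c = det N *s (\<chi> k. c $ k / det N)"
      using N by (simp add: vec_eq_iff)
    ultimately have "N *v c = det N *s axis j 1"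
      by (metis vector_scalar_commute)
    then show ?thesis
      by (simp add: c_def)
  qed
  have "act (adjm M) (axis j 1) = (\<chi> k. entry (adjm M) k j)"
    by (simp add: vec_eq_iff entry_act)
  then have "act M (act (adjm M) (axis j 1)) = detm M *s axis j 1"
    using assms *[of "matrix_of M"]
    by (simp add: adjm.rep_eq entry.rep_eq act.rep_eq detm.rep_eq)
  then show "act (M * adjm M) (axis j 1) = act (detm M *e 1) (axis j 1)"
    by simp
qed

lemma detm_1 [simp]: "detm 1 = 1"
  by transfer simp

lemma detm_mult: "detm (x * y) = detm x * detm y"
  by transfer (rule det_mul)

lemma detm_nz_iff: "detm x \<noteq> 0 \<longleftrightarrow> (\<exists>y. x * y = 1)"
proof
  assume "detm x \<noteq> 0"
  then have "x * ((1 / detm x) *e adjm x) = 1"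
    by (simp add: mult_adjm)
  then show "\<exists>y. x * y = 1"
    by blast
next
  assume "\<exists>y. x * y = 1"
  then show "detm x \<noteq> 0"
    by (metis detm_1 detm_mult mult_zero_left zero_neq_one)
qed

lemma adjm_1 [simp]: "adjm 1 = (1 :: ('a::field, 'n::finite) endo)"
  using mult_adjm[of "1 :: ('a, 'n) endo"] by simp

lemma entries_adjm:
  assumes R: "funring R" and X: "entries_in R X"
  shows "entries_in R (\<lambda>p. adjm (X p))"
proof -
  have eq: "(\<lambda>p. entry (adjm (X p)) k j) = (\<lambda>p. detm (Endo (\<chi> i l. if l = k then axis j 1 $ i else entry (X p) i l)))"
    for k j
    by (simp add: adjm.rep_eq entry.rep_eq detm.rep_eq cong: if_cong)
  have ent: "entries_in R (\<lambda>p. Endo (\<chi> i l. if l = k then axis j 1 $ i else entry (X p) i l))" for k j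
  proof -
    have "(\<lambda>p. if l = k then axis j 1 $ i else entry (X p) i l) \<in> R" for i l
      using X funring_const[OF R] by (cases "l = k") (auto simp: entries_in_def)
    then show ?thesis
      by (simp add: entries_in_def)
  qed
  show ?thesis
    unfolding entries_in_def eq using funring_detm[OF R ent] by blast
qed

section \<open>Polynomial functions on pairs and along lines\<close>

definition polyfun :: "(('a::field, 'n::finite) endo \<Rightarrow> ('a, 'n) endo \<Rightarrow> 'a) \<Rightarrow> bool" where
  "polyfun F \<longleftrightarrow> (\<lambda>p. F (Endo (fst p)) (Endo (snd p))) \<in> polynomial_functions"

lemma polyfun_compose:
  assumes F: "polyfun F" and R: "funring R" and X: "entries_in R X" and Y: "entries_in R Y"
  shows "(\<lambda>p. F (X p) (Y p)) \<in> R"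
proof -
  have "(\<lambda>p. f (matrix_of (X p), matrix_of (Y p))) \<in> R" if "f \<in> polynomial_functions" for f
    using that
  proof induction
    case (fst i j)
    then show ?case
      using X by (simp add: entries_in_def entry.rep_eq)
  next
    case (snd i j)
    then show ?case
      using Y by (simp add: entries_in_def entry.rep_eq)
  next
    case (const c)
    show ?case
      by (rule funring_const[OF R])
  next
    case (add f g)
    then show ?case
      by (intro funring_add[OF R])
  next
    case (mult f g)
    then show ?case
      by (intro funring_mult[OF R])
  qed
  from this[OF F[unfolded polyfun_def]] show ?thesis
    by (simp add: matrix_of_inverse)
qed

definition pairfuns :: "(('a::field, 'n::finite) endo \<times> ('a, 'n) endo \<Rightarrow> 'a) set" where
  "pairfuns = {h. polyfun (\<lambda>x y. h (x, y))}"

lemma funring_pairfuns: "funring pairfuns"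
  by (simp add: funring_def pairfuns_def polyfun_def polynomial_functions.const
      polynomial_functions.add polynomial_functions.mult)

lemma entries_fst: "entries_in pairfuns fst" and entries_snd: "entries_in pairfuns snd"
  by (simp_all add: entries_in_def pairfuns_def polyfun_def polynomial_functions.fst
      polynomial_functions.snd)

lemma polyfunI: "(\<lambda>p. H (fst p) (snd p)) \<in> pairfuns \<Longrightarrow> polyfun H"
  by (simp add: pairfuns_def)

definition linefuns :: "('a::field \<Rightarrow> 'a) set" where
  "linefuns = {f. \<exists>q. \<forall>s. f s = poly q s}"

lemma funring_linefuns: "funring linefuns"
proof -
  have "\<exists>q. \<forall>s. c = poly q s" for c :: 'a
    by (rule exI[of _ "[:c:]"]) simp
  then show ?thesis
    unfolding funring_def linefuns_def by (auto simp flip: poly_add poly_mult)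
qed

lemma linefuns_id: "(\<lambda>s. s) \<in> linefuns"
  unfolding linefuns_def by (auto intro!: exI[of _ "[:0, 1:]"])

lemma linefuns_vanish:
  fixes f :: "'a::field_char_0 \<Rightarrow> 'a"
  assumes "f \<in> linefuns" "finite E" "\<And>s. s \<notin> E \<Longrightarrow> f s = 0"
  shows "f s = 0"
proof -
  obtain q where q: "\<And>s. f s = poly q s"
    using assms(1) by (auto simp: linefuns_def)
  have "- E \<subseteq> {s. poly q s = 0}"
    using assms(3) q by auto
  moreover have "infinite (- E)"
    using assms(2) by (simp add: Compl_eq_Diff_UNIV infinite_UNIV_char_0)
  ultimately have "q = 0"
    using poly_roots_finite[of q] finite_subset by blast
  then show ?thesis
    by (simp add: q)
qed

lemma linefuns_finite_zeros:
  fixes f :: "'a::field \<Rightarrow> 'a"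
  assumes "f \<in> linefuns" "f s\<^sub>0 \<noteq> 0"
  shows "finite {s. f s = 0}"
proof -
  obtain q where q: "\<And>s. f s = poly q s"
    using assms(1) by (auto simp: linefuns_def)
  then have "q \<noteq> 0"
    using assms(2) by auto
  then show ?thesis
    using poly_roots_finite[of q] by (simp add: q)
qed

text \<open>\<open>D\<close> is a certificate of genericity: nonzero at one parameter, hence at all
  but finitely many.\<close>

lemma linefuns_vanish_generic:
  fixes f :: "'a::field_char_0 \<Rightarrow> 'a"
  assumes "f \<in> linefuns" "D \<in> linefuns" "D s\<^sub>0 \<noteq> 0" "\<And>s. D s \<noteq> 0 \<Longrightarrow> f s = 0"
  shows "f s = 0"
  using linefuns_vanish[OF assms(1) linefuns_finite_zeros[OF assms(2,3)]] assms(4) by blast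

section \<open>Odd self-adjoint operators\<close>

locale quadratic_involution =
  fixes b :: "'a::{alg_closed_field, field_char_0}^'n \<Rightarrow> 'a^'n \<Rightarrow> 'a" and A :: "('a, 'n) endo"
  assumes b_add: "b (u + v) w = b u w + b v w"
    and b_scale: "b (c *s u) w = c * b u w"
    and b_sym: "b u v = b v u"
    and b_nondeg: "(\<And>v. b u v = 0) \<Longrightarrow> u = 0"
    and AA [simp]: "A * A = 1"
    and b_A: "b (act A u) v = b u (act A v)"
begin

lemma b_add_right: "b w (u + v) = b w u + b w v"
  by (metis b_add b_sym)

lemma b_scale_right: "b w (c *s u) = c * b w u"
  by (metis b_scale b_sym)

lemma b_0 [simp]: "b 0 w = 0" "b w 0 = 0"
  using b_scale[of 0 0 w] b_scale_right[of w 0 0] by simp_all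

lemma b_minus: "b (- u) w = - b u w" "b w (- u) = - b w u"
  using b_scale[of "-1" u w] b_scale_right[of w "-1" u] by (simp_all add: vec.scale_minus_left)

lemma b_diff: "b (u - v) w = b u w - b v w" "b w (u - v) = b w u - b w v"
  using b_add[of u "-v" w] b_add_right[of w u "-v"] by (simp_all add: b_minus)

lemmas b_simps = b_add b_add_right b_scale b_scale_right b_minus b_diff

lemma b_sum: "b (\<Sum>i\<in>I. f i) w = (\<Sum>i\<in>I. b (f i) w)"
  by (induction I rule: infinite_finite_induct) (simp_all add: b_simps)

lemma b_eqI: "(\<And>w. b u w = b v w) \<Longrightarrow> u = v"
  using b_nondeg[of "u - v"] by (simp add: b_simps)

section \<open>Adjoints and rank-one operators\<close>

definition gram :: "('a, 'n) endo" where
  "gram = Endo (\<chi> i j. b (axis i 1) (axis j 1))"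

lemma b_gram: "b u v = (\<Sum>i\<in>UNIV. u $ i * act gram v $ i)"
proof -
  have *: "b w v = (\<Sum>i\<in>UNIV. v $ i * b w (axis i 1))" for w v
    by (subst basis_expansion[of v, symmetric], subst b_sym, subst b_sum)
      (simp add: b_simps b_sym[of w])
  have "act gram v $ i = b (axis i 1) v" for i
    by (subst *) (simp add: act_vec_nth gram_def mult.commute)
  then show ?thesis
    using *[of v u] by (simp add: b_sym)
qed

definition gram_inv :: "('a, 'n) endo" where
  "gram_inv = (SOME y. gram * y = 1)"

lemma gram_gram_inv: "gram * gram_inv = 1"
proof -
  have "v = 0" if "act gram v = 0" for v
    by (rule b_nondeg) (subst b_sym, simp add: b_gram that)
  then have "inj (act gram)"
    by (intro injI) (metis act_linear(2) eq_iff_diff_eq_0)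
  then have "\<exists>B. B ** matrix_of gram = mat 1"
    by (simp add: matrix_left_invertible_injective act.rep_eq)
  then obtain B where "matrix_of gram ** B = mat 1"
    using matrix_left_right_inverse by blast
  then have "gram * Endo B = 1"
    by (simp flip: matrix_of_inject add: times_endo.rep_eq one_endo.rep_eq)
  then show ?thesis
    unfolding gram_inv_def by (rule someI)
qed

text \<open>The adjoint for \<open>b\<close>. The formula through the Gram matrix makes its entries
  polynomial in those of \<open>x\<close>, so adjoints may enter polynomial deformations.\<close>

definition star :: "('a, 'n) endo \<Rightarrow> ('a, 'n) endo" where
  "star x = gram_inv * Endo (transpose (matrix_of x)) * gram"

lemma b_star: "b (act x u) v = b u (act (star x) v)"
proof -
  have "(\<Sum>i\<in>UNIV. act x u $ i * w $ i) = (\<Sum>i\<in>UNIV. u $ i * act (Endo (transpose (matrix_of x))) w $ i)" for w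
    by (simp add: act_vec_nth entry.rep_eq transpose_def sum_distrib_left sum_distrib_right)
      (subst sum.swap, simp add: mult_ac)
  moreover have "act gram (act (star x) v) = act (Endo (transpose (matrix_of x))) (act gram v)"
    unfolding star_def by (metis act_1 act_mult gram_gram_inv)
  ultimately show ?thesis
    by (simp add: b_gram del: act_vec_nth)
qed

lemma b_star': "b (act (star x) u) v = b u (act x v)"
  by (metis b_star b_sym)

lemma star_eqI: "(\<And>u v. b (act x u) v = b u (act y v)) \<Longrightarrow> star x = y"
  by (rule endo_eqI, rule b_eqI) (metis b_star' b_sym)

lemma star_star [simp]: "star (star x) = x"
  by (rule star_eqI) (rule b_star')

lemma star_simps [simp]:
  "star (x * y) = star y * star x" "star (x + y) = star x + star y"
  "star (x - y) = star x - star y" "star (- x) = - star x" "star (c *e x) = c *e star x"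
  "star 0 = 0" "star 1 = 1"
  by (rule star_eqI, simp add: b_simps b_star b_A)+

lemma star_A [simp]: "star A = A"
  by (rule star_eqI) (rule b_A)

lemma star_meval: "star x = x \<Longrightarrow> star (meval q x) = meval q x"
  by (induction q) (simp_all add: meval_commute)

lemma entries_star:
  assumes R: "funring R" and X: "entries_in R X"
  shows "entries_in R (\<lambda>p. star (X p))"
proof -
  have "entries_in R (\<lambda>p. Endo (transpose (matrix_of (X p))))"
    using X by (simp add: entries_in_def entry.rep_eq transpose_def)
  then show ?thesis
    unfolding star_def by (intro entries_mult[OF R] entries_const[OF R])
qed

definition ten :: "'a^'n \<Rightarrow> 'a^'n \<Rightarrow> ('a, 'n) endo" where
  "ten u v = Endo (\<chi> i j. u $ i * b v (axis j 1))"

lemma act_ten [simp]: "act (ten u v) w = b v w *s u"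
proof -
  have "b v w = (\<Sum>i\<in>UNIV. w $ i * b v (axis i 1))"
    by (subst basis_expansion[of w, symmetric], subst b_sym, subst b_sum)
      (simp add: b_simps b_sym[of v])
  then show ?thesis
    by (simp add: vec_eq_iff act_vec_nth ten_def sum_distrib_left sum_distrib_right mult_ac)
qed

lemma mult_ten [simp]:
  "x * ten u v = ten (act x u) v" "ten u v * x = ten u (act (star x) v)"
  by (rule endo_eqI, simp add: b_star')+

lemma star_ten [simp]: "star (ten u v) = ten v u"
  by (rule star_eqI) (simp add: b_simps b_sym)

lemma ten_simps [simp]: "ten 0 v = 0" "ten u 0 = 0" "ten (- u) v = - ten u v" "ten u (- v) = - ten u v"
  "ten (c *s u) v = c *e ten u v" "ten u (c *s v) = c *e ten u v"
  by (rule endo_eqI, simp add: b_simps vec.scale_minus_left)+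

lemma ten_add: "ten (u + u') v = ten u v + ten u' v" "ten u (v + v') = ten u v + ten u v'"
  by (rule endo_eqI, simp add: b_simps vec.scale_right_distrib vec.scale_left_distrib)+

lemma tr_ten [simp]: "tr (ten u v) = b u v"
proof -
  have "tr (ten u v) = (\<Sum>i\<in>UNIV. u $ i * b v (axis i 1))"
    by (simp add: tr_eq_sum_entry ten_def )
  also have "\<dots> = b (\<Sum>i\<in>UNIV. u $ i *s axis i 1) v"
    by (simp add: b_sum b_simps b_sym[of v])
  finally show ?thesis
    by (simp add: basis_expansion)
qed

text \<open>Nondegenerate \<open>A\<close>-stable subspaces are represented by their orthogonal projections.\<close>

definition good :: "('a, 'n) endo \<Rightarrow> bool" where
  "good e \<longleftrightarrow> e * e = e \<and> star e = e \<and> A * e = e * A"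

text \<open>Operators on a subspace are extended by zero to the whole space. All subspaces then
  share one ring, and a pair on an orthogonal sum is the sum of two pairs.\<close>

definition odds :: "('a, 'n) endo \<Rightarrow> ('a, 'n) endo set" where
  "odds e = {x. star x = x \<and> A * x = - (x * A) \<and> x * e = x}"

definition commuting :: "('a, 'n) endo \<Rightarrow> ('a, 'n) endo \<Rightarrow> ('a, 'n) endo \<Rightarrow> bool" where
  "commuting e x y \<longleftrightarrow> x \<in> odds e \<and> y \<in> odds e \<and> x * y = y * x"

definition oddpoly :: "'a poly \<Rightarrow> ('a, 'n) endo \<Rightarrow> ('a, 'n) endo" where
  "oddpoly r x = x * meval r (x * x)"

text \<open>Zariski density of the points \<open>(x, oddpoly r x)\<close> in the commuting variety of the subspace \<open>e\<close>.\<close>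

definition dense_oddpoly :: "('a, 'n) endo \<Rightarrow> bool" where
  "dense_oddpoly e \<longleftrightarrow> (\<forall>F. polyfun F \<longrightarrow> (\<forall>x\<in>odds e. \<forall>r. F x (oddpoly r x) = 0)
     \<longrightarrow> (\<forall>x y. commuting e x y \<longrightarrow> F x y = 0))"

lemma goodD: "good e \<Longrightarrow> e * e = e" "good e \<Longrightarrow> star e = e" "good e \<Longrightarrow> A * e = e * A"
  by (simp_all add: good_def)

lemma oddsD: "x \<in> odds e \<Longrightarrow> star x = x" "x \<in> odds e \<Longrightarrow> A * x = - (x * A)" "x \<in> odds e \<Longrightarrow> x * e = x"
  by (simp_all add: odds_def)

lemma odds_left:
  assumes "good e" "x \<in> odds e"
  shows "e * x = x"
proof -
  have "star (x * e) = star x"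
    using oddsD(3)[OF assms(2)] by simp
  then show ?thesis
    using goodD(2)[OF assms(1)] oddsD(1)[OF assms(2)] by simp
qed

lemma A_square:
  assumes "A * x = - (x * A)"
  shows "A * (x * x) = x * x * A"
proof -
  have "A * (x * x) = (A * x) * x"
    by (simp only: mult.assoc)
  also have "\<dots> = - (x * (A * x))"
    by (simp only: assms mult_minus_left mult.assoc)
  also have "\<dots> = x * x * A"
    by (simp add: assms mult.assoc)
  finally show ?thesis .
qed

lemma oddpoly_odds:
  assumes "good e" "x \<in> odds e"
  shows "oddpoly r x \<in> odds e"
proof -
  note x = oddsD[OF assms(2)] odds_left[OF assms]
  define m where "m = meval r (x * x)"
  have mx: "m * x = x * m"
    unfolding m_def by (rule meval_commute) (simp only: mult.assoc)
  have mA: "m * A = A * m"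
    unfolding m_def by (rule meval_commute) (simp only: A_square[OF x(2)])
  have "x * x * e = e * (x * x)"
    using x(3,4) by (simp add: mult.assoc) (simp flip: mult.assoc)
  then have me: "m * e = e * m"
    unfolding m_def by (rule meval_commute)
  have "star m = m"
    unfolding m_def by (rule star_meval) (simp add: x)
  moreover have "A * (x * m) = - (x * m * A)"
    by (simp add: mA mult.assoc) (simp add: x(2) flip: mult.assoc)
  moreover have "x * m * e = x * m"
    by (simp add: me mult.assoc) (simp add: x(3) flip: mult.assoc)
  ultimately show ?thesis
    using x mx by (simp add: odds_def oddpoly_def flip: m_def)
qed

lemma commuting_oddpoly:
  assumes "good e" "x \<in> odds e"
  shows "commuting e x (oddpoly r x)"
proof -
  have "meval r (x * x) * x = x * meval r (x * x)"
    by (rule meval_commute) (simp add: mult.assoc)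
  then show ?thesis
    using assms by (simp add: commuting_def oddpoly_odds) (simp add: oddpoly_def mult.assoc)
qed

lemma good_diff:
  assumes "good e" "good e'" "e' * e = e'"
  shows "good (e - e')" "e * e' = e'"
proof -
  show e: "e * e' = e'"
    using assms by (metis goodD(2) star_simps(1))
  show "good (e - e')"
    using assms e by (simp add: good_def left_diff_distrib right_diff_distrib)
qed

lemma rk_good_less:
  assumes "good e" "good e'" "e' * e = e'" "e' \<noteq> e"
  shows "rk e' < rk e"
proof (rule rk_less)
  note e = good_diff(2)[OF assms(1-3)]
  have "act e' u = act e (act e' u)" for u
    using e by (simp flip: act_mult)
  then have "range (act e') \<subseteq> range (act e)"
    by (metis image_subsetI rangeI)
  moreover have "range (act e') \<noteq> range (act e)"
  proof
    assume eq: "range (act e') = range (act e)"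
    have "act e u = act (e' * e) u" for u
    proof -
      obtain w where "act e u = act e' w"
        using eq by (metis rangeE rangeI)
      moreover from this have "act (e' * e) u = act (e' * e') w"
        by simp
      ultimately show ?thesis
        using goodD(1)[OF assms(2)] by simp
    qed
    then have "e = e' * e"
      by (rule endo_eqI)
    then show False
      using assms by simp
  qed
  ultimately show "range (act e') \<subset> range (act e)"
    by blast
qed

lemma odds_add: "x \<in> odds e \<Longrightarrow> y \<in> odds e \<Longrightarrow> x + y \<in> odds e"
  and odds_diff: "x \<in> odds e \<Longrightarrow> y \<in> odds e \<Longrightarrow> x - y \<in> odds e"
  and odds_smul: "x \<in> odds e \<Longrightarrow> c *e x \<in> odds e"
  by (simp_all add: odds_def distrib_left distrib_right left_diff_distrib right_diff_distrib)

lemma odds_mono: "x \<in> odds e' \<Longrightarrow> e' * e = e' \<Longrightarrow> x \<in> odds e"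
  unfolding odds_def by (metis (mono_tags, lifting) mem_Collect_eq mult.assoc)

section \<open>Restrictions and direct sums of commuting pairs\<close>

lemma odds_restrict:
  assumes x: "x \<in> odds e" and e': "good e'" and comm: "x * e' = e' * x"
  shows "x * e' \<in> odds e'"
proof -
  have "A * (x * e') = - (x * (A * e'))"
    using oddsD(2)[OF x] by (simp flip: mult.assoc)
  then have "A * (x * e') = - (x * e' * A)"
    by (simp add: goodD(3)[OF e'] mult.assoc)
  moreover have "star (x * e') = x * e'"
    using comm by (simp add: goodD(2)[OF e'] oddsD(1)[OF x])
  moreover have "x * e' * e' = x * e'"
    by (simp add: goodD(1)[OF e'] mult.assoc)
  ultimately show ?thesis
    by (simp add: odds_def)
qed

text \<open>Invertibility forces the Fitting idempotent of \<open>M\<close> to be \<open>e\<close>,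
  and its companion \<open>g\<close> has no root 0. A root 0 could collide with a root 0 of the
  other block under every rescaling.\<close>

lemma annihilator_of_invertible:
  assumes "good e" "M * e = M" "e * M = M" "N * M = e"
  obtains g where "poly g 0 \<noteq> 0" "meval g M * e = 0"
proof -
  obtain q k g where f: "M ^ k * (1 - meval q M * M) = 0" "meval g M * (meval q M * M) = 0" "poly g 0 \<noteq> 0"
    using fitting_idempotent[of M] by blast
  have cancel: "e * w = 0" if "M ^ k * w = 0" for k w
    using that
  proof (induction k arbitrary: w)
    case (Suc k)
    then have "e * (M * w) = 0"
      by (simp only: power_Suc2 mult.assoc)
    then have "M * w = 0"
      using assms(3) by (simp flip: mult.assoc)
    then have "N * (M * w) = 0"
      by simp
    then show ?case
      using assms(4) by (simp flip: mult.assoc)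
  qed simp
  have "e * meval q M = meval q M * e"
    by (rule meval_commute[symmetric]) (simp add: assms)
  then have "e * (meval q M * M) = meval q M * M"
    by (metis assms(3) mult.assoc)
  then have "e = meval q M * M"
    using cancel[OF f(1)] by (simp add: right_diff_distrib)
  then show ?thesis
    using that f by metis
qed

lemma finite_square_roots: "finite {s::'a. s * s = c}"
proof -
  have "{s. s * s = c} = {s. poly [:- c, 0, 1:] s = 0}"
    by (auto simp: algebra_simps)
  then show ?thesis
    using poly_roots_finite[of "[:- c, 0, 1:]"] by simp
qed

text \<open>Rescaling \<open>x'\<close> makes the spectra of the two blocks disjoint, so that one odd polynomial
  interpolates both of the given ones.\<close>

lemma vanish_direct_sum_oddpoly:
  assumes F: "polyfun F" and van: "\<And>x r. x \<in> odds (e + e') \<Longrightarrow> F x (oddpoly r x) = 0"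
    and e: "good e" and e': "good e'" and ee': "e * e' = 0" "e' * e = 0"
    and x: "x \<in> odds e" and z: "x * z = e" and x': "x' \<in> odds e'"
  shows "F (x + x') (oddpoly r x + oddpoly r' x') = 0"
proof -
  note xD = oddsD[OF x] odds_left[OF e x] and x'D = oddsD[OF x'] odds_left[OF e' x']
  define M where "M = x * x"
  have M: "M * e = M" "e * M = M"
    using xD by (simp_all add: M_def mult.assoc) (simp flip: mult.assoc)
  have "star z * x = e"
    using arg_cong[OF z, of star] xD goodD[OF e] by simp
  then have "(star z * star z) * M = e"
    using xD by (simp add: M_def mult.assoc) (metis mult.assoc)
  then obtain g where g: "poly g 0 \<noteq> 0" "meval g M * e = 0"
    using annihilator_of_invertible[OF e M] by blast
  obtain p where p: "p \<noteq> 0" "meval p (x' * x') = 0"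
    using ex_poly_annihilator by blast
  \<comment> \<open>The scalings for which \<open>s * s * c\<close> can be a root of
    \<open>g\<close>. A root \<open>c = 0\<close> gives \<open>a / 0 = 0\<close> and contributes
    only \<open>s = 0\<close>, which is excluded anyway.\<close>
  define E where "E = {0} \<union> (\<Union>a\<in>{a. poly g a = 0}. \<Union>c\<in>{c. poly p c = 0}. {s. s * s = a / c})"
  have "g \<noteq> 0"
    using g(1) by auto
  then have "finite E"
    unfolding E_def using p(1) poly_roots_finite[of g] poly_roots_finite[of p] finite_square_roots
    by (intro finite_UnI finite_UN_I) auto
  define f where "f s = F (x + s *e x') (oddpoly r x + oddpoly r' (s *e x'))" for s
  have "f \<in> linefuns"
    unfolding f_def oddpoly_def using F
    by (intro polyfun_compose[OF _ funring_linefuns] entries_add[OF funring_linefuns]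
        entries_mult[OF funring_linefuns] entries_meval[OF funring_linefuns]
        entries_smul[OF funring_linefuns] entries_const[OF funring_linefuns] linefuns_id)
  moreover have "f s = 0" if s: "s \<notin> E" for s
  proof -
    have s0: "s \<noteq> 0"
      using s by (auto simp: E_def)
    define x'' where "x'' = s *e x'"
    have x'': "x'' \<in> odds e'"
      unfolding x''_def by (rule odds_smul[OF x'])
    note x''D = oddsD[OF x''] odds_left[OF e' x'']
    define M' where "M' = x'' * x''"
    have M': "M' * e' = M'" "e' * M' = M'"
      using x''D by (simp_all add: M'_def mult.assoc) (simp flip: mult.assoc)
    define p' where "p' = pcompose p [:0, 1 / (s * s):]"
    have p'0: "meval p' M' = 0"
      unfolding p'_def meval_pcompose_scale M'_def x''_def using s0 p(2) by simp
    have "poly p' a \<noteq> 0" if "poly g a = 0" for a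
    proof
      assume "poly p' a = 0"
      then have c: "poly p (a / (s * s)) = 0"
        by (simp add: p'_def poly_pcompose)
      have "a \<noteq> 0"
        using g(1) that by auto
      then have "s * s = a / (a / (s * s))"
        using s0 by simp
      then have "s \<in> E"
        unfolding E_def using c that by blast
      then show False
        using s by blast
    qed
    then obtain h w where hw: "h * p' + w * g = 1"
      using poly_bezout[of g p'] by blast
    \<comment> \<open>Chinese remainders: \<open>h * p'\<close> is 0 modulo \<open>p'\<close> and 1
      modulo \<open>g\<close>, so \<open>t\<close> acts as \<open>r'\<close> on the block of
      \<open>x''\<close> and as \<open>r\<close> on that of \<open>x\<close>.\<close>
    define t where "t = r' + (r - r') * (h * p')"
    have t_M': "meval t M' = meval r' M'"
      by (simp add: t_def meval_add meval_mult p'0)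
    have "meval (h * p') M * e = meval (1 - w * g) M * e"
      using hw by (metis add_diff_cancel_right')
    also have "\<dots> = e"
      by (simp add: meval_diff meval_mult left_diff_distrib mult.assoc g(2))
    finally have "meval t M * e = meval r M * e"
      by (simp add: t_def meval_add meval_diff meval_mult[of "r - r'"] mult.assoc distrib_right)
        (simp add: algebra_simps)
    define X where "X = x + x''"
    have xx'': "x * x'' = 0" "x'' * x = 0" "x * e' = 0" "x'' * e = 0"
      using xD x''D ee' by (metis mult.assoc mult_zero_left mult_zero_right)+
    have XX: "X * X = M + M'"
      by (simp add: X_def M_def M'_def distrib_left distrib_right xx'')
    have "M * e' = 0" "M' * e = 0"
      by (simp_all add: M_def M'_def mult.assoc xx'')
    then have XXe: "X * X * e = M" "X * X * e' = M'"
      by (simp_all add: XX distrib_right M M')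
    have X: "X \<in> odds (e + e')"
      unfolding X_def using ee' goodD(1)[OF e] goodD(1)[OF e'] x x''
      by (intro odds_add) (auto elim!: odds_mono simp: distrib_left)
    have ge: "good (e + e')"
      using e e' ee' by (simp add: good_def distrib_left distrib_right)
    have "oddpoly t X = oddpoly t X * (e + e')"
      using oddsD(3)[OF oddpoly_odds[OF ge X]] by simp
    also have "\<dots> = X * (meval t (X * X) * e) + X * (meval t (X * X) * e')"
      by (simp add: oddpoly_def distrib_left mult.assoc)
    also have "\<dots> = X * (meval r M * e) + X * (meval r' M' * e')"
      using meval_block[OF XXe(1) M] meval_block[OF XXe(2) M'] \<open>meval t M * e = meval r M * e\<close> t_M' by simp
    also have "\<dots> = oddpoly r x + oddpoly r' x''"
    proof -
      have c: "meval r M * e = e * meval r M" "meval r' M' * e' = e' * meval r' M'"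
        using M M' by (auto intro!: meval_commute)
      have Xe: "X * (e * w) = x * w" "X * (e' * w) = x'' * w" for w
        using xD x''D xx'' by (simp_all add: X_def distrib_right flip: mult.assoc)
      show ?thesis
        unfolding c Xe by (simp add: oddpoly_def M_def M'_def)
    qed
    finally have "oddpoly t X = oddpoly r x + oddpoly r' x''" .
    then show ?thesis
      using van[OF X, of t] by (simp add: f_def X_def x''_def)
  qed
  ultimately have "f 1 = 0"
    using linefuns_vanish \<open>finite E\<close> by blast
  then show ?thesis
    by (simp add: f_def)
qed

text \<open>An arbitrary first block is joined by a line to the invertible \<open>x\<close>, so that
  generically the previous lemma applies. Density on \<open>e'\<close>, then on \<open>e\<close>,
  with the other block fixed, brings in the given pairs.\<close>

lemma vanish_direct_sum:
  assumes F: "polyfun F" and van: "\<And>x r. x \<in> odds (e + e') \<Longrightarrow> F x (oddpoly r x) = 0"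
    and e: "good e" and e': "good e'" and ee': "e * e' = 0" "e' * e = 0"
    and dense: "dense_oddpoly e" "dense_oddpoly e'"
    and x: "commuting e x y" "x * z = e" and x': "commuting e' x' y'"
  shows "F (x + x') (y + y') = 0"
proof -
  have x_odd: "x \<in> odds e"
    using x by (simp add: commuting_def)
  note xD = oddsD[OF x_odd] odds_left[OF e x_odd]
  have 1: "F (u + u') (oddpoly r u + oddpoly r' u') = 0" if u: "u \<in> odds e" and u': "u' \<in> odds e'" for u u' r r'
  proof -
    define v where "v s = x + s *e (u - x)" for s
    have v: "v s \<in> odds e" for s
      unfolding v_def using x_odd u by (intro odds_add odds_smul odds_diff)
    define f where "f s = F (v s + u') (oddpoly r (v s) + oddpoly r' u')" for s
    \<comment> \<open>Adding \<open>1 - e\<close> turns invertibility on \<open>e\<close> into a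
      determinant condition on the whole space.\<close>
    define D where "D s = detm (v s + (1 - e))" for s
    have v_line: "entries_in linefuns v"
      unfolding v_def by (intro entries_add[OF funring_linefuns]
        entries_smul[OF funring_linefuns] entries_const[OF funring_linefuns] linefuns_id)
    have "f s = 0" for s
    proof (rule linefuns_vanish_generic[of f D 0])
      show "f \<in> linefuns"
        unfolding f_def oddpoly_def using F v_line
        by (intro polyfun_compose[OF _ funring_linefuns] entries_add[OF funring_linefuns]
            entries_mult[OF funring_linefuns] entries_meval[OF funring_linefuns]
            entries_const[OF funring_linefuns])
      show "D \<in> linefuns"
        unfolding D_def using v_line
        by (intro funring_detm[OF funring_linefuns] entries_add[OF funring_linefuns]
            entries_const[OF funring_linefuns])
      have "(x + (1 - e)) * (e * z + (1 - e)) = 1"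
        using xD x(2) goodD(1)[OF e]
        by (simp add: distrib_left distrib_right left_diff_distrib right_diff_distrib flip: mult.assoc)
      then show "D 0 \<noteq> 0"
        unfolding D_def detm_nz_iff v_def by auto
      show "f s = 0" if "D s \<noteq> 0" for s
      proof -
        obtain w where w: "(v s + (1 - e)) * w = 1"
          using \<open>D s \<noteq> 0\<close> by (auto simp: D_def detm_nz_iff)
        have "e * ((v s + (1 - e)) * w) = e * v s * w + (e - e * e) * w"
          by (simp add: algebra_simps)
        then have "v s * w = e"
          using w goodD(1)[OF e] odds_left[OF e v] by simp
        then show ?thesis
          unfolding f_def using vanish_direct_sum_oddpoly[OF F van e e' ee' v _ u'] by blast
      qed
    qed
    from this[of 1] show ?thesis
      by (simp add: f_def v_def)
  qed
  have 2: "F (u + x') (oddpoly r u + y') = 0" if u: "u \<in> odds e" for u r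
  proof -
    have "polyfun (\<lambda>x y. F (u + x) (oddpoly r u + y))"
      by (rule polyfunI) (intro polyfun_compose[OF F funring_pairfuns] entries_add[OF funring_pairfuns]
          entries_const[OF funring_pairfuns] entries_fst entries_snd)
    then show ?thesis
      using dense(2)[unfolded dense_oddpoly_def] 1[OF u] x' by blast
  qed
  have "polyfun (\<lambda>x y. F (x + x') (y + y'))"
    by (rule polyfunI) (intro polyfun_compose[OF F funring_pairfuns] entries_add[OF funring_pairfuns]
        entries_const[OF funring_pairfuns] entries_fst entries_snd)
  then show ?thesis
    using dense(1)[unfolded dense_oddpoly_def] 2 x by blast
qed

section \<open>Pairs with a nonnilpotent member\<close>

definition dense_below :: "('a, 'n) endo \<Rightarrow> bool" where
  "dense_below e \<longleftrightarrow> (\<forall>e'. good e' \<longrightarrow> rk e' < rk e \<longrightarrow> dense_oddpoly e')"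

definition vanishing :: "('a, 'n) endo \<Rightarrow> (('a, 'n) endo \<Rightarrow> ('a, 'n) endo \<Rightarrow> 'a) \<Rightarrow> bool" where
  "vanishing e F \<longleftrightarrow> polyfun F \<and> (\<forall>x\<in>odds e. \<forall>r. F x (oddpoly r x) = 0)"

lemma dense_oddpoly_iff: "dense_oddpoly e \<longleftrightarrow> (\<forall>F. vanishing e F \<longrightarrow> (\<forall>x y. commuting e x y \<longrightarrow> F x y = 0))"
  unfolding dense_oddpoly_def vanishing_def by blast

text \<open>The Fitting idempotent is a polynomial in \<open>N\<close>, so it is self-adjoint with
  \<open>N\<close> and commutes with \<open>A\<close> and with everything that commutes with
  \<open>N\<close>.\<close>

lemma fitting_good:
  assumes e: "good e" and N: "star N = N" "A * N = N * A" "N * e = N"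
  obtains e' n k where "good e'" "e' * e = e'" "N * n = e'" "N ^ k * (1 - e') = 0"
    "\<And>w. N * w = w * N \<Longrightarrow> e' * w = w * e'" "\<And>w. N * w = w * N \<Longrightarrow> n * w = w * n"
proof -
  obtain q k where q: "meval q N * N * (meval q N * N) = meval q N * N" "N ^ k * (1 - meval q N * N) = 0"
    using fitting_idempotent[of N] by metis
  have comm: "meval q N * w = w * meval q N" if "N * w = w * N" for w
    by (rule meval_commute[OF that])
  have comm': "meval q N * N * w = w * (meval q N * N)" if "N * w = w * N" for w
    using comm[OF that] that by (simp add: mult.assoc) (simp flip: mult.assoc)
  show thesis
  proof (rule that[of "meval q N * N" "meval q N" k])
    show "good (meval q N * N)"
      using q(1) comm'[of A] N comm[of N] by (simp add: good_def star_meval)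
    show "meval q N * N * e = meval q N * N"
      by (simp add: mult.assoc N)
    show "N * meval q N = meval q N * N"
      using comm[of N] by simp
  qed (fact q(2), erule comm', erule comm)
qed

text \<open>Both summands have smaller rank. Invertibility of \<open>x\<close> on \<open>e'\<close>
  is what lets rescaling separate the spectra of the two blocks.\<close>

lemma vanish_decomposed:
  assumes F: "vanishing e F" and e: "good e" and IH: "dense_below e"
    and xy: "commuting e x y"
    and e': "good e'" "e' * e = e'" "e' \<noteq> 0" "e' \<noteq> e"
    and comm: "x * e' = e' * x" "y * e' = e' * y" and inv: "x * e' * z = e'"
  shows "F x y = 0"
proof -
  define f where "f = e - e'"
  have f: "good f" "e * e' = e'" "f * e = f"
    using good_diff[OF e e'(1,2)] goodD(1)[OF e] e'(2) by (simp_all add: f_def left_diff_distrib)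
  have sum: "e' + f = e"
    by (simp add: f_def)
  have orth: "e' * f = 0" "f * e' = 0"
    using e' f goodD(1)[OF e'(1)] by (simp_all add: f_def left_diff_distrib right_diff_distrib)
  have x: "x \<in> odds e" and y: "y \<in> odds e" and "x * y = y * x"
    using xy by (auto simp: commuting_def)
  have comm_f: "x * f = f * x" "y * f = f * y"
    using comm oddsD(3)[OF x] oddsD(3)[OF y] odds_left[OF e x] odds_left[OF e y]
    by (simp_all add: f_def left_diff_distrib right_diff_distrib)
  have restrict: "commuting g (x * g) (y * g)" if g: "good g" "x * g = g * x" "y * g = g * y" for g
  proof -
    have "x * g * (y * g) = x * (g * y) * g" "y * g * (x * g) = y * (g * x) * g"
      by (simp_all add: mult.assoc)
    then have "x * g * (y * g) = x * y * g * g" "y * g * (x * g) = y * x * g * g"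
      by (simp_all add: mult.assoc g(2,3)[symmetric])
    then show ?thesis
      using odds_restrict[OF x g(1,2)] odds_restrict[OF y g(1,3)] \<open>x * y = y * x\<close>
      by (simp add: commuting_def)
  qed
  have "dense_oddpoly e'"
    using IH e' rk_good_less[OF e e'(1,2,4)] by (simp add: dense_below_def)
  moreover have "f \<noteq> e"
    using e'(3) by (simp add: f_def)
  then have "dense_oddpoly f"
    using IH f rk_good_less[OF e f(1,3)] by (simp add: dense_below_def)
  ultimately have "F (x * e' + x * f) (y * e' + y * f) = 0"
    using F[unfolded vanishing_def] inv
    by (intro vanish_direct_sum[of F e' f "x * e'" "y * e'" z] e'(1) f(1) orth restrict comm comm_f)
      (simp_all add: sum)
  then show ?thesis
    using oddsD(3)[OF x] oddsD(3)[OF y] by (simp add: sum flip: distrib_left)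
qed

text \<open>The adjoint of a right inverse is a left inverse; cut down by \<open>e\<close> the two
  agree, and the inverse of an odd operator is odd.\<close>

lemma odds_inverse:
  assumes e: "good e" and x: "x \<in> odds e" and z: "x * z = e"
  obtains z' where "z' \<in> odds e" "x * z' = e" "z' * x = e"
proof
  note xD = oddsD[OF x] odds_left[OF e x] and eD = goodD[OF e]
  have zx: "star z * x = e"
    using arg_cong[OF z, of star] xD eD by simp
  have sz: "star z * e = e * z"
    using z zx by (metis mult.assoc)
  have ez: "e * z * e = e * z"
    using sz eD by (metis mult.assoc)
  show 1: "x * (e * z) = e"
    using xD z by (simp flip: mult.assoc)
  show 2: "e * z * x = e"
    unfolding sz[symmetric] using xD zx by (simp add: mult.assoc)
  have "e * z * A = e * z * (A * e)"
    using eD(3) ez by (simp flip: mult.assoc)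
  also have "\<dots> = e * z * (A * x) * (e * z)"
    using 1 by (simp add: mult.assoc)
  also have "\<dots> = - (e * z * x * (A * (e * z)))"
    by (simp add: xD(2) mult.assoc)
  also have "\<dots> = - (A * (e * z))"
    unfolding 2 using eD(1,3) by (metis mult.assoc)
  finally have "A * (e * z) = - (e * z * A)"
    by simp
  moreover have "star (e * z) = e * z"
    using eD sz by simp
  ultimately show "e * z \<in> odds e"
    using ez by (simp add: odds_def)
qed

text \<open>Division by \<open>x\<close> turns \<open>y\<close> into an even self-adjoint
  \<open>p\<close> that commutes with \<open>x\<close>. On the line from \<open>e'\<close> to
  \<open>p\<close> the generic \<open>P s\<close> is not a scalar plus a nilpotent on
  \<open>e\<close>, so some shift of it has a proper Fitting projection, which splits both
  \<open>x\<close> and \<open>x * P s\<close>.\<close>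

lemma vanish_invertible_decomposable:
  assumes F: "vanishing e F" and e: "good e" and IH: "dense_below e"
    and xy: "commuting e x y" and z: "x * z = e"
    and e': "good e'" "e' * e = e'" "e' \<noteq> 0" "e' \<noteq> e" and comm: "x * e' = e' * x"
  shows "F x y = 0"
proof -
  have x: "x \<in> odds e" and y: "y \<in> odds e" and "x * y = y * x"
    using xy by (auto simp: commuting_def)
  obtain w where w: "w \<in> odds e" "x * w = e" "w * x = e"
    using odds_inverse[OF e x z] by blast
  note xD = oddsD[OF x] odds_left[OF e x] and yD = oddsD[OF y] odds_left[OF e y]
    and wD = oddsD[OF w(1)] odds_left[OF e w(1)] and eD = goodD[OF e]
  define p where "p = w * y"
  have yw: "y * w = w * y"
    using \<open>x * y = y * x\<close> w yD wD by (metis mult.assoc)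
  have "A * (w * y) = - (w * (A * y))"
    by (simp add: wD(2) flip: mult.assoc)
  then have "A * p = p * A"
    by (simp add: p_def yD(2) mult.assoc)
  moreover have "e * p = p" "x * p = y"
    by (simp_all add: p_def wD(4) w(2) yD(4) flip: mult.assoc)
  moreover have "p * x = w * (x * y)"
    by (simp add: p_def \<open>x * y = y * x\<close> mult.assoc)
  then have "p * x = y"
    by (simp add: w(3) yD(4) flip: mult.assoc)
  ultimately have p: "star p = p" "A * p = p * A" "p * e = p" "e * p = p" "x * p = y" "p * x = y"
    by (simp_all add: p_def yw wD(1) yD(1)) (simp add: yD(3) mult.assoc)
  have ee': "e * e' = e'"
    using good_diff[OF e e'(1,2)] by simp
  define P where "P s = (1 - s) *e e' + s *e p" for s
  have P: "star (P s) = P s" "A * P s = P s * A" "P s * e = P s" "e * P s = P s" "x * P s = P s * x" for s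
    using p goodD[OF e'(1)] ee' e'(2) comm by (simp_all add: P_def distrib_left distrib_right)
  define r where "r = tr e"
  have r: "r = of_nat (rk e)" "tr e' = of_nat (rk e')"
    unfolding r_def using tr_idempotent goodD(1) e e'(1) by auto
  have rk: "0 < rk e'" "rk e' < rk e"
    using rk_good_less[OF e e'(1,2,4)] e'(3) rk_0_iff[of e'] by auto
  then have r0: "r \<noteq> 0"
    by (simp add: r)
  \<comment> \<open>The trace of the square of the traceless part of \<open>P s\<close>, which
    vanishes if \<open>P s\<close> is a scalar plus a nilpotent on \<open>e\<close>. At
    \<open>s = 0\<close> it is \<open>k * (r - k) / r\<close> with \<open>k\<close> the rank of
    \<open>e'\<close>.\<close>
  define D where "D s = tr ((P s - (tr (P s) / r) *e e) * (P s - (tr (P s) / r) *e e))" for s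
  have P_line: "entries_in linefuns P"
    unfolding P_def
    by (intro entries_add[OF funring_linefuns] entries_smul[OF funring_linefuns]
        entries_const[OF funring_linefuns] linefuns_id)
      (auto simp: linefuns_def intro!: exI[of _ "[:1, -1:]"])
  have commP: "commuting e x (x * P s)" for s
  proof -
    have "A * (x * P s) = - (x * P s * A)"
      by (simp add: xD(2) P(2) mult.assoc flip: mult.assoc[of A])
    then have "x * P s \<in> odds e"
      using P(1,3,5)[of s] xD by (simp add: odds_def mult.assoc)
    moreover have "x * P s * x = x * (x * P s)"
      by (metis P(5) mult.assoc)
    ultimately show ?thesis
      using x by (simp add: commuting_def)
  qed
  have "F x (x * P s) = 0" for s
  proof (rule linefuns_vanish_generic[of "\<lambda>s. F x (x * P s)" D 0])
    show "(\<lambda>s. F x (x * P s)) \<in> linefuns"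
      using F P_line
      by (intro polyfun_compose[OF _ funring_linefuns] entries_mult[OF funring_linefuns]
          entries_const[OF funring_linefuns]) (auto simp: vanishing_def)
    have "(\<lambda>s. tr (P s) * (1 / r)) \<in> linefuns"
      by (intro funring_mult[OF funring_linefuns] funring_tr[OF funring_linefuns]
          funring_const[OF funring_linefuns] P_line)
    then show "D \<in> linefuns"
      unfolding D_def using P_line
      by (intro funring_tr[OF funring_linefuns] entries_mult[OF funring_linefuns]
          entries_diff[OF funring_linefuns] entries_smul[OF funring_linefuns]
          entries_const[OF funring_linefuns]) auto
    have "D 0 = tr e' - 2 * (tr e' / r) * tr e' + (tr e' / r) * (tr e' / r) * r"
      using goodD(1)[OF e'(1)] eD(1) ee' e'(2)
      by (simp add: D_def P_def left_diff_distrib right_diff_distrib r_def algebra_simps)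
    also have "\<dots> = tr e' * (r - tr e') / r"
      using r0 by (simp add: field_simps)
    finally show "D 0 \<noteq> 0"
      using r0 rk by (simp add: r flip: of_nat_diff)
    show "F x (x * P s) = 0" if D: "D s \<noteq> 0" for s
    proof -
      have "e \<noteq> 0"
        using r0 r_def by auto
      then obtain c where c: "\<nexists>y. (P s - c *e e) * y = e"
        using ex_noninvertible_shift[of e "P s"] P eD(1) by metis
      define N where "N = P s - c *e e"
      have N: "star N = N" "A * N = N * A" "N * e = N" "N * x = x * N" "N * P s = P s * N"
        using P[of s] eD xD by (simp_all add: N_def left_diff_distrib right_diff_distrib)
      have NxP: "N * (x * P s) = x * P s * N"
        by (metis N(4,5) mult.assoc)
      obtain d n k where d: "good d" "d * e = d" "N * n = d" "N ^ k * (1 - d) = 0"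
        "\<And>w. N * w = w * N \<Longrightarrow> d * w = w * d"
        using fitting_good[OF e N(1-3)] by metis
      have "d \<noteq> e"
        using c d(3) by (auto simp: N_def)
      moreover have "d \<noteq> 0"
      proof
        assume "d = 0"
        then have Nk: "N ^ k = 0"
          using d(4) by simp
        then have "tr N = 0"
          by (rule tr_nilpotent)
        then have "c = tr (P s) / r"
          using r0 by (simp add: N_def r_def)
        then have "D s = tr (N * N)"
          by (simp add: D_def N_def)
        moreover have "(N * N) ^ k = 0"
          using Nk by (rule square_power_0)
        ultimately show False
          using D tr_nilpotent by metis
      qed
      moreover have "x * d * (w * d) = d"
        using d(5)[OF N(4)] d(2) goodD(1)[OF d(1)] w(2) by (metis mult.assoc)
      ultimately show ?thesis
        using vanish_decomposed[OF F e IH commP[of s] d(1,2)] d(5)[OF N(4)] d(5)[OF NxP] by metis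
    qed
  qed
  from this[of 1] show ?thesis
    by (simp add: P_def p)
qed

text \<open>The projections onto the eigenspaces \<open>V\<^sub>a\<close> and \<open>V\<^sub>b\<close> of \<open>A\<close>.\<close>

definition pa :: "('a, 'n) endo" where "pa = (1 / 2) *e (1 - A)"
definition pb :: "('a, 'n) endo" where "pb = (1 / 2) *e (1 + A)"

lemma pa_pb [simp]:
  "pa * pa = pa" "pb * pb = pb" "pa * pb = 0" "pb * pa = 0" "star pa = pa" "star pb = pb"
  "A * pa = - pa" "pa * A = - pa" "A * pb = pb" "pb * A = pb"
proof -
  have "(1 - A) * (1 - A) = 2 *e (1 - A)" "(1 + A) * (1 + A) = 2 *e (1 + A)"
    by (simp_all add: smul_2 algebra_simps)
  then show "pa * pa = pa" "pb * pb = pb"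
    by (simp_all add: pa_def pb_def)
  have "(1 - A) * (1 + A) = 0" "(1 + A) * (1 - A) = 0"
    by (simp_all add: algebra_simps)
  then show "pa * pb = 0" "pb * pa = 0"
    by (simp_all add: pa_def pb_def)
qed (simp_all add: pa_def pb_def distrib_left distrib_right left_diff_distrib right_diff_distrib smul_add)

lemma pa_add_pb: "pa + pb = 1"
proof -
  have "pa + pb = (1 / 2) *e 1 + (1 / 2) *e 1"
    by (simp add: pa_def pb_def smul_add)
  also have "\<dots> = (1 / 2 + 1 / 2) *e 1"
    by (rule smul_add(2)[symmetric])
  finally show ?thesis
    by simp
qed

lemma odd_pa: "A * x = - (x * A) \<Longrightarrow> x * pa = pb * x" and odd_pb: "A * x = - (x * A) \<Longrightarrow> x * pb = pa * x"
  by (simp_all add: pa_def pb_def distrib_left distrib_right left_diff_distrib right_diff_distrib)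

lemma even_pa: "A * x = x * A \<Longrightarrow> x * pa = pa * x" and even_pb: "A * x = x * A \<Longrightarrow> x * pb = pb * x"
  by (simp_all add: pa_def pb_def distrib_left distrib_right left_diff_distrib right_diff_distrib)

section \<open>Cyclic vectors of nilpotent self-adjoint operators\<close>

lemma ex_nonisotropic:
  assumes "star M = M" "M \<noteq> 0"
  obtains v where "b (act M v) v \<noteq> 0"
proof (rule ccontr)
  assume "\<not> thesis"
  then have 0: "b (act M v) v = 0" for v
    using that by blast
  have "b (act M u) v = 0" for u v
  proof -
    have "b (act M (u + v)) (u + v) = b (act M u) v + b (act M v) u"
      by (simp add: b_simps 0)
    moreover have "b (act M v) u = b (act M u) v"
      using b_star[of M v u] assms(1) b_sym[of v "act M u"] by simp
    ultimately show ?thesis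
      using 0[of "u + v"] by simp
  qed
  then have "M = 0"
    by (intro endo_eqI) (simp add: b_nondeg)
  then show False
    using assms by simp
qed

text \<open>For nilpotent \<open>\<nu>\<close> of index \<open>m + 1\<close> and \<open>v\<close> with \<open>b (\<nu>\<^sup>m v) v \<noteq> 0\<close>, the operator \<open>cyc \<nu> m v\<close>
  is, up to an invertible polynomial in \<open>\<nu>\<close>, the orthogonal projection onto the span of the \<open>\<nu>\<^sup>i v\<close>.\<close>

definition cyc :: "('a, 'n) endo \<Rightarrow> nat \<Rightarrow> 'a^'n \<Rightarrow> ('a, 'n) endo" where
  "cyc \<nu> m v = (\<Sum>i<Suc m. ten (act (\<nu> ^ i) v) (act (\<nu> ^ (m - i)) v))"

lemma star_sum: "star (\<Sum>i\<in>I. f i) = (\<Sum>i\<in>I. star (f i))"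
  by (induction I rule: infinite_finite_induct) simp_all

lemma act_sum: "act (\<Sum>i\<in>I. f i) v = (\<Sum>i\<in>I. act (f i) v)"
  by (induction I rule: infinite_finite_induct) simp_all

lemma meval_sum: "meval (\<Sum>i\<in>I. f i) x = (\<Sum>i\<in>I. meval (f i) x)"
  by (induction I rule: infinite_finite_induct) (simp_all add: meval_add)

context
  fixes \<nu> :: "('a, 'n) endo" and m :: nat and v :: "'a^'n"
  assumes \<nu>: "star \<nu> = \<nu>" "\<nu> ^ Suc m = 0"
begin

lemma star_cyc: "star (cyc \<nu> m v) = cyc \<nu> m v"
proof -
  have "star (cyc \<nu> m v) = (\<Sum>i<Suc m. ten (act (\<nu> ^ (m - i)) v) (act (\<nu> ^ i) v))"
    by (simp only: cyc_def star_sum star_ten)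
  also have "\<dots> = (\<Sum>i<Suc m. ten (act (\<nu> ^ (Suc m - Suc i)) v) (act (\<nu> ^ (m - (Suc m - Suc i))) v))"
    by (intro sum.cong) auto
  also have "\<dots> = cyc \<nu> m v"
    unfolding cyc_def by (rule sum.nat_diff_reindex)
  finally show ?thesis .
qed

text \<open>Moving a factor \<open>\<nu>\<close> from one slot to the other shifts the summation
  index; the end terms contain \<open>\<nu> ^ Suc m = 0\<close>.\<close>

lemma cyc_commute: "\<nu> * cyc \<nu> m v = cyc \<nu> m v * \<nu>"
proof -
  have "\<nu> * cyc \<nu> m v = (\<Sum>i<Suc m. ten (act (\<nu> ^ Suc i) v) (act (\<nu> ^ (m - i)) v))"
    by (simp add: cyc_def sum_distrib_left del: sum.lessThan_Suc)
  also have "\<dots> = (\<Sum>i<m. ten (act (\<nu> ^ Suc i) v) (act (\<nu> ^ (m - i)) v))"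
    by (simp add: \<nu>(2) del: power_Suc)
  also have "\<dots> = (\<Sum>i<Suc m. ten (act (\<nu> ^ i) v) (act (\<nu> ^ (Suc m - i)) v))"
    by (subst sum.lessThan_Suc_shift) (simp add: \<nu>(2) del: power_Suc)
  also have "\<dots> = (\<Sum>i<Suc m. ten (act (\<nu> ^ i) v) (act (\<nu> ^ Suc (m - i)) v))"
    by (intro sum.cong) (auto simp: Suc_diff_le)
  also have "\<dots> = cyc \<nu> m v * \<nu>"
    by (simp add: cyc_def sum_distrib_right \<nu>(1) power_commutes flip: act_mult del: sum.lessThan_Suc)
  finally show ?thesis .
qed

text \<open>The range of \<open>cyc\<close> lies in the span of the \<open>\<nu> ^ i v\<close>, so
  an operator commuting with \<open>\<nu>\<close> is determined there by its value at
  \<open>v\<close>. The coefficients of \<open>\<rho>\<close> are the pairings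
  \<open>b (\<nu> ^ (m - i) v) w\<close>; if the constant one is nonzero, \<open>\<rho>\<close> is
  invertible at the nilpotent \<open>\<nu>\<close>.\<close>

lemma cyc_absorb:
  obtains \<rho> where "\<And>p q. p * \<nu> = \<nu> * p \<Longrightarrow> act p v = act q (act (cyc \<nu> m v) w) \<Longrightarrow> q * \<nu> = \<nu> * q \<Longrightarrow>
    p * cyc \<nu> m v = q * meval \<rho> \<nu> * cyc \<nu> m v" "poly \<rho> 0 = b (act (\<nu> ^ m) v) w"
    "act (cyc \<nu> m v) w = act (meval \<rho> \<nu>) v"
proof
  define \<rho> where "\<rho> = (\<Sum>i<Suc m. smult (b (act (\<nu> ^ (m - i)) v) w) (monom 1 i))"
  show Ew: "act (cyc \<nu> m v) w = act (meval \<rho> \<nu>) v"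
    by (simp only: cyc_def act_sum act_ten \<rho>_def meval_sum meval_smult meval_monom act_simps)
  have comm: "x * \<nu> ^ i = \<nu> ^ i * x" if "x * \<nu> = \<nu> * x" for x i
    using power_commuting_commutes[of \<nu> x i] that by simp
  show "p * cyc \<nu> m v = q * meval \<rho> \<nu> * cyc \<nu> m v"
    if p: "p * \<nu> = \<nu> * p" "act p v = act q (act (cyc \<nu> m v) w)" "q * \<nu> = \<nu> * q" for p q
  proof -
    have "\<nu> * meval \<rho> \<nu> = meval \<rho> \<nu> * \<nu>"
      by (rule meval_commute[symmetric]) simp
    then have c: "q * meval \<rho> \<nu> * \<nu> = \<nu> * (q * meval \<rho> \<nu>)"
      using p(3) by (metis mult.assoc)
    have "act p (act (\<nu> ^ i) v) = act (q * meval \<rho> \<nu>) (act (\<nu> ^ i) v)" for i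
    proof -
      have pv: "act p v = act (q * meval \<rho> \<nu>) v"
        using p(2) Ew by simp
      have "act p (act (\<nu> ^ i) v) = act (\<nu> ^ i) (act p v)"
        by (simp only: act_mult[symmetric] comm[OF p(1)])
      also have "\<dots> = act (\<nu> ^ i) (act (q * meval \<rho> \<nu>) v)"
        by (simp only: pv)
      also have "\<dots> = act (q * meval \<rho> \<nu>) (act (\<nu> ^ i) v)"
        using comm[OF c, of i] by (simp only: act_mult[symmetric])
      finally show ?thesis .
    qed
    then show ?thesis
      by (simp only: cyc_def sum_distrib_left mult_ten)
  qed
  have "poly \<rho> 0 = (\<Sum>i<Suc m. if i = 0 then b (act (\<nu> ^ (m - i)) v) w else 0)"
    unfolding \<rho>_def poly_sum by (intro sum.cong) (auto simp: poly_monom power_0_left)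
  then show "poly \<rho> 0 = b (act (\<nu> ^ m) v) w"
    by (simp add: sum.delta)
qed

end

text \<open>If nothing splits, \<open>x * x\<close> has a single eigenvalue \<open>c\<close> on
  \<open>e\<close>. The cyclic subspace of a suitable \<open>v\<close> in \<open>V\<^sub>a\<close>
  plus its image under \<open>x\<close> is a nondegenerate \<open>x\<close>-stable summand, hence
  everything. The quotient \<open>p\<close> of \<open>y\<close> by \<open>x\<close> commutes with
  \<open>x * x\<close>, so it is determined by \<open>p v\<close>, a polynomial in
  \<open>x * x\<close> applied to \<open>v\<close>.\<close>

lemma oddpoly_of_indecomposable:
  assumes e: "good e" "e \<noteq> 0" and xy: "commuting e x y" and w: "w \<in> odds e" "x * w = e" "w * x = e"
    and indec: "\<And>e'. good e' \<Longrightarrow> e' * e = e' \<Longrightarrow> x * e' = e' * x \<Longrightarrow> e' = 0 \<or> e' = e"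
  obtains r where "y = oddpoly r x"
proof -
  have x: "x \<in> odds e" and y: "y \<in> odds e" and comm: "x * y = y * x"
    using xy by (auto simp: commuting_def)
  note xD = oddsD[OF x] odds_left[OF e(1) x] and yD = oddsD[OF y] odds_left[OF e(1) y]
    and wD = oddsD[OF w(1)] odds_left[OF e(1) w(1)] and eD = goodD[OF e(1)]
  define Q where "Q = x * x"
  have Q: "star Q = Q" "A * Q = Q * A" "Q * e = Q" "e * Q = Q" "Q * x = x * Q" "Q * w = x" "w * Q = x"
    using xD A_square[OF xD(2)] w
    by (simp_all add: Q_def mult.assoc) (simp_all add: w xD flip: mult.assoc)
  obtain c where c: "\<nexists>z. (Q - c *e e) * z = e"
    using ex_noninvertible_shift[of e Q] Q eD e(2) by metis
  define \<nu> where "\<nu> = Q - c *e e"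
  have \<nu>: "star \<nu> = \<nu>" "A * \<nu> = \<nu> * A" "\<nu> * e = \<nu>" "e * \<nu> = \<nu>" "\<nu> * x = x * \<nu>"
    using Q eD xD by (simp_all add: \<nu>_def left_diff_distrib right_diff_distrib)
  obtain d n k where d: "good d" "d * e = d" "\<nu> * n = d" "\<nu> ^ k * (1 - d) = 0" "x * d = d * x"
    using fitting_good[OF e(1) \<nu>(1-3)] \<nu>(5) by metis
  have "d \<noteq> e"
    using c d(3) by (auto simp: \<nu>_def)
  then have "d = 0"
    using indec d by blast
  then have "\<nu> ^ k * e = 0"
    using d(4) by simp
  define l where "l = (LEAST k. \<nu> ^ k * e = 0)"
  have l: "\<nu> ^ l * e = 0" "\<And>k. k < l \<Longrightarrow> \<nu> ^ k * e \<noteq> 0"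
    unfolding l_def using LeastI[of "\<lambda>k. \<nu> ^ k * e = 0", OF \<open>\<nu> ^ k * e = 0\<close>] not_less_Least by blast+
  obtain m where m: "l = Suc m"
    using l(1) e(2) by (cases l) auto
  have nil: "\<nu> ^ Suc m = 0"
    using l(1) \<nu>(3) by (simp only: m power_Suc2 mult.assoc)
  have pow: "star (\<nu> ^ i) = \<nu> ^ i" "\<nu> ^ i * A = A * \<nu> ^ i" "\<nu> ^ i * x = x * \<nu> ^ i" "\<nu> ^ i * e = e * \<nu> ^ i" for i
    using star_meval[OF \<nu>(1), of "monom 1 i"] meval_commute[of \<nu> A "monom 1 i"]
      meval_commute[of \<nu> x "monom 1 i"] meval_commute[of \<nu> e "monom 1 i"] \<nu>
    by (simp_all add: meval_monom)
  \<comment> \<open>The top power is nonzero already on \<open>V\<^sub>a\<close>, because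
    \<open>x\<close> is invertible, commutes with \<open>\<nu>\<close> and exchanges the
    eigenspaces.\<close>
  define S where "S = \<nu> ^ m * e * pa"
  have "S \<noteq> 0"
  proof
    assume "S = 0"
    have "\<nu> ^ m * e * pb = \<nu> ^ m * (e * pb)"
      by (simp only: mult.assoc)
    also have "e * pb = pb * (x * w)"
      using even_pb[of e] eD w by simp
    also have "\<nu> ^ m * (pb * (x * w)) = \<nu> ^ m * (x * pa) * w"
      by (simp only: odd_pa[OF xD(2)] mult.assoc)
    also have "\<dots> = \<nu> ^ m * (x * e * pa) * w"
      using xD by simp
    also have "\<dots> = x * S * w"
      by (simp add: S_def mult.assoc mult_ext[OF pow(3)])
    also have "\<dots> = 0"
      by (simp add: \<open>S = 0\<close>)
    finally have "\<nu> ^ m * e * (pa + pb) = 0"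
      using \<open>S = 0\<close> by (simp add: S_def distrib_left)
    then show False
      using l(2)[of m] m by (simp add: pa_add_pb)
  qed
  have epa: "e * pa = pa * e"
    using even_pa[OF eD(3)] .
  have "star S = S"
    using pow(4)[of m] even_pa[of "\<nu> ^ m"] pow(2)[of m] epa
    by (simp add: S_def eD pow mult.assoc) (metis mult.assoc)
  then obtain u where u: "b (act S u) u \<noteq> 0"
    using ex_nonisotropic \<open>S \<noteq> 0\<close> by metis
  define v where "v = act (e * pa) u"
  have v: "act e v = v" "act pa v = v"
    unfolding v_def using eD epa by (metis act_mult mult.assoc pa_pb(1))+
  have bv: "b (act (\<nu> ^ m) v) v = b (act S u) u"
  proof -
    have "b (act (\<nu> ^ m) v) v = b (act (star (e * pa) * (\<nu> ^ m) * (e * pa)) u) u"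
      by (simp only: v_def act_mult) (simp add: b_star eD)
    also have "star (e * pa) * (\<nu> ^ m) * (e * pa) = S"
      using pow(4)[of m] even_pa[of "\<nu> ^ m"] pow(2)[of m] epa eD
      by (simp add: S_def) (metis mult.assoc pa_pb(1))
    finally show ?thesis .
  qed
  define E where "E = cyc \<nu> m v"
  have E: "star E = E" "\<nu> * E = E * \<nu>"
    unfolding E_def using star_cyc cyc_commute \<nu>(1) nil by blast+
  have \<nu>v: "act e (act (\<nu> ^ i) v) = act (\<nu> ^ i) v" "act A (act (\<nu> ^ i) v) = - act (\<nu> ^ i) v" for i
  proof -
    show "act e (act (\<nu> ^ i) v) = act (\<nu> ^ i) v"
      using v(1) pow(4)[of i] by (metis act_mult)
    have "act A v = - v"
      using v(2) by (metis act_mult act_simps(4) pa_pb(7))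
    then show "act A (act (\<nu> ^ i) v) = - act (\<nu> ^ i) v"
      using pow(2)[of i] by (metis act_linear(3) act_mult)
  qed
  have "e * E = E" "A * E = - E"
    by (simp_all only: E_def cyc_def sum_distrib_left mult_ten \<nu>v sum_negf ten_simps)
  moreover have "E * e = star (e * E)" "E * A = star (A * E)"
    by (simp_all add: E(1) eD)
  ultimately have Ee: "e * E = E" "E * e = E" "A * E = - E" "E * A = - E"
    using E(1) by simp_all
  obtain \<rho> where \<rho>: "\<And>p q. p * \<nu> = \<nu> * p \<Longrightarrow> act p v = act q (act E v) \<Longrightarrow> q * \<nu> = \<nu> * q \<Longrightarrow>
    p * E = q * meval \<rho> \<nu> * E" "poly \<rho> 0 = b (act (\<nu> ^ m) v) v" "act E v = act (meval \<rho> \<nu>) v"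
    unfolding E_def using cyc_absorb[OF \<nu>(1) nil, of v v] by metis
  define L where "L = meval \<rho> \<nu>"
  have EE: "E * E = L * E"
    using \<rho>(1)[of E 1] E(2) by (simp add: L_def)
  have "poly \<rho> a \<noteq> 0" if "poly (monom 1 (Suc m)) a = 0" for a
    using that \<rho>(2) bv u by (auto simp: poly_monom)
  then obtain h g where hg: "h * \<rho> + g * monom 1 (Suc m) = 1"
    using poly_bezout[of "monom 1 (Suc m)" \<rho>] by blast
  define H where "H = meval h \<nu>"
  have HL: "H * L = 1"
    using arg_cong[OF hg, of "\<lambda>p. meval p \<nu>"] nil
    by (simp add: H_def L_def meval_add meval_mult meval_monom del: power_Suc)
  have Hc: "H * z = z * H" if "\<nu> * z = z * \<nu>" for z
    unfolding H_def by (rule meval_commute[OF that])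
  have Lc: "L * z = z * L" if "\<nu> * z = z * \<nu>" for z
    unfolding L_def by (rule meval_commute[OF that])
  have starH: "star H = H"
    unfolding H_def by (rule star_meval[OF \<nu>(1)])
  \<comment> \<open>The factor \<open>H\<close>, inverse to \<open>L\<close>, turns
    \<open>E * E = L * E\<close> into \<open>a * a = a\<close>: this is the orthogonal projection
    onto the cyclic subspace of \<open>v\<close>.\<close>
  define a where "a = H * E"
  have a\<nu>: "\<nu> * a = a * \<nu>"
    unfolding a_def using Hc[of \<nu>] E(2) by (metis mult.assoc)
  have aE: "a = E * H"
    using Hc[OF E(2)] by (simp add: a_def)
  have aa: "a * a = a"
  proof -
    have "a * a = H * (E * H) * E"
      by (simp add: a_def mult.assoc)
    also have "\<dots> = H * (H * (E * E))"
      by (simp add: Hc[OF E(2), symmetric] mult.assoc)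
    also have "\<dots> = H * (H * L * E)"
      by (simp add: EE mult.assoc)
    finally show ?thesis
      by (simp add: HL a_def)
  qed
  have a: "star a = a" "A * a = - a" "a * A = - a" "e * a = a" "a * e = a"
  proof -
    show "star a = a"
      using starH E(1) aE by (simp add: a_def)
    show "A * a = - a" "e * a = a"
      unfolding aE using Ee by (simp_all flip: mult.assoc)
    show "a * A = - a" "a * e = a"
      unfolding a_def using Ee by (simp_all add: mult.assoc)
  qed
  have "a \<noteq> 0"
  proof
    assume "a = 0"
    then have "L * a = 0"
      by simp
    moreover have "L * H = 1"
      using Hc[of L] Lc[of \<nu>] HL by simp
    ultimately have "E = 0"
      by (simp add: a_def flip: mult.assoc)
    then have "act L v = 0"
      using \<rho>(3) by (simp add: L_def)
    then have "act (H * L) v = 0"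
      by (simp only: act_mult act_linear)
    then have "v = 0"
      by (simp only: HL act_1)
    then show False
      using bv u by simp
  qed
  have aQ: "Q * a = a * Q"
    using a\<nu> a(4,5) by (simp add: \<nu>_def left_diff_distrib right_diff_distrib)
  have axa: "a * (x * a) = 0"
  proof -
    have "a * (x * a) = - (a * (x * (A * a)))"
      by (simp add: a(2))
    also have "\<dots> = a * A * (x * a)"
      using xD(2) by (simp flip: mult.assoc) (simp add: mult.assoc)
    also have "\<dots> = - (a * (x * a))"
      by (simp add: a(3))
    finally have "2 *e (a * (x * a)) = 0"
      by (simp add: smul_2 eq_neg_iff_add_eq_0)
    then show ?thesis
      by simp
  qed
  \<comment> \<open>The projection onto the image of the cyclic subspace under \<open>x\<close>. It
    is orthogonal because \<open>a\<close> commutes with \<open>x * x\<close>, which gives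
    \<open>x * a * w = w * a * x\<close>.\<close>
  define a' where "a' = x * a * w"
  have a'2: "a' = w * a * x"
  proof -
    have "w * a * x = w * (a * (x * x)) * w"
      using a(5) w xD by (metis mult.assoc)
    also have "\<dots> = w * Q * a * w"
      using aQ by (simp add: Q_def mult.assoc)
    finally show ?thesis
      by (simp add: Q(7) a'_def)
  qed
  define e' where "e' = a + a'"
  have aa': "a * a' = 0" "a' * a = 0"
  proof -
    have "a * a' = a * (x * a) * w" "a' * a = w * (a * (x * a))"
      by (simp add: a'_def mult.assoc) (simp add: a'2 mult.assoc)
    then show "a * a' = 0" "a' * a = 0"
      by (simp_all add: axa)
  qed
  have "a' * a' = x * (a * (w * x) * a) * w"
    by (simp add: a'_def mult.assoc)
  then have a'a': "a' * a' = a'"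
    by (simp add: w a aa a'_def)
  have "star a' = w * a * x"
    unfolding a'_def by (simp add: a wD xD mult.assoc)
  then have "star a' = a'"
    by (simp add: a'2)
  moreover have Aa': "A * a' = a'"
  proof -
    have "A * a' = - (x * (A * a) * w)"
      by (simp add: a'_def xD(2) flip: mult.assoc)
    then show ?thesis
      by (simp add: a a'_def)
  qed
  moreover have "a' * A = a'"
    using arg_cong[OF Aa', of star] \<open>star a' = a'\<close> by simp
  ultimately have "good e'"
    using aa a aa' a'a' by (simp add: good_def e'_def distrib_left distrib_right)
  moreover have "e' * e = e'"
    using a wD by (simp add: e'_def a'_def distrib_right mult.assoc)
  moreover have "x * e' = e' * x"
  proof -
    have "x * a' = Q * a * w"
      by (simp add: a'_def Q_def mult.assoc)
    also have "\<dots> = a * x"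
      by (simp add: aQ mult.assoc Q)
    finally have "x * a' = a * x" .
    moreover have "a' * x = x * a"
      by (simp add: a'_def mult.assoc w a)
    ultimately show ?thesis
      by (simp add: e'_def distrib_left distrib_right)
  qed
  moreover have "a * e' = a"
    by (simp add: e'_def distrib_left aa aa')
  then have "e' \<noteq> 0"
    using \<open>a \<noteq> 0\<close> by auto
  ultimately have e': "e' = e"
    using indec by blast
  have ya: "w * y = y * w"
    using comm w yD wD by (metis mult.assoc)
  define p where "p = w * y"
  have p: "p * x = x * p" "x * p = y" "e * p = p" "p * e = p" "A * p = p * A"
  proof -
    show "x * p = y" "e * p = p"
      by (simp_all add: p_def w yD wD flip: mult.assoc)
    show "p * x = x * p"
      by (metis comm mult.assoc p_def w(2,3) yD(4))
    show "p * e = p"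
      by (simp add: p_def yD mult.assoc)
    have "A * p = - (w * (A * y))"
      by (simp add: p_def wD(2) flip: mult.assoc)
    then show "A * p = p * A"
      by (simp add: p_def yD(2) mult.assoc)
  qed
  have "p * Q = Q * p"
    unfolding Q_def using p(1) by (metis mult.assoc)
  then have p\<nu>: "p * \<nu> = \<nu> * p"
    using p(3,4) by (simp add: \<nu>_def left_diff_distrib right_diff_distrib)
  have epa_a: "e * pa = a"
  proof -
    have "pa * a = a" "pa * a' = 0"
    proof -
      show "pa * a = a"
        by (simp add: pa_def left_diff_distrib a smul_2[symmetric])
      show "pa * a' = 0"
        by (simp add: pa_def left_diff_distrib Aa')
    qed
    then have "pa * e' = a"
      by (simp add: e'_def distrib_left)
    then show ?thesis
      by (simp add: epa e')
  qed
  \<comment> \<open>As \<open>e * pa = a = H * E\<close>, the vector \<open>p v\<close> lies in the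
    cyclic subspace, and \<open>cyc_absorb\<close> makes \<open>p\<close> a polynomial in
    \<open>\<nu>\<close> there.\<close>
  have "act p v = act H (act E (act p v))"
  proof -
    have "act p v = act (e * pa) (act p v)"
      using p v even_pa[OF p(5)] by (metis act_mult mult.assoc)
    then show ?thesis
      by (simp add: epa_a a_def)
  qed
  moreover obtain \<sigma> where \<sigma>: "\<And>p' q. p' * \<nu> = \<nu> * p' \<Longrightarrow> act p' v = act q (act E (act p v)) \<Longrightarrow> q * \<nu> = \<nu> * q \<Longrightarrow>
    p' * E = q * meval \<sigma> \<nu> * E"
    unfolding E_def using cyc_absorb[OF \<nu>(1) nil, of v "act p v"] by metis
  ultimately have pE: "p * E = H * meval \<sigma> \<nu> * E"
    using p\<nu> Hc[of \<nu>] by simp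
  define R where "R = meval (h * \<sigma>) \<nu>"
  have Rx: "R * x = x * R"
    unfolding R_def by (rule meval_commute[OF \<nu>(5)])
  have "p * a = R * a"
    unfolding aE R_def meval_mult using pE by (simp add: H_def flip: mult.assoc)
  moreover have "p * a' = x * (p * a) * w" "R * a' = x * (R * a) * w"
    by (simp_all add: a'_def mult_ext[OF p(1)] mult_ext[OF Rx] mult.assoc)
  ultimately have "p * e' = R * e'"
    by (simp add: e'_def distrib_left)
  then have "p = R * e"
    by (simp add: e' p(4))
  moreover have "R * e = meval (pcompose (h * \<sigma>) [:- c, 1:]) Q * e"
  proof -
    have "(- c *e 1 + Q) * e = \<nu>"
      by (simp add: \<nu>_def Q left_diff_distrib)
    then show ?thesis
      unfolding R_def meval_pcompose_shift using meval_block[of "- c *e 1 + Q" e \<nu>] \<nu>(3,4) by simp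
  qed
  ultimately have "y = x * (meval (pcompose (h * \<sigma>) [:- c, 1:]) Q * e)"
    using p(2) by simp
  also have "\<dots> = oddpoly (pcompose (h * \<sigma>) [:- c, 1:]) x"
    using oddsD(3)[OF oddpoly_odds[OF e(1) x]] by (simp add: oddpoly_def Q_def mult.assoc)
  finally show thesis
    using that by blast
qed

text \<open>Fitting is applied to \<open>x * x\<close>, which is even while \<open>x\<close> is odd.
  Its component is nonzero; it is either proper or all of \<open>e\<close>, and then
  \<open>x\<close> is invertible.\<close>

lemma vanish_nonnilpotent:
  assumes F: "vanishing e F" and e: "good e" and IH: "dense_below e"
    and xy: "commuting e x y" and nil: "\<And>k. x ^ k \<noteq> 0"
  shows "F x y = 0"
proof -
  have x: "x \<in> odds e" and y: "y \<in> odds e" and comm: "x * y = y * x"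
    using xy by (auto simp: commuting_def)
  note xD = oddsD[OF x] odds_left[OF e x]
  have "star (x * x) = x * x" "x * x * e = x * x"
    by (simp_all add: xD mult.assoc)
  then obtain d n k where d: "good d" "d * e = d" "x * x * n = d" "(x * x) ^ k * (1 - d) = 0"
    "\<And>z. x * x * z = z * (x * x) \<Longrightarrow> d * z = z * d"
    using fitting_good[OF e, of "x * x"] A_square[OF xD(2)] by metis
  have dx: "d * x = x * d" and dy: "d * y = y * d"
    using comm by (auto intro!: d(5)) (simp_all add: mult.assoc, simp_all flip: mult.assoc)
  have "d \<noteq> 0"
  proof
    assume "d = 0"
    then have "(x * x) ^ k = 0"
      using d(4) by simp
    then have "x ^ (2 * k) = 0"
      by (simp only: power_mult power2_eq_square)
    then show False
      using nil by blast
  qed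
  have inv: "x * d * (x * n) = d"
  proof -
    have "x * d * (x * n) = d * (x * x * n)"
      by (simp add: mult.assoc mult_ext[OF dx])
    then show ?thesis
      using d(3) goodD(1)[OF d(1)] by simp
  qed
  show ?thesis
  proof (cases "d = e")
    case False
    then show ?thesis
      using vanish_decomposed[OF F e IH xy d(1,2) \<open>d \<noteq> 0\<close> False dx[symmetric] dy[symmetric] inv] by blast
  next
    case True
    then have xz: "x * (x * n) = e"
      using d(3) by (simp add: mult.assoc)
    then obtain w where w: "w \<in> odds e" "x * w = e" "w * x = e"
      using odds_inverse[OF e x] by blast
    show ?thesis
    proof (cases "\<exists>e'. good e' \<and> e' * e = e' \<and> e' \<noteq> 0 \<and> e' \<noteq> e \<and> x * e' = e' * x")
      case True
      then show ?thesis
        using vanish_invertible_decomposable[OF F e IH xy xz] by blast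
    next
      case False
      then obtain r where "y = oddpoly r x"
        using oddpoly_of_indecomposable[OF e _ xy w] True \<open>d \<noteq> 0\<close> by metis
      then show ?thesis
        using F x by (simp add: vanishing_def)
    qed
  qed
qed

section \<open>Nilpotent pairs\<close>

lemma zero_oddpoly [simp]: "oddpoly 0 x = 0"
  by (simp add: oddpoly_def)

lemma zero_odds [simp]: "0 \<in> odds e"
  by (simp add: odds_def)

lemma vanishing_mono: "vanishing e F \<Longrightarrow> e' * e = e' \<Longrightarrow> vanishing e' F"
  unfolding vanishing_def using odds_mono by blast

text \<open>The orthogonal projection \<open>t\<close> onto the line of \<open>u\<close> is killed
  by both operators, so the pair already lives on the smaller subspace \<open>e - t\<close>.\<close>

lemma vanish_nonisotropic_kernel:
  assumes F: "vanishing e F" and e: "good e" and IH: "dense_below e" and xy: "commuting e x y"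
    and u: "act e u = u" "act A u = c *s u" "act x u = 0" "act y u = 0" "b u u \<noteq> 0"
  shows "F x y = 0"
proof -
  define t where "t = (1 / b u u) *e ten u u"
  have "t * t = (1 / b u u * (1 / b u u) * b u u) *e ten u u"
    by (simp add: t_def)
  then have "t * t = t"
    using u(5) by (simp add: t_def)
  then have t: "good t" "t * e = t" "x * t = 0" "y * t = 0" "act t u = u"
    using u by (simp_all add: good_def t_def goodD[OF e])
  define e' where "e' = e - t"
  have et: "e * t = t"
    using good_diff(2)[OF e t(1,2)] .
  have e': "good e'" "e' * e = e'"
    using good_diff(1)[OF e t(1,2)] goodD(1)[OF e] t(2) by (simp_all add: e'_def left_diff_distrib)
  have "act e' u = 0"
    by (simp add: e'_def u t)
  then have "e' \<noteq> e"
    using u(1,5) by auto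
  then have "dense_oddpoly e'"
    using IH rk_good_less[OF e e'] e' by (simp add: dense_below_def)
  moreover have "commuting e' x y"
    using xy t by (auto simp: commuting_def odds_def e'_def right_diff_distrib)
  ultimately show ?thesis
    using vanishing_mono[OF F e'(2)] by (auto simp: dense_oddpoly_iff)
qed

text \<open>\<open>\<nu>\<close> projects onto a totally isotropic \<open>N\<close> in
  \<open>V\<^sub>b\<close>, \<open>star \<nu>\<close> onto the dual isotropic \<open>N'\<close>, and
  \<open>\<nu> + star \<nu>\<close> orthogonally onto \<open>N + N'\<close>.\<close>

definition isotropic_projection :: "('a, 'n) endo \<Rightarrow> ('a, 'n) endo \<Rightarrow> bool" where
  "isotropic_projection e \<nu> \<longleftrightarrow> \<nu> * \<nu> = \<nu> \<and> star \<nu> * \<nu> = 0 \<and> \<nu> * star \<nu> = 0 \<and>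
     A * \<nu> = \<nu> \<and> \<nu> * A = \<nu> \<and> e * \<nu> = \<nu> \<and> \<nu> * e = \<nu>"

text \<open>Subtracting \<open>\<rho> * star \<rho> / 2\<close> makes the complementary space isotropic as well.\<close>

lemma ex_isotropic_projection:
  assumes e: "good e" and N: "vec.subspace N"
    and iso: "\<And>u. u \<in> N \<Longrightarrow> b u u = 0" and Ne: "\<And>u. u \<in> N \<Longrightarrow> act e u = u \<and> act A u = u"
  obtains \<nu> where "isotropic_projection e \<nu>" "range (act \<nu>) = N"
proof -
  obtain P where P: "range (act P) = N" "\<And>u. u \<in> N \<Longrightarrow> act P u = u"
    using ex_projection[OF N] by metis
  define \<rho> where "\<rho> = P * (pb * e)"
  have PN: "act P u \<in> N" for u
    using P(1) by blast
  have pbN: "act pb u = u" if "u \<in> N" for u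
  proof -
    have "act pb u = (1 / 2) *s (u + u)"
      using Ne[OF that] by (simp add: pb_def)
    then show ?thesis
      by (simp add: vec_eq_iff)
  qed
  have \<rho>N: "act \<rho> u \<in> N" "u \<in> N \<Longrightarrow> act \<rho> u = u" for u
    using PN P(2) pbN Ne by (simp_all add: \<rho>_def)
  have e_pb: "e * pb = pb * e"
    using even_pb[OF goodD(3)[OF e]] .
  have \<rho>: "\<rho> * \<rho> = \<rho>" "A * \<rho> = \<rho>" "e * \<rho> = \<rho>"
    using \<rho>N Ne by (auto intro!: endo_eqI)
  have "\<rho> * e = \<rho>"
    by (simp add: \<rho>_def mult.assoc goodD(1)[OF e])
  moreover have "\<rho> * A = \<rho>"
    by (simp add: \<rho>_def mult.assoc flip: e_pb)
  ultimately have \<rho>': "\<rho> * e = \<rho>" "\<rho> * A = \<rho>"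
    by auto
  have "b u w = 0" if "u \<in> N" "w \<in> N" for u w
  proof -
    have "u + w \<in> N"
      using N that by (simp add: vec.subspace_add)
    then have "b u w + b w u = 0"
      using iso[of "u + w"] iso[OF that(1)] iso[OF that(2)] by (simp add: b_simps add.commute)
    then show ?thesis
      using b_sym[of u w] by simp
  qed
  then have sr: "star \<rho> * \<rho> = 0"
    by (intro endo_eqI b_eqI) (simp add: b_star' \<rho>N)
  have sr': "star \<rho> * (\<rho> * w) = 0" for w
    using sr by (simp flip: mult.assoc)
  have rr: "\<rho> * (\<rho> * w) = \<rho> * w" for w
    using \<rho>(1) by (simp flip: mult.assoc)
  have ss: "star \<rho> * star \<rho> = star \<rho>"
    using arg_cong[OF \<rho>(1), of star] by simp
  define \<nu> where "\<nu> = \<rho> - (1 / 2) *e (\<rho> * star \<rho>)"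
  have star_\<nu>: "star \<nu> = star \<rho> - (1 / 2) *e (\<rho> * star \<rho>)"
    by (simp add: \<nu>_def)
  have "\<nu> * \<nu> = \<nu>" "star \<nu> * \<nu> = 0"
    unfolding star_\<nu> by (simp_all add: \<nu>_def left_diff_distrib right_diff_distrib mult.assoc \<rho> sr sr' rr)
  moreover have "\<nu> * star \<nu> = \<rho> * star \<rho> - ((1 / 2) *e (\<rho> * star \<rho>) + (1 / 2) *e (\<rho> * star \<rho>))"
    unfolding star_\<nu> by (simp add: \<nu>_def left_diff_distrib right_diff_distrib mult.assoc \<rho> sr sr' rr ss)
  then have "\<nu> * star \<nu> = 0"
    by (simp flip: smul_add(2))
  moreover have "A * \<nu> = \<nu>" "e * \<nu> = \<nu>"
    by (simp_all add: \<nu>_def right_diff_distrib \<rho> flip: mult.assoc)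
  moreover have "star \<rho> * A = star \<rho>" "star \<rho> * e = star \<rho>"
    using arg_cong[OF \<rho>(2), of star] arg_cong[OF \<rho>(3), of star] goodD(2)[OF e] by simp_all
  then have "\<nu> * A = \<nu>" "\<nu> * e = \<nu>"
    by (simp_all add: \<nu>_def left_diff_distrib \<rho>' mult.assoc)
  ultimately have "isotropic_projection e \<nu>"
    by (simp add: isotropic_projection_def)
  moreover have "range (act \<nu>) = N"
  proof
    have "\<nu> = \<rho> * \<nu>"
      by (simp add: \<nu>_def right_diff_distrib \<rho> rr)
    then have "act \<nu> u = act \<rho> (act \<nu> u)" for u
      by (metis act_mult)
    then show "range (act \<nu>) \<subseteq> N"
      using \<rho>N(1) by (metis image_subsetI)
    have "\<nu> * \<rho> = \<rho>"
      by (simp add: \<nu>_def left_diff_distrib mult.assoc \<rho> sr)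
    then show "N \<subseteq> range (act \<nu>)"
      using \<rho>N(2) by (metis act_mult rangeI subsetI)
  qed
  ultimately show thesis
    by (rule that)
qed

text \<open>For self-adjoint operators the sum of the images is the orthogonal complement of the
  common kernel. The sign fits the symplectic form on pairs.\<close>

lemma mem_range_of_perp:
  assumes x: "star x = x" and y: "star y = y"
    and perp: "\<And>k. act x k = 0 \<Longrightarrow> act y k = 0 \<Longrightarrow> b k w = 0"
  obtains a a' where "w = act x a - act y a'"
proof -
  define S where "S = {act x a - act y a' | a a'. True}"
  have "vec.subspace S"
    unfolding vec.subspace_def
  proof (intro conjI ballI allI)
    show "0 \<in> S"
      by (auto simp: S_def intro!: exI[of _ 0])
    fix u v c
    assume "u \<in> S"
    then obtain a a' where u: "u = act x a - act y a'"
      by (auto simp: S_def)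
    then have "c *s u = act x (c *s a) - act y (c *s a')"
      by (simp add: vec.scale_right_diff_distrib)
    then show "c *s u \<in> S"
      unfolding S_def by blast
    assume "v \<in> S"
    then obtain d d' where "v = act x d - act y d'"
      by (auto simp: S_def)
    then have "u + v = act x (a + d) - act y (a' + d')"
      using u by simp
    then show "u + v \<in> S"
      unfolding S_def by blast
  qed
  then obtain P where P: "range (act P) = S" "\<And>u. u \<in> S \<Longrightarrow> act P u = u"
    using ex_projection by metis
  have xS: "act x a \<in> S" "act y a \<in> S" for a
  proof -
    have "act x a = act x a - act y 0" "act y a = act x 0 - act y (- a)"
      by simp_all
    then show "act x a \<in> S" "act y a \<in> S"
      unfolding S_def by blast+
  qed
  have "b t (w - act P w) = 0" for t
  proof -
    define k where "k = act (star (1 - P)) t"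
    have "b (act x k) u = 0" "b (act y k) u = 0" for u
      using xS P(2) by (simp_all add: k_def b_star x y b_star' b_simps)
    then have "act x k = 0" "act y k = 0"
      by (simp_all add: b_nondeg)
    then have "b k w = 0"
      by (rule perp)
    then show ?thesis
      by (simp add: k_def b_simps b_star')
  qed
  then have "w - act P w = 0"
    by (intro b_nondeg) (metis b_sym)
  then have "w \<in> S"
    using P(1) by (metis eq_iff_diff_eq_0 rangeI)
  then show thesis
    using that by (auto simp: S_def)
qed

lemma pb_eq: "pb = 1 - pa"
  using pa_add_pb by (simp add: algebra_simps)

section \<open>Totally isotropic common kernel: the case \<open>V\<^sub>0 \<noteq> 0\<close>\<close>

context
  fixes e \<nu> :: "('a, 'n) endo"
  assumes e: "good e" and \<nu>: "isotropic_projection e \<nu>"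
begin

lemma iso_simps:
  "\<nu> * \<nu> = \<nu>" "star \<nu> * \<nu> = 0" "\<nu> * star \<nu> = 0" "A * \<nu> = \<nu>" "\<nu> * A = \<nu>" "e * \<nu> = \<nu>" "\<nu> * e = \<nu>"
  "star \<nu> * star \<nu> = star \<nu>" "A * star \<nu> = star \<nu>" "star \<nu> * A = star \<nu>"
  "e * star \<nu> = star \<nu>" "star \<nu> * e = star \<nu>"
  "pb * \<nu> = \<nu>" "\<nu> * pb = \<nu>" "pb * star \<nu> = star \<nu>" "star \<nu> * pb = star \<nu>"
  "pa * \<nu> = 0" "\<nu> * pa = 0" "pa * star \<nu> = 0" "star \<nu> * pa = 0"
proof -
  show 1: "\<nu> * \<nu> = \<nu>" "star \<nu> * \<nu> = 0" "\<nu> * star \<nu> = 0" "A * \<nu> = \<nu>" "\<nu> * A = \<nu>" "e * \<nu> = \<nu>" "\<nu> * e = \<nu>"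
    using \<nu> by (simp_all add: isotropic_projection_def)
  show 2: "star \<nu> * star \<nu> = star \<nu>" "A * star \<nu> = star \<nu>" "star \<nu> * A = star \<nu>"
    "e * star \<nu> = star \<nu>" "star \<nu> * e = star \<nu>"
    using arg_cong[OF 1(1), of star] arg_cong[OF 1(4), of star] arg_cong[OF 1(5), of star]
      arg_cong[OF 1(6), of star] arg_cong[OF 1(7), of star] goodD(2)[OF e] by simp_all
  show "pa * \<nu> = 0" "\<nu> * pa = 0" "pa * star \<nu> = 0" "star \<nu> * pa = 0"
    by (simp_all add: pa_def left_diff_distrib right_diff_distrib 1 2)
  then show "pb * \<nu> = \<nu>" "\<nu> * pb = \<nu>" "pb * star \<nu> = star \<nu>" "star \<nu> * pb = star \<nu>"
    using pa_add_pb by (simp_all add: pb_eq left_diff_distrib right_diff_distrib)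
qed

text \<open>The orthogonal projection onto \<open>V\<^sub>a + V\<^sub>0\<close>.\<close>

definition core :: "('a, 'n) endo" where "core = e - \<nu> - star \<nu>"

lemma core_good: "good core" "core * e = core" "e * core = core"
  "core * \<nu> = 0" "\<nu> * core = 0" "core * star \<nu> = 0" "star \<nu> * core = 0"
  using goodD[OF e] by (simp_all add: core_def good_def left_diff_distrib right_diff_distrib iso_simps)

lemma core_fixes:
  assumes "pa * T = T" "e * T = T"
  shows "core * T = T"
proof -
  have "\<nu> * T = \<nu> * pa * T" "star \<nu> * T = star \<nu> * pa * T"
    using assms(1) by (simp_all only: mult.assoc)
  then show ?thesis
    by (simp add: core_def left_diff_distrib assms(2) iso_simps)
qed

lemma odds_core:
  assumes "x \<in> odds core"
  shows "star \<nu> * x = 0" "x * star \<nu> = 0" "x * \<nu> = 0" "\<nu> * x = 0"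
  using oddsD(3)[OF assms] odds_left[OF core_good(1) assms] core_good(4-7)
  by (metis mult.assoc mult_zero_left mult_zero_right)+

text \<open>\<open>P\<close> and \<open>R\<close> map \<open>N'\<close> into
  \<open>V\<^sub>a\<close>. Up to adjoints the commutator has only two new blocks, from
  \<open>N'\<close> to \<open>V\<^sub>0\<close> and from \<open>N'\<close> to \<open>N\<close>.
  Symplectically, their vanishing says that the columns of \<open>(P, R)\<close> are orthogonal to
  all \<open>(x u, y u)\<close> and to each other.\<close>

lemma commuting_extension:
  assumes xy: "commuting core x y"
    and P: "pa * P = P" "e * P = P" "P * star \<nu> = P"
    and R: "pa * R = R" "e * R = R" "R * star \<nu> = R"
    and PR: "x * R = y * P" "star P * R = star R * P"
  shows "commuting e (x + P + star P) (y + R + star R)"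
    and "tr ((x + P + star P) * (x + P + star P)) = tr (x * x)"
proof -
  have x: "x \<in> odds core" and y: "y \<in> odds core" and comm: "x * y = y * x"
    using xy unfolding commuting_def by blast+
  have odd: "z + Q + star Q \<in> odds e" if z: "z \<in> odds core" and Q: "pa * Q = Q" "e * Q = Q" "Q * star \<nu> = Q" for z Q
  proof -
    have "A * Q = A * pa * Q"
      using Q(1) by (simp only: mult.assoc)
    moreover have "Q * A = Q * (star \<nu> * A)" "Q * e = Q * (star \<nu> * e)"
      using Q(3) by (simp_all only: mult.assoc[symmetric])
    ultimately have AQ: "A * Q = - Q" "Q * A = Q" "Q * e = Q"
      using Q by (simp_all add: iso_simps)
    have "star Q * A = - star Q" "A * star Q = star Q" "star Q * e = star Q"
      using arg_cong[OF AQ(1), of star] arg_cong[OF AQ(2), of star] arg_cong[OF Q(2), of star] goodD(2)[OF e]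
      by simp_all
    moreover have "z \<in> odds e"
      using odds_mono[OF z core_good(2)] .
    ultimately show ?thesis
      using AQ by (simp add: odds_def distrib_left distrib_right)
  qed
  have prods: "Q * T = 0" "Q * star T = 0" "Q * z = 0" "z * star T = 0" "star Q * star T = 0"
    if z: "z \<in> odds core" and Q: "Q * star \<nu> = Q" and T: "pa * T = T" "T * star \<nu> = T" "pa * Q = Q" for z Q T
  proof -
    have sT: "\<nu> * star T = star T"
      using arg_cong[OF T(2), of star] by simp
    have "star \<nu> * T = 0" "star \<nu> * Q = 0"
      using T iso_simps(20) by (metis mult.assoc mult_zero_left)+
    then have "Q * T = 0" "T * Q = 0"
      using Q T(2) by (metis mult.assoc mult_zero_right)+
    moreover have "star Q * star T = star (T * Q)"
      by (simp only: star_simps)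
    ultimately show "Q * T = 0" "star Q * star T = 0"
      by simp_all
    show "Q * star T = 0"
      using Q sT iso_simps(2) by (metis mult.assoc mult_zero_left mult_zero_right)
    show "Q * z = 0" "z * star T = 0"
      using Q sT odds_core[OF z] by (metis mult.assoc mult_zero_left mult_zero_right)+
  qed
  have yP: "star R * x = star P * y"
    using arg_cong[OF PR(1), of star] oddsD(1)[OF x] oddsD(1)[OF y] by simp
  have XY: "(x + P + star P) * (y + R + star R) = x * y + x * R + star P * y + star P * R"
    "(y + R + star R) * (x + P + star P) = y * x + y * P + star R * x + star R * P"
    "(x + P + star P) * (x + P + star P) = x * x + x * P + star P * x + star P * P"
    using prods[OF x P(3) R(1,3) P(1)] prods[OF y P(3) R(1,3) P(1)] prods[OF x R(3) P(1,3) R(1)]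
      prods[OF y R(3) P(1,3) R(1)] prods[OF x P(3) P(1,3) P(1)]
    by (simp_all add: distrib_left distrib_right)
  have "tr (x * P) = 0" "tr (star P * x) = 0" "tr (star P * P) = 0"
    using prods[OF x P(3) P(1,3) P(1)]
    by (simp_all add: tr_mult_commute[of x P] tr_mult_commute[of "star P"])
  then show "tr ((x + P + star P) * (x + P + star P)) = tr (x * x)"
    by (simp add: XY)
  have "(x + P + star P) * (y + R + star R) = (y + R + star R) * (x + P + star P)"
    by (simp only: XY comm PR yP)
  then show "commuting e (x + P + star P) (y + R + star R)"
    using odd[OF x P] odd[OF y R] by (simp add: commuting_def)
qed

context
  fixes x y :: "('a, 'n) endo"
  assumes xy: "commuting e x y" and x\<nu>: "x * \<nu> = 0" and y\<nu>: "y * \<nu> = 0"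
    and kernel: "\<And>u. act (pb * e) u = u \<Longrightarrow> act x u = 0 \<Longrightarrow> act y u = 0 \<Longrightarrow> act \<nu> u = u"
begin

lemma xy_odds: "x \<in> odds e" "y \<in> odds e" "x * y = y * x"
  using xy unfolding commuting_def by blast+

lemma \<nu>x: "star \<nu> * x = 0" "star \<nu> * y = 0"
  using arg_cong[OF x\<nu>, of star] arg_cong[OF y\<nu>, of star] oddsD(1)[OF xy_odds(1)] oddsD(1)[OF xy_odds(2)]
  by simp_all

lemma pb_core: "core * pb = pb * core" "core * pa = pa * core" "pa * core = pa * e" "pb * core = pb * e - \<nu> - star \<nu>"
proof -
  show "core * pb = pb * core" "core * pa = pa * core"
    using even_pb[OF goodD(3)[OF core_good(1)]] even_pa[OF goodD(3)[OF core_good(1)]] by simp_all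
  show "pa * core = pa * e" "pb * core = pb * e - \<nu> - star \<nu>"
    by (simp_all add: core_def right_diff_distrib iso_simps)
qed

text \<open>The columns of \<open>(F1, F2)\<close> form an isotropic complement, for the symplectic form
  \<open>b p q' - b q p'\<close> on pairs, of the image of \<open>u \<mapsto> (x u, y u)\<close>.\<close>

lemma ex_dual_pair:
  obtains F1 F2 where "x * F2 - y * F1 = pb * core" "star F1 * F2 = star F2 * F1"
    "pa * F1 = F1" "pa * F2 = F2" "e * F1 = F1" "e * F2 = F2"
proof -
  note xD = oddsD[OF xy_odds(1)] odds_left[OF e xy_odds(1)] and yD = oddsD[OF xy_odds(2)] odds_left[OF e xy_odds(2)]
  have epa: "e * pa = pa * e" and epb: "e * pb = pb * e"
    using even_pa[OF goodD(3)[OF e]] even_pb[OF goodD(3)[OF e]] .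
  define \<pi> where "\<pi> = pb * core"
  have \<pi>: "\<pi> * \<pi> = \<pi>" "star \<pi> = \<pi>" "\<pi> * \<nu> = 0" "\<pi> * pb = \<pi>" "\<pi> * e = \<pi>" "e * \<pi> = \<pi>" "pb * \<pi> = \<pi>" "pa * \<pi> = 0"
    using core_good goodD[OF core_good(1)] pb_core(1) epb
    by (simp_all add: \<pi>_def mult.assoc mult_ext[OF pb_core(1)] mult_ext[OF epb] mult_ext[OF pa_pb(2)] mult_ext[OF pa_pb(3)])
  have "\<exists>a a'. act \<pi> (axis j 1) = act x a - act y a'" for j
  proof -
    have "b k (act \<pi> (axis j 1)) = 0" if k: "act x k = 0" "act y k = 0" for k
    proof -
      define k' where "k' = act (pb * e) k"
      have "act x k' = act (x * pb * e) k" "act y k' = act (y * pb * e) k"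
        by (simp_all add: k'_def)
      moreover have "x * pb * e = pa * x" "y * pb * e = pa * y"
        unfolding odd_pb[OF xD(2)] odd_pb[OF yD(2)] by (simp_all add: mult.assoc xD yD)
      ultimately have "act x k' = 0" "act y k' = 0"
        using k by simp_all
      moreover have "act (pb * e) k' = k'"
        unfolding k'_def act_mult[symmetric] by (simp add: mult.assoc mult_ext[OF epb] goodD(1)[OF e] mult_ext[OF pa_pb(2)])
      ultimately have "act \<nu> k' = k'"
        by (intro kernel)
      then have "act \<pi> k' = act (\<pi> * \<nu>) k'"
        by simp
      also have "\<dots> = 0"
        by (simp add: \<pi>)
      finally have "act \<pi> k = 0"
        using \<pi>(4,5) by (simp add: k'_def flip: act_mult mult.assoc)
      then have "b (act \<pi> k) (axis j 1) = 0"
        by simp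
      then show ?thesis
        by (simp only: b_star \<pi>(2))
    qed
    then show ?thesis
      using mem_range_of_perp[OF xD(1) yD(1)] by metis
  qed
  then obtain f g where fg: "\<And>j. act \<pi> (axis j 1) = act x (g j) - act y (f j)"
    by metis
  \<comment> \<open>The matrix with columns \<open>h j\<close>, cut down to \<open>V\<^sub>a\<close>
    on the left and to \<open>V\<^sub>0\<close> on the right; the cuts preserve the equation for
    \<open>\<pi>\<close>.\<close>
  define G where "G h = pa * e * Endo (\<chi> i j. h j $ i) * \<pi>" for h :: "'n \<Rightarrow> 'a^'n"
  have "act (Endo (\<chi> i j. h j $ i)) (axis j 1) = h j" for h :: "'n \<Rightarrow> 'a^'n" and j
    by (simp add: vec_eq_iff flip: entry_act)
  then have "x * Endo (\<chi> i j. g j $ i) - y * Endo (\<chi> i j. f j $ i) = \<pi>"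
    using fg by (intro endo_eqI_axis) simp
  then have "pb * (x * Endo (\<chi> i j. g j $ i) - y * Endo (\<chi> i j. f j $ i)) * \<pi> = \<pi>"
    using \<pi> by simp
  moreover have "x * G g = pb * (x * Endo (\<chi> i j. g j $ i)) * \<pi>" "y * G f = pb * (y * Endo (\<chi> i j. f j $ i)) * \<pi>"
    by (simp_all add: G_def mult.assoc mult_ext[OF odd_pa[OF xD(2)]] mult_ext[OF odd_pa[OF yD(2)]]
        mult_ext[OF xD(3)] mult_ext[OF yD(3)])
  ultimately have G1: "x * G g - y * G f = \<pi>"
    by (simp add: left_diff_distrib right_diff_distrib)
  have G: "pa * G h = G h" "e * G h = G h" "G h * \<pi> = G h" for h
    using \<pi>(1) by (simp_all add: G_def mult.assoc mult_ext[OF pa_pb(1)] mult_ext[OF epa] mult_ext[OF goodD(1)[OF e]])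
  \<comment> \<open>\<open>T\<close> measures how far the columns are from isotropic. Adding
    \<open>(x * B, y * B)\<close> keeps the first equation, since \<open>x\<close> and
    \<open>y\<close> commute, and changes \<open>T\<close> by \<open>- 2 B\<close>.\<close>
  define T where "T = star (G f) * G g - star (G g) * G f"
  define B where "B = (1 / 2) *e T"
  have sG: "\<pi> * star (G h) = star (G h)" for h
    using arg_cong[OF G(3)[of h], of star] \<pi>(2) by simp
  have "\<pi> * T = T" "T * \<pi> = T" "star T = - T"
    by (simp_all add: T_def left_diff_distrib right_diff_distrib mult.assoc G mult_ext[OF sG])
  moreover have "B + B = (1 / 2 + 1 / 2) *e T"
    unfolding B_def by (rule smul_add(2)[symmetric])
  ultimately have B: "\<pi> * B = B" "B * \<pi> = B" "star B = - B" "B + B = T"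
    by (simp_all add: B_def)
  have xB: "pa * (x * B) = x * B" "pa * (y * B) = y * B"
    using odd_pb[OF xD(2)] odd_pb[OF yD(2)] \<pi>(7) B(1) by (metis mult.assoc)+
  show thesis
  proof (rule that[of "G g + y * B" "G f + x * B"])
    have "x * (G g + y * B) - y * (G f + x * B) = x * G g - y * G f + (x * y - y * x) * B"
      by (simp add: algebra_simps)
    then show "x * (G g + y * B) - y * (G f + x * B) = pb * core"
      using G1 xy_odds(3) by (simp add: \<pi>_def)
    show "pa * (G f + x * B) = G f + x * B"
      using G xB by (simp add: distrib_left)
    show "pa * (G g + y * B) = G g + y * B"
      using G xB by (simp add: distrib_left)
    show "e * (G f + x * B) = G f + x * B"
      using G mult_ext[OF xD(4)] by (simp add: distrib_left)
    show "e * (G g + y * B) = G g + y * B"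
      using G mult_ext[OF yD(4)] by (simp add: distrib_left)
    have s: "star (x * G g - y * G f) = star (G g) * x - star (G f) * y"
      by (simp add: xD yD)
    have "star (G f + x * B) * (G g + y * B) - star (G g + y * B) * (G f + x * B)
        = T - (star (G g) * x - star (G f) * y) * B
          - B * (x * G g - y * G f) - B * (x * y - y * x) * B"
      by (simp add: B T_def xD yD) (simp add: algebra_simps)
    also have "\<dots> = (B + B) - \<pi> * B - B * \<pi>"
      using G1 s xy_odds(3) by (simp add: B \<pi>(2))
    also have "\<dots> = 0"
      by (simp add: B(1,2))
    finally show "star (G f + x * B) * (G g + y * B) = star (G g + y * B) * (G f + x * B)"
      by simp
  qed
qed

text \<open>A commuting pair \<open>(x', y')\<close> in the core extends to a commuting pair for \<open>e\<close>, polynomially in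
  \<open>(x', y')\<close> and so that the core of \<open>(x, y)\<close> extends to \<open>(x, y)\<close>. A generic \<open>x'\<close> is not nilpotent.\<close>

lemma vanish_core:
  assumes F: "vanishing e F" and IH: "dense_below e" and core0: "pb * core \<noteq> 0" and \<nu>0: "\<nu> \<noteq> 0"
  shows "F x y = 0"
proof (cases "pa * e = 0")
  case True
  have "z = 0" if z: "z \<in> odds e" for z
  proof -
    note zD = oddsD[OF z] odds_left[OF e z]
    have "pa * z = 0"
      using True zD(4) by (metis mult.assoc mult_zero_left)
    then have "z * pb = 0"
      using odd_pb[OF zD(2)] by simp
    moreover have "pb * z = star (z * pb)"
      by (simp add: zD(1))
    ultimately have "pb * z = 0"
      by simp
    then show ?thesis
      using \<open>pa * z = 0\<close> pa_add_pb by (metis add_0 distrib_right mult_1)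
  qed
  then have "x = 0" "y = oddpoly 0 x"
    using xy_odds by simp_all
  then show ?thesis
    using F zero_odds unfolding vanishing_def by blast
next
  case pae: False
  note xD = oddsD[OF xy_odds(1)] odds_left[OF e xy_odds(1)] and yD = oddsD[OF xy_odds(2)] odds_left[OF e xy_odds(2)]
  have polyF: "polyfun F"
    using F by (simp add: vanishing_def)
  obtain F1 F2 where F12: "x * F2 - y * F1 = pb * core" "star F1 * F2 = star F2 * F1"
    "pa * F1 = F1" "pa * F2 = F2" "e * F1 = F1" "e * F2 = F2"
    using ex_dual_pair by blast
  define \<pi> where "\<pi> = pb * core"
  have \<pi>\<pi>: "\<pi> * \<pi> = \<pi>" "star \<pi> = \<pi>" "\<nu> * \<pi> = 0"
    using core_good(5) goodD[OF core_good(1)] pb_core(1)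
    by (simp_all add: \<pi>_def mult.assoc mult_ext[OF pb_core(1)] mult_ext[OF pa_pb(2)] mult_ext[OF iso_simps(14)])
  define p where "p = x * star \<nu>"
  define q where "q = y * star \<nu>"
  have pq: "pa * p = p" "pa * q = q" "e * p = p" "e * q = q" "p * star \<nu> = p" "q * star \<nu> = q"
    using mult_ext[OF odd_pb[OF xD(2)], of "star \<nu>"] mult_ext[OF odd_pb[OF yD(2)], of "star \<nu>"]
    by (simp_all add: p_def q_def mult.assoc iso_simps mult_ext[OF xD(4)] mult_ext[OF yD(4)])
  have pqF: "star p * F2 - star q * F1 = 0"
  proof -
    have "star p * F2 - star q * F1 = \<nu> * (x * F2 - y * F1)"
      by (simp add: p_def q_def xD yD right_diff_distrib mult.assoc)
    then show ?thesis
      by (simp add: F12(1) \<pi>\<pi>(3)[unfolded \<pi>_def])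
  qed
  have Fpq: "star F2 * p - star F1 * q = 0"
    using arg_cong[OF pqF, of star] by simp
  have spq: "star p * q = star q * p"
    using xy_odds(3) by (simp add: p_def q_def xD yD mult.assoc) (simp flip: mult.assoc)
  \<comment> \<open>\<open>(P, R)\<close> is the projection of \<open>(p, q)\<close> along the
    columns of \<open>(F1, F2)\<close> onto the symplectic complement of the pairs
    \<open>(x' u, y' u)\<close>, times \<open>detm (M x' y')\<close> to stay polynomial. At the core
    of \<open>(x, y)\<close>, \<open>M\<close> is 1 and \<open>S\<close> is 0, so
    \<open>(P, R)\<close> is \<open>(p, q)\<close>.\<close>
  define M where "M x' y' = x' * F2 - y' * F1 + (1 - \<pi>)" for x' y'
  define S where "S x' y' = adjm (M x' y') * (x' * q - y' * p)" for x' y'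
  define P where "P x' y' = detm (M x' y') *e p - F1 * S x' y'" for x' y'
  define R where "R x' y' = detm (M x' y') *e q - F2 * S x' y'" for x' y'
  \<comment> \<open>The leading determinant makes \<open>h\<close> vanish where the projection is
    undefined.\<close>
  define h where "h x' y' = detm (M x' y') * F (x' + P x' y' + star (P x' y')) (y' + R x' y' + star (R x' y'))" for x' y'
  have ext: "commuting e (x' + P x' y' + star (P x' y')) (y' + R x' y' + star (R x' y'))"
    "tr ((x' + P x' y' + star (P x' y')) * (x' + P x' y' + star (P x' y'))) = tr (x' * x')"
    if xy': "commuting core x' y'" and D: "detm (M x' y') \<noteq> 0" for x' y'
  proof -
    have x': "x' \<in> odds core" and y': "y' \<in> odds core"
      using xy' by (simp_all add: commuting_def)
    have \<pi>z: "\<pi> * (z * T) = z * T" if z: "z \<in> odds core" and T: "pa * T = T" for z T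
    proof -
      have "\<pi> * (z * T) = pb * (core * z) * T"
        by (simp add: \<pi>_def mult.assoc)
      also have "\<dots> = z * (pa * T)"
        by (simp add: odds_left[OF core_good(1) z] odd_pa[OF oddsD(2)[OF z], symmetric] mult.assoc)
      finally show ?thesis
        by (simp add: T)
    qed
    define W where "W = x' * q - y' * p"
    define m where "m = x' * F2 - y' * F1"
    have W: "\<pi> * W = W" "\<pi> * m = m" "W * star \<nu> = W"
      using \<pi>z[OF x'] \<pi>z[OF y'] F12(3,4) pq
      by (simp_all add: W_def m_def left_diff_distrib right_diff_distrib mult.assoc)
    have MS: "M x' y' * S x' y' = detm (M x' y') *e W"
      using mult_ext[OF mult_adjm[OF D]] by (simp add: S_def W_def)
    have "(1 - \<pi>) * M x' y' = 1 - \<pi>"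
      using W(2) \<pi>\<pi>(1) by (simp add: M_def m_def algebra_simps)
    then have "(1 - \<pi>) * S x' y' = (1 - \<pi>) * (detm (M x' y') *e W)"
      using MS by (metis mult.assoc)
    then have "(1 - \<pi>) * S x' y' = 0"
      by (simp add: left_diff_distrib W(1))
    then have mS: "m * S x' y' = detm (M x' y') *e W"
      using MS by (simp add: M_def m_def distrib_right)
    have S\<nu>: "S x' y' * star \<nu> = S x' y'"
      using W(3) by (simp add: S_def W_def mult.assoc)
    let ?D = "detm (M x' y')" and ?S = "S x' y'" and ?P = "P x' y'" and ?R = "R x' y'"
    have "x' * ?R - y' * ?P = ?D *e W - m * ?S"
      by (simp add: P_def R_def W_def m_def left_diff_distrib right_diff_distrib smul_add mult.assoc)
    then have 1: "x' * ?R = y' * ?P"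
      by (simp add: mS)
    have "star ?P * ?R - star ?R * ?P = (?D * ?D) *e (star p * q - star q * p)
        - ?D *e ((star p * F2 - star q * F1) * ?S) + ?D *e (star ?S * (star F2 * p - star F1 * q))
        + star ?S * (star F1 * F2 - star F2 * F1) * ?S"
      by (simp add: P_def R_def left_diff_distrib right_diff_distrib smul_add mult.assoc)
    then have 2: "star ?P * ?R = star ?R * ?P"
      by (simp add: spq pqF Fpq F12(2))
    have PR: "pa * ?P = ?P" "e * ?P = ?P" "?P * star \<nu> = ?P" "pa * ?R = ?R" "e * ?R = ?R" "?R * star \<nu> = ?R"
      by (simp_all add: P_def R_def left_diff_distrib right_diff_distrib pq mult.assoc S\<nu>
          mult_ext[OF F12(3)] mult_ext[OF F12(4)] mult_ext[OF F12(5)] mult_ext[OF F12(6)])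
    show "commuting e (x' + ?P + star ?P) (y' + ?R + star ?R)"
      "tr ((x' + ?P + star ?P) * (x' + ?P + star ?P)) = tr (x' * x')"
      using commuting_extension[OF xy' PR 1 2] by simp_all
  qed
  have "polyfun h"
  proof (rule polyfunI)
    note ents = entries_add[OF funring_pairfuns] entries_diff[OF funring_pairfuns] entries_mult[OF funring_pairfuns]
      entries_const[OF funring_pairfuns] entries_adjm[OF funring_pairfuns] entries_smul[OF funring_pairfuns]
      funring_detm[OF funring_pairfuns] entries_fst entries_snd
    have M: "entries_in pairfuns (\<lambda>p. M (fst p) (snd p))"
      unfolding M_def by (intro ents)
    then have S: "entries_in pairfuns (\<lambda>p. S (fst p) (snd p))"
      unfolding S_def by (intro ents)
    have P: "entries_in pairfuns (\<lambda>p. P (fst p) (snd p))"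
      unfolding P_def by (intro ents M S)
    have R: "entries_in pairfuns (\<lambda>p. R (fst p) (snd p))"
      unfolding R_def by (intro ents M S)
    show "(\<lambda>p. h (fst p) (snd p)) \<in> pairfuns"
      unfolding h_def
      by (intro funring_mult[OF funring_pairfuns] polyfun_compose[OF polyF funring_pairfuns] ents
          entries_star[OF funring_pairfuns] M P R)
  qed
  moreover have "h x' (oddpoly r x') = 0" if x': "x' \<in> odds core" for x' r
  proof -
    obtain u where u: "act (pa * e) u = u" "b u u \<noteq> 0"
    proof -
      have "star (pa * e) = pa * e" "pa * e * (pa * e) = pa * e"
        using even_pa[OF goodD(3)[OF e]] goodD[OF e]
        by (simp_all add: mult.assoc mult_ext[OF even_pa[OF goodD(3)[OF e]]] mult_ext[OF pa_pb(1)])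
      then obtain v where "b (act (pa * e) v) v \<noteq> 0"
        using ex_nonisotropic pae by metis
      then have "b (act (pa * e) v) (act (pa * e) v) \<noteq> 0"
        using \<open>star (pa * e) = pa * e\<close> \<open>pa * e * (pa * e) = pa * e\<close> by (metis act_mult b_star)
      then show thesis
        using that[of "act (pa * e) v"] \<open>pa * e * (pa * e) = pa * e\<close> by (metis act_mult)
    qed
    obtain w where w: "act \<pi> w = w" "b w w \<noteq> 0"
    proof -
      obtain v where "b (act \<pi> v) v \<noteq> 0"
        using ex_nonisotropic \<pi>\<pi>(2) core0 \<pi>_def by metis
      then have "b (act \<pi> v) (act \<pi> v) \<noteq> 0"
        using \<pi>\<pi>(1,2) by (metis act_mult b_star)
      then show thesis
        using that[of "act \<pi> v"] \<pi>\<pi>(1) by (metis act_mult)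
    qed
    have Au: "act A u = - u" and core_u: "act core u = u"
    proof -
      have "A * (pa * e) = - (pa * e)" "core * (pa * e) = pa * e"
        using core_good(2,3) goodD(1)[OF core_good(1)]
        by (simp add: flip: mult.assoc) (metis core_good(2,3) goodD(1)[OF e] pb_core(2,3) goodD(1)[OF core_good(1)] mult.assoc)
      then show "act A u = - u" "act core u = u"
        using u(1) by (metis act_mult act_simps(4))+
    qed
    have Aw: "act A w = w" and core_w: "act core w = w"
    proof -
      have "A * \<pi> = \<pi>" "core * \<pi> = \<pi>"
        using goodD(1)[OF core_good(1)] by (simp_all add: \<pi>_def mult_ext[OF pa_pb(9)] mult_ext[OF pb_core(1)] mult.assoc)
      then show "act A w = w" "act core w = w"
        using w(1) by (metis act_mult)+
    qed
    have "b (act A u) w = b u (act A w)"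
      by (rule b_A)
    then have buw: "b u w = 0" "b w u = 0"
      using Au Aw b_sym[of w u] by (simp_all add: b_simps)
    \<comment> \<open>A rank-two operator with \<open>tr (z * z) \<noteq> 0\<close>. It takes an
      anisotropic vector from each eigenspace, which is where \<open>pae\<close> and
      \<open>core0\<close> enter.\<close>
    define z where "z = ten u w + ten w u"
    have z: "z \<in> odds core"
      using Au Aw core_u core_w goodD(2)[OF core_good(1)] by (simp add: z_def odds_def distrib_left distrib_right)
    have trz: "tr (z * z) = 2 * (b u u * b w w)"
      by (simp add: z_def distrib_left distrib_right buw)
    define v where "v s = z + s *e (x' - z)" for s
    have v: "v s \<in> odds core" for s
      unfolding v_def using z x' by (intro odds_add odds_smul odds_diff)
    have v_line: "entries_in linefuns v"
      unfolding v_def by (intro entries_add[OF funring_linefuns]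
        entries_smul[OF funring_linefuns] entries_const[OF funring_linefuns] linefuns_id)
    have "h (v s) (oddpoly r (v s)) = 0" for s
    proof (rule linefuns_vanish_generic[of "\<lambda>s. h (v s) (oddpoly r (v s))" "\<lambda>s. tr (v s * v s)" 0])
      show "(\<lambda>s. h (v s) (oddpoly r (v s))) \<in> linefuns"
        unfolding oddpoly_def
        by (intro polyfun_compose[OF \<open>polyfun h\<close> funring_linefuns] entries_mult[OF funring_linefuns]
            entries_meval[OF funring_linefuns] v_line)
      show "(\<lambda>s. tr (v s * v s)) \<in> linefuns"
        by (intro funring_tr[OF funring_linefuns] entries_mult[OF funring_linefuns] v_line)
      show "tr (v 0 * v 0) \<noteq> 0"
        using u w by (simp add: v_def trz)
      show "h (v s) (oddpoly r (v s)) = 0" if tr: "tr (v s * v s) \<noteq> 0" for s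
      proof (cases "detm (M (v s) (oddpoly r (v s))) = 0")
        case False
        note ext' = ext[OF commuting_oddpoly[OF core_good(1) v] False]
        define X where "X = v s + P (v s) (oddpoly r (v s)) + star (P (v s) (oddpoly r (v s)))"
        have "X ^ k \<noteq> 0" for k
        proof
          assume "X ^ k = 0"
          then have "(X * X) ^ k = 0"
            by (rule square_power_0)
          then have "tr (X * X) = 0"
            by (rule tr_nilpotent)
          then show False
            using tr ext'(2) by (simp add: X_def)
        qed
        then show ?thesis
          using vanish_nonnilpotent[OF F e IH ext'(1)] by (simp add: h_def X_def)
      qed (simp add: h_def)
    qed
    from this[of 1] show ?thesis
      by (simp add: v_def)
  qed
  ultimately have "vanishing core h"
    by (simp add: vanishing_def)
  moreover have "dense_oddpoly core"
  proof -
    have "core \<noteq> e"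
    proof
      assume "core = e"
      then have "\<nu> + star \<nu> = 0"
        by (simp add: core_def algebra_simps)
      then have "(\<nu> + star \<nu>) * \<nu> = 0"
        by simp
      then have "\<nu> = 0"
        by (simp add: distrib_right iso_simps)
      then show False
        using \<nu>0 by simp
    qed
    then show ?thesis
      using IH rk_good_less[OF e core_good(1,2)] core_good(1) by (simp add: dense_below_def)
  qed
  moreover have "commuting core (core * x * core) (core * y * core)"
  proof -
    have in_core: "core * z * core \<in> odds core" if z: "z \<in> odds e" for z
    proof -
      have "A * (core * z * core) = core * (A * z) * core"
        by (simp add: goodD(3)[OF core_good(1)] mult_ext[OF goodD(3)[OF core_good(1)]] mult.assoc)
      also have "\<dots> = - (core * z * core * A)"
        by (simp add: oddsD(2)[OF z] goodD(3)[OF core_good(1)] mult.assoc)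
      finally show ?thesis
        using goodD[OF core_good(1)] oddsD(1)[OF z] by (simp add: odds_def mult.assoc)
    qed
    have "x * core * y = x * y" "y * core * x = y * x"
      by (simp_all add: core_def left_diff_distrib right_diff_distrib xD yD x\<nu> y\<nu> \<nu>x mult.assoc)
    moreover have "core * z * core * (core * z' * core) = core * (z * (core * core) * z') * core" for z z'
      by (simp only: mult.assoc)
    ultimately have "core * x * core * (core * y * core) = core * (x * y) * core"
      "core * y * core * (core * x * core) = core * (y * x) * core"
      by (simp_all only: goodD(1)[OF core_good(1)])
    then show ?thesis
      using xy_odds in_core by (simp add: commuting_def)
  qed
  ultimately have "h (core * x * core) (core * y * core) = 0"
    by (simp add: dense_oddpoly_iff)
  moreover have "h (core * x * core) (core * y * core) = F x y"
  proof -
    note coreF = core_fixes[OF F12(3,5)] core_fixes[OF F12(4,6)]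
      and core_pq = core_fixes[OF pq(1,3)] core_fixes[OF pq(2,4)]
    have "core * x * core * F2 - core * y * core * F1 = core * (x * F2 - y * F1)"
      by (simp add: mult.assoc coreF right_diff_distrib)
    also have "\<dots> = \<pi>"
      by (simp add: F12(1) \<pi>_def mult_ext[OF pb_core(1)] goodD(1)[OF core_good(1)] mult.assoc)
    finally have M: "M (core * x * core) (core * y * core) = 1"
      by (simp add: M_def)
    have "core * x * core * q - core * y * core * p = core * (x * y - y * x) * star \<nu>"
      by (simp add: mult.assoc core_pq left_diff_distrib right_diff_distrib) (simp add: p_def q_def)
    then have S: "S (core * x * core) (core * y * core) = 0"
      using xy_odds(3) by (simp add: S_def)
    have PR: "P (core * x * core) (core * y * core) = p" "R (core * x * core) (core * y * core) = q"
      by (simp_all add: P_def R_def S M)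
    have "core * z * core + z * star \<nu> + star (z * star \<nu>) = z"
      if z: "z \<in> odds e" "z * \<nu> = 0" "star \<nu> * z = 0" for z
    proof -
      have "\<nu> * z * star \<nu> = \<nu> * (pb * z) * star \<nu>"
        by (simp add: iso_simps flip: mult.assoc)
      also have "\<dots> = \<nu> * z * (pa * star \<nu>)"
        by (simp only: odd_pa[OF oddsD(2)[OF z(1)], symmetric] mult.assoc)
      finally have "\<nu> * (z * star \<nu>) = 0"
        by (simp add: iso_simps mult.assoc)
      then show ?thesis
        using z oddsD[OF z(1)] odds_left[OF e z(1)]
        by (simp add: core_def left_diff_distrib right_diff_distrib mult.assoc)
    qed
    then show ?thesis
      using xy_odds x\<nu> y\<nu> \<nu>x by (simp add: h_def PR M) (simp add: p_def q_def)
  qed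
  ultimately show ?thesis
    by simp
qed

end

end

section \<open>Totally isotropic common kernel: the case \<open>V\<^sub>0 = 0\<close>\<close>

definition joint_kernel :: "('a, 'n) endo \<Rightarrow> ('a, 'n) endo \<Rightarrow> ('a, 'n) endo \<Rightarrow> ('a^'n) set" where
  "joint_kernel e x y = {u. act e u = u \<and> act x u = 0 \<and> act y u = 0}"

lemma subspace_joint_kernel: "vec.subspace (joint_kernel e x y)"
  by (simp add: vec.subspace_def joint_kernel_def)

lemma tr_star: "tr (star x) = tr x"
proof -
  have "tr (star x) = tr (Endo (transpose (matrix_of x)) * (gram * gram_inv))"
    unfolding star_def by (simp add: tr_mult_commute[of gram_inv] mult.assoc)
  then show ?thesis
    by (simp add: gram_gram_inv tr_eq_sum_entry transpose_def entry.rep_eq)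
qed

lemma ten_diff: "ten (u - u') v = ten u v - ten u' v" "ten u (v - v') = ten u v - ten u v'"
  using ten_add(1)[of u "- u'" v] ten_add(2)[of u v "- v'"] by simp_all

definition sym :: "'a^'n \<Rightarrow> 'a^'n \<Rightarrow> ('a, 'n) endo" where
  "sym v c = ten v c + ten c v"

lemma sym_mult: "star x = x \<Longrightarrow> x * sym v c = ten (act x v) c + ten (act x c) v"
  "star x = x \<Longrightarrow> sym v c * x = ten v (act x c) + ten c (act x v)"
  by (simp_all add: sym_def distrib_left distrib_right)

lemma act_sym: "act (sym v c) u = b c u *s v + b v u *s c"
  by (simp add: sym_def)

lemma b_parity: "act A u = u \<Longrightarrow> act A v = - v \<Longrightarrow> b u v = 0" "act A u = u \<Longrightarrow> act A v = - v \<Longrightarrow> b v u = 0"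
  using b_A[of u v] b_sym[of u v] by (simp_all add: b_simps)

lemma ex_both_nonzero:
  assumes "v \<noteq> 0" "w \<noteq> 0"
  obtains t where "b v t \<noteq> 0" "b w t \<noteq> 0"
proof -
  obtain t t' where t: "b v t \<noteq> 0" "b w t' \<noteq> 0"
    using assms b_nondeg by metis
  show thesis
  proof (cases "b w t = 0 \<and> b v t' = 0")
    case True
    then show thesis
      using that[of "t + t'"] t by (simp add: b_simps)
  next
    case False
    then show thesis
      using that[of t] that[of t'] t by blast
  qed
qed

text \<open>The first-order condition suffices because \<open>sym v c\<close> and \<open>sym v d\<close> commute.\<close>

lemma commuting_line:
  assumes e: "good e" and xy: "commuting e x y"
    and v: "act A v = v" "act e v = v" "b v v = 0"
    and c: "act A c = - c" "act e c = c" and d: "act A d = - d" "act e d = d"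
    and first: "x * sym v d + sym v c * y = sym v d * x + y * sym v c"
  shows "commuting e (x + s *e sym v c) (y + s *e sym v d)"
proof -
  have x: "x \<in> odds e" and y: "y \<in> odds e" and comm: "x * y = y * x"
    using xy unfolding commuting_def by blast+
  have "sym v c' \<in> odds e" if "act A c' = - c'" "act e c' = c'" for c'
    using v that goodD(2)[OF e] by (simp add: odds_def sym_def distrib_left distrib_right)
  then have odd: "x + s *e sym v c \<in> odds e" "y + s *e sym v d \<in> odds e"
    using x y c d by (auto intro!: odds_add odds_smul)
  have zw: "sym v c * sym v d = sym v d * sym v c"
    using v c d b_parity[OF v(1) c(1)] b_parity[OF v(1) d(1)] b_sym[of c d]
    by (simp add: sym_def distrib_left distrib_right)
  have "(x + s *e sym v c) * (y + s *e sym v d)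
      = x * y + s *e (x * sym v d + sym v c * y) + (s * s) *e (sym v c * sym v d)"
    by (simp add: distrib_left distrib_right smul_add)
  also have "\<dots> = y * x + s *e (sym v d * x + y * sym v c) + (s * s) *e (sym v d * sym v c)"
    by (simp only: comm first zw)
  also have "\<dots> = (y + s *e sym v d) * (x + s *e sym v c)"
    by (simp add: distrib_left distrib_right smul_add)
  finally show ?thesis
    using odd by (simp add: commuting_def)
qed

context
  fixes e \<nu> x y :: "('a, 'n) endo"
  assumes e: "good e" and \<nu>: "isotropic_projection e \<nu>" "\<nu> \<noteq> 0" and xy: "commuting e x y"
    and x\<nu>: "x * \<nu> = 0" and y\<nu>: "y * \<nu> = 0"
    and kernel: "\<And>u. act (pb * e) u = u \<Longrightarrow> act x u = 0 \<Longrightarrow> act y u = 0 \<Longrightarrow> act \<nu> u = u"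
    and lagrangian: "pb * e = \<nu> + star \<nu>"
begin

lemmas iso = iso_simps[OF e \<nu>(1)]

lemma lag_odds: "x \<in> odds e" "y \<in> odds e" "x * y = y * x"
  using xy unfolding commuting_def by blast+

lemmas lag_x = oddsD[OF lag_odds(1)] odds_left[OF e lag_odds(1)]
lemmas lag_y = oddsD[OF lag_odds(2)] odds_left[OF e lag_odds(2)]

text \<open>The first-order condition says that the antisymmetrizations of \<open>x v\<close> with
  \<open>d\<close>, of \<open>c\<close> with \<open>y v\<close> and of \<open>x d - y c\<close> with
  \<open>v\<close> add up to zero. The ansatz \<open>d = \<alpha> x v + \<beta> y v\<close>,
  \<open>c = - \<beta> x v + \<delta> y v\<close> cancels the first two, and
  \<open>x d = y c\<close> becomes
  \<open>(\<alpha> x^2 + 2 \<beta> x y - \<delta> y^2) v = 0\<close>. With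
  \<open>\<alpha> = 0\<close>, \<open>\<beta> = 1\<close>, \<open>\<delta> = 2 \<mu>\<close> this is
  \<open>x y v = \<mu> y^2 v\<close>, an eigenvalue problem if \<open>y^2\<close> maps
  \<open>N'\<close> bijectively onto \<open>N\<close>. If \<open>y^2 v = 0\<close> for some nonzero
  \<open>v\<close> in \<open>N'\<close>, one takes \<open>\<beta> = 0\<close>,
  \<open>\<delta> = 1\<close>, or \<open>\<mu> = 0\<close> when \<open>y v = 0\<close>.\<close>

lemma ex_line_direction:
  obtains v c d where "v \<noteq> 0" "act (star \<nu>) v = v" "act A c = - c" "act e c = c" "act A d = - d" "act e d = d"
    "c \<noteq> 0 \<or> d \<noteq> 0" "x * sym v d + sym v c * y = sym v d * x + y * sym v c"
proof -
  note result = that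
  have nu_v: "act A v = v" "act e v = v" "act \<nu> v = 0" if "act (star \<nu>) v = v" for v
    using that iso(3,9,11) by (metis act_mult act_simps(1))+
  have img: "act A (act z v) = - act z v" "act e (act z v) = act z v" if "act (star \<nu>) v = v" "z \<in> odds e" for z v
  proof -
    have "act (A * z) v = - act z (act A v)"
      using oddsD(2)[OF that(2)] by simp
    then show "act A (act z v) = - act z v"
      using nu_v(1)[OF that(1)] by simp
    show "act e (act z v) = act z v"
      using odds_left[OF e that(2)] by (simp flip: act_mult)
  qed
  have not_ker: "act x v \<noteq> 0 \<or> act y v \<noteq> 0" if "v \<noteq> 0" "act (star \<nu>) v = v" for v
  proof (rule ccontr)
    assume "\<not> ?thesis"
    moreover have "act (pb * e) v = v"
      using that nu_v(3) by (simp add: lagrangian)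
    ultimately have "act \<nu> v = v"
      using kernel by blast
    then show False
      using nu_v(3)[OF that(2)] that(1) by simp
  qed
  have II: thesis if v: "v \<noteq> 0" "act (star \<nu>) v = v" and \<mu>: "act x (act y v) = \<mu> *s act y (act y v)" for v \<mu>
  proof (rule result[of v "- act x v + (2 * \<mu>) *s act y v" "act y v"])
    have yx: "act y (act x v) = \<mu> *s act y (act y v)"
      using \<mu> lag_odds(3) by (metis act_mult)
    have yc: "act y (- act x v + (2 * \<mu>) *s act y v) = \<mu> *s act y (act y v)"
      by (simp add: yx vec_eq_iff algebra_simps)
    show "x * sym v (act y v) + sym v (- act x v + (2 * \<mu>) *s act y v) * y
        = sym v (act y v) * x + y * sym v (- act x v + (2 * \<mu>) *s act y v)"
      unfolding sym_mult[OF lag_x(1)] sym_mult[OF lag_y(1)] yc \<mu> by (simp add: ten_add ten_diff)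
    show "- act x v + (2 * \<mu>) *s act y v \<noteq> 0 \<or> act y v \<noteq> 0"
      using not_ker[OF v] by auto
    show "act A (- act x v + (2 * \<mu>) *s act y v) = - (- act x v + (2 * \<mu>) *s act y v)"
      using img(1)[OF v(2) lag_odds(1)] img(1)[OF v(2) lag_odds(2)] by (simp add: vec.scale_minus_right)
  qed (use v img[OF v(2)] lag_odds in simp_all)
  show thesis
  proof (cases "\<exists>v. v \<noteq> 0 \<and> act (star \<nu>) v = v \<and> act y (act y v) = 0")
    case True
    then obtain v where v: "v \<noteq> 0" "act (star \<nu>) v = v" "act y (act y v) = 0"
      by blast
    show thesis
    proof (cases "act y v = 0")
      case True
      then show thesis
        using II[of v 0] v by simp
    next
      case False
      show thesis
      proof (rule result[of v "act y v" 0])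
        show "x * sym v 0 + sym v (act y v) * y = sym v 0 * x + y * sym v (act y v)"
          unfolding sym_mult[OF lag_y(1)] v(3) by (simp add: sym_def)
      qed (use v img[OF v(2)] lag_odds False in simp_all)
    qed
  next
    case False
    define m where "m = y * y * star \<nu>"
    have inj: "inj_on (act (y * y)) (range (act (star \<nu>)))"
    proof (rule inj_onI)
      fix u u' assume u: "u \<in> range (act (star \<nu>))" "u' \<in> range (act (star \<nu>))" "act (y * y) u = act (y * y) u'"
      have "act (star \<nu>) u = u" "act (star \<nu>) u' = u'"
        using u iso(8) by (metis act_mult rangeE)+
      then have "act (star \<nu>) (u - u') = u - u'" "act y (act y (u - u')) = 0"
        using u(3) by simp_all
      then show "u = u'"
        using False by (metis eq_iff_diff_eq_0)
    qed
    obtain L where L: "range (act L) \<subseteq> range (act (star \<nu>))"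
      "\<And>u. u \<in> range (act (star \<nu>)) \<Longrightarrow> act L (act (y * y) u) = u"
      using vec.linear_exists_left_inverse_on[OF linear_act subspace_range_act inj] endo_of_linear by metis
    \<comment> \<open>Since \<open>x\<close> and \<open>y\<close> kill \<open>N\<close>, their
      images are orthogonal to \<open>N\<close>; within \<open>V\<^sub>b = N + N'\<close> this
      places the images of the even products in \<open>N\<close>.\<close>
    have to_\<nu>: "z * star \<nu> = \<nu> * (z * star \<nu>)" if "star \<nu> * z = 0" "A * z = z * A" "e * z = z" for z
    proof -
      have "z * star \<nu> = e * z * (pb * star \<nu>)"
        by (simp add: iso that)
      also have "\<dots> = (pb * e) * z * star \<nu>"
        using even_pb[OF that(2)] even_pb[OF goodD(3)[OF e]] by (metis mult.assoc that(3))
      also have "\<dots> = \<nu> * (z * star \<nu>)"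
        by (simp add: lagrangian distrib_right that mult.assoc mult_ext[OF that(1)])
      finally show ?thesis .
    qed
    have \<nu>y: "star \<nu> * x = 0" "star \<nu> * y = 0"
      using arg_cong[OF x\<nu>, of star] arg_cong[OF y\<nu>, of star] lag_x(1) lag_y(1) by simp_all
    have xyA: "A * (x * y) = x * y * A"
    proof -
      have "A * (x * y) = - (x * (A * y))"
        by (simp add: lag_x(2) flip: mult.assoc)
      then show ?thesis
        by (simp add: lag_y(2) mult.assoc)
    qed
    have m: "m = \<nu> * m" "x * y * star \<nu> = \<nu> * (x * y * star \<nu>)"
      unfolding m_def using lag_x lag_y \<nu>y A_square xyA
      by (intro to_\<nu>; simp flip: mult.assoc)+
    \<comment> \<open>\<open>N\<close> and \<open>N'\<close> have equal dimension, so the injective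
      map \<open>y * y\<close> from \<open>N'\<close> to \<open>N\<close> is onto.\<close>
    have "rk (star \<nu>) = rk \<nu>"
    proof -
      have "of_nat (rk (star \<nu>)) = (of_nat (rk \<nu>) :: 'a)"
        using tr_idempotent[OF iso(1)] tr_idempotent[OF iso(8)] tr_star[of \<nu>] by simp
      then show ?thesis
        by simp
    qed
    moreover have "rk (star \<nu>) \<le> rk m"
    proof -
      have "range (act (star \<nu>)) = act L ` range (act m)"
        using L(2) by (auto simp: m_def image_image)
      then show ?thesis
        unfolding rk_def using vec.dim_image_le[OF linear_act] by metis
    qed
    moreover have "range (act m) \<subseteq> range (act \<nu>)"
      using m(1) by (metis act_mult image_subsetI rangeI)
    ultimately have range_m: "range (act m) = range (act \<nu>)"
      using rk_less[of m \<nu>] by fastforce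
    have L\<nu>: "star \<nu> * L = L"
    proof (rule endo_eqI)
      fix u
      obtain t where "act L u = act (star \<nu>) t"
        using L(1) by blast
      then show "act (star \<nu> * L) u = act L u"
        using iso(8) by (metis act_mult)
    qed
    define M where "M = L * (x * y * star \<nu>)"
    have M: "M * star \<nu> = M" "star \<nu> * M = M"
      using L\<nu> by (simp_all add: M_def mult.assoc iso) (simp flip: mult.assoc)
    have "star \<nu> \<noteq> 0"
      using \<nu>(2) by (metis star_star star_simps(6))
    then obtain \<mu> where \<mu>: "\<nexists>z. (M - \<mu> *e star \<nu>) * z = star \<nu>"
      using ex_noninvertible_shift[OF iso(8) _ M] by blast
    \<comment> \<open>The summand \<open>1 - star \<nu>\<close> confines the kernel of
      \<open>K\<close> to \<open>N'\<close>, where it consists of eigenvectors of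
      \<open>M\<close>.\<close>
    define K where "K = M - \<mu> *e star \<nu> + (1 - star \<nu>)"
    have \<nu>K: "star \<nu> * K = M - \<mu> *e star \<nu>" "(1 - star \<nu>) * K = 1 - star \<nu>"
      by (simp_all add: K_def distrib_left left_diff_distrib right_diff_distrib M iso)
    have "\<nexists>z. K * z = 1"
      using \<mu> \<nu>K(1) by (metis mult.assoc mult_1_right)
    then obtain v where v: "v \<noteq> 0" "act K v = 0"
      using ex_kernel by blast
    have "act ((1 - star \<nu>) * K) v = 0" "act (star \<nu> * K) v = 0"
      using v(2) by simp_all
    then have v': "act (star \<nu>) v = v" "act M v = \<mu> *s v"
      unfolding \<nu>K by simp_all
    have "act (x * y * star \<nu>) v \<in> range (act \<nu>)"
      using m(2) by (metis act_mult rangeI)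
    then obtain t where t: "act (x * y * star \<nu>) v = act m t"
      using range_m by blast
    define t' where "t' = act (star \<nu>) t"
    have "act M v = t'"
      using t L(2)[of t'] by (simp add: M_def m_def t'_def)
    then have "t' = \<mu> *s v"
      using v'(2) by simp
    moreover have "act x (act y v) = act y (act y t')"
      using t v'(1) by (simp add: m_def t'_def)
    ultimately have "act x (act y v) = \<mu> *s act y (act y v)"
      by simp
    then show thesis
      using II v(1) v'(1) by blast
  qed
qed

text \<open>At \<open>u\<close> in \<open>V\<^sub>b\<close> the operators change by
  \<open>s * b v u\<close> times \<open>c\<close> and \<open>d\<close>. If some \<open>w\<close> in
  \<open>V\<^sub>b\<close> has \<open>x w = c\<close> and \<open>y w = d\<close>, a multiple of
  \<open>w\<close> compensates this, and an anisotropic kernel vector appears. Otherwise the kernel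
  only loses vectors, among them those of \<open>N\<close> not orthogonal to
  \<open>v\<close>.\<close>

lemma vanish_lagrangian:
  assumes F: "vanishing e F" and IH: "dense_below e"
    and inner: "\<And>x' y'. commuting e x' y' \<Longrightarrow>
      vec.dim (joint_kernel e x' y') < vec.dim (joint_kernel e x y) \<Longrightarrow> F x' y' = 0"
  shows "F x y = 0"
proof -
  have polyF: "polyfun F"
    using F by (simp add: vanishing_def)
  obtain v c d where v: "v \<noteq> 0" "act (star \<nu>) v = v" and c: "act A c = - c" "act e c = c"
    and d: "act A d = - d" "act e d = d" and cd: "c \<noteq> 0 \<or> d \<noteq> 0"
    and first: "x * sym v d + sym v c * y = sym v d * x + y * sym v c"
    by (rule ex_line_direction)
  have v': "act A v = v" "act e v = v"
    using v(2) iso(9,11) by (metis act_mult)+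
  have "b (act (star \<nu>) v) (act (star \<nu>) v) = b v (act (\<nu> * star \<nu>) v)"
    by (simp add: b_star')
  then have "b v v = 0"
    using v(2) by (simp add: iso)
  define X where "X s = x + s *e sym v c" for s
  define Y where "Y s = y + s *e sym v d" for s
  have XY: "commuting e (X s) (Y s)" for s
    unfolding X_def Y_def by (rule commuting_line[OF e xy v' \<open>b v v = 0\<close> c d first])
  have line: "(\<lambda>s. F (X s) (Y s)) \<in> linefuns"
    unfolding X_def Y_def
    by (intro polyfun_compose[OF polyF funring_linefuns] entries_add[OF funring_linefuns]
        entries_smul[OF funring_linefuns] entries_const[OF funring_linefuns] linefuns_id)
  have bv: "b v (act \<nu> t) = b v t" for t
    using b_star'[of \<nu> v t] v(2) by simp
  have even: "act A (act \<nu> t) = act \<nu> t" "act e (act \<nu> t) = act \<nu> t" "act x (act \<nu> t) = 0" "act y (act \<nu> t) = 0" for t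
    using iso(4,6) x\<nu> y\<nu> by (simp_all flip: act_mult)
  have act_even: "act (X s) u = act x u + (s * b v u) *s c" "act (Y s) u = act y u + (s * b v u) *s d" if "act A u = u" for u s
    using b_parity(2)[OF that c(1)] b_parity(2)[OF that d(1)] by (simp_all add: X_def Y_def act_sym)
  have "F (X 0) (Y 0) = 0"
  proof (cases "\<exists>w. act A w = w \<and> act e w = w \<and> act x w = c \<and> act y w = d")
    case True
    then obtain w where w: "act A w = w" "act e w = w" "act x w = c" "act y w = d"
      by blast
    have "act (star \<nu>) w \<noteq> 0"
    proof
      assume 0: "act (star \<nu>) w = 0"
      have "act pb w = (1 / 2) *s (w + w)"
        using w(1) by (simp add: pb_def)
      then have "act pb w = w"
        by (simp add: vec_eq_iff)
      then have "act (pb * e) w = w"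
        by (simp add: w)
      then have "w = act \<nu> w"
        using 0 by (simp add: lagrangian)
      then show False
        using even(3,4) w(3,4) cd by metis
    qed
    then obtain t where t: "b v t \<noteq> 0" "b (act (star \<nu>) w) t \<noteq> 0"
      using ex_both_nonzero v(1) by blast
    define n where "n = act \<nu> t"
    have n: "b v n \<noteq> 0" "b w n \<noteq> 0" "b n n = 0"
    proof -
      show "b v n \<noteq> 0" "b w n \<noteq> 0"
        using t bv b_star'[of \<nu> w t] by (simp_all add: n_def)
      have "b (act \<nu> t) (act \<nu> t) = b t (act (star \<nu> * \<nu>) t)"
        by (simp add: b_star)
      then show "b n n = 0"
        by (simp add: n_def iso)
    qed
    define D where "D s = s * b v n * b w w - 2 * (1 + s * b v w) * b w n" for s
    have "F (X s) (Y s) = 0" if "s \<notin> insert 0 {s. D s = 0}" for s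
    proof -
      \<comment> \<open>Here \<open>b v u = b v n\<close>, so the perturbation cancels the
        contribution of \<open>w\<close>. Moreover \<open>b u u = s * b v n * D s\<close>, and
        \<open>D 0 = - 2 * b w n\<close> is nonzero.\<close>
      define u where "u = (1 + s * b v w) *s n - (s * b v n) *s w"
      have u: "act A u = u" "act e u = u"
        using w even by (simp_all add: u_def n_def)
      have "b v u = b v n"
        by (simp add: u_def b_simps algebra_simps)
      then have "act (X s) u = 0" "act (Y s) u = 0"
        unfolding act_even[OF u(1)] using w even by (simp_all add: u_def n_def)
      moreover have "b u u = s * b v n * D s"
        using n(3) b_sym[of n w] by (simp add: u_def b_simps D_def algebra_simps)
      then have "b u u \<noteq> 0"
        using that n by simp
      ultimately show ?thesis
        using vanish_nonisotropic_kernel[OF F e IH XY u(2), of 1] u(1) by simp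
    qed
    moreover have "finite {s. D s = 0}"
    proof (rule linefuns_finite_zeros[of D 0])
      have "D s = poly [:- 2 * b w n, b v n * b w w - 2 * b v w * b w n:] s" for s
        by (simp add: D_def algebra_simps)
      then show "D \<in> linefuns"
        unfolding linefuns_def by blast
    qed (use n in \<open>simp add: D_def\<close>)
    ultimately show ?thesis
      using linefuns_vanish[OF line, of "insert 0 {s. D s = 0}"] by blast
  next
    case False
    have "F (X s) (Y s) = 0" if s: "s \<notin> {0}" for s
    proof (rule inner[OF XY])
      have s0: "s \<noteq> 0"
        using s by simp
      have "joint_kernel e (X s) (Y s) \<subseteq> joint_kernel e x y"
      proof
        fix u assume "u \<in> joint_kernel e (X s) (Y s)"
        then have u: "act e u = u" "act (X s) u = 0" "act (Y s) u = 0"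
          by (simp_all add: joint_kernel_def)
        have XsD: "A * X s = - (X s * A)" "A * Y s = - (Y s * A)"
          using XY[of s] oddsD(2) by (auto simp: commuting_def)
        define ub where "ub = act pb u"
        define ua where "ua = act pa u"
        have u_sum: "u = ua + ub"
          using pa_add_pb by (metis act_1 act_simps(2) ua_def ub_def)
        have "act (X s) ub = act (X s * pb) u" "act (Y s) ub = act (Y s * pb) u"
          by (simp_all add: ub_def)
        then have Xub: "act (X s) ub = 0" "act (Y s) ub = 0"
          using u by (simp_all add: odd_pb[OF XsD(1)] odd_pb[OF XsD(2)])
        then have Xua: "act (X s) ua = 0" "act (Y s) ua = 0"
          using u u_sum by simp_all
        have A_ub: "act A ub = ub" "act e ub = ub" and A_ua: "act A ua = - ua"
          using u(1) even_pb[OF goodD(3)[OF e]] by (simp_all add: ua_def ub_def flip: act_mult)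
            (simp add: even_pb[OF goodD(3)[OF e]])
        have eqs: "act x ub = - ((s * b v ub) *s c)" "act y ub = - ((s * b v ub) *s d)"
          using Xub act_even[OF A_ub(1)] by (simp_all add: eq_neg_iff_add_eq_0)
        have "b v ub = 0"
        proof (rule ccontr)
          assume nz: "b v ub \<noteq> 0"
          have "act x ((- 1 / (s * b v ub)) *s ub) = c" "act y ((- 1 / (s * b v ub)) *s ub) = d"
            using nz s0 by (simp_all add: eqs vec_eq_iff)
          moreover have "act A ((- 1 / (s * b v ub)) *s ub) = (- 1 / (s * b v ub)) *s ub"
            "act e ((- 1 / (s * b v ub)) *s ub) = (- 1 / (s * b v ub)) *s ub"
            using A_ub by simp_all
          ultimately show False
            using False by blast
        qed
        then have "act x ub = 0" "act y ub = 0"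
          using eqs by simp_all
        moreover have "act x ua = 0" "act y ua = 0"
        proof -
          \<comment> \<open>\<open>star \<nu>\<close> kills the image of \<open>z\<close> and fixes
            \<open>v\<close>, so the two summands vanish separately.\<close>
          have *: "act z ua = 0" if z: "star z = z" "z * \<nu> = 0" "act z ua + s *s (b c' ua *s v) = 0" for z c'
          proof -
            have "star \<nu> * z = 0"
              using arg_cong[OF z(2), of star] z(1) by simp
            then have "act (star \<nu>) (act z ua) = 0"
              by (simp flip: act_mult)
            moreover have "act (star \<nu>) (act z ua + s *s (b c' ua *s v)) = 0"
              by (simp only: z(3) act_linear)
            ultimately have "s *s (b c' ua *s v) = 0"
              using v(2) by simp
            with z(3) show ?thesis
              by (simp only: add_0_right)
          qed
          show "act x ua = 0" "act y ua = 0"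
            using Xua b_parity(1)[OF v'(1) A_ua] *[OF lag_x(1) x\<nu>, of c] *[OF lag_y(1) y\<nu>, of d]
            by (simp_all add: X_def Y_def act_sym)
        qed
        ultimately show "u \<in> joint_kernel e x y"
          using u(1) u_sum by (simp add: joint_kernel_def)
      qed
      moreover have "joint_kernel e (X s) (Y s) \<noteq> joint_kernel e x y"
      proof -
        obtain t where "b v t \<noteq> 0"
          using v(1) b_nondeg by blast
        then have "act (X s) (act \<nu> t) \<noteq> 0 \<or> act (Y s) (act \<nu> t) \<noteq> 0"
          unfolding act_even[OF even(1)] using s0 cd by (simp add: bv even)
        then have "act \<nu> t \<notin> joint_kernel e (X s) (Y s)" "act \<nu> t \<in> joint_kernel e x y"
          using even by (auto simp: joint_kernel_def)
        then show ?thesis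
          by blast
      qed
      ultimately show "vec.dim (joint_kernel e (X s) (Y s)) < vec.dim (joint_kernel e x y)"
        by (intro vec.dim_psubset) (simp add: subspace_joint_kernel vec.span_eq_iff[THEN iffD2] psubset_eq)
    qed
    then show ?thesis
      using linefuns_vanish[OF line, of "{0}"] by blast
  qed
  then show ?thesis
    by (simp add: X_def Y_def)
qed

end

text \<open>\<open>N\<close> has to be the full common kernel in \<open>V\<^sub>b\<close>: the dual
  pair and the line direction both rest on no vector of \<open>V\<^sub>b\<close> outside
  \<open>N\<close> being killed.\<close>

lemma vanish_even_kernel:
  assumes F: "vanishing e F" and e: "good e" and IH: "dense_below e" and xy: "commuting e x y"
    and inner: "\<And>x' y'. commuting e x' y' \<Longrightarrow>
      vec.dim (joint_kernel e x' y') < vec.dim (joint_kernel e x y) \<Longrightarrow> F x' y' = 0"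
    and u: "u \<noteq> 0" "act e u = u" "act A u = u" "act x u = 0" "act y u = 0"
  shows "F x y = 0"
proof -
  define N where "N = {u. act e u = u \<and> act A u = u \<and> act x u = 0 \<and> act y u = 0}"
  have N: "vec.subspace N"
    by (simp add: vec.subspace_def N_def)
  show ?thesis
  proof (cases "\<exists>w\<in>N. b w w \<noteq> 0")
    case True
    then obtain w where "act e w = w" "act A w = w" "act x w = 0" "act y w = 0" "b w w \<noteq> 0"
      by (auto simp: N_def)
    then show ?thesis
      using vanish_nonisotropic_kernel[OF F e IH xy, of w 1] by simp
  next
    case False
    obtain \<nu> where \<nu>: "isotropic_projection e \<nu>" "range (act \<nu>) = N"
    proof (rule ex_isotropic_projection[OF e N])
      show "b w w = 0" if "w \<in> N" for w
        using False that by blast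
      show "act e w = w \<and> act A w = w" if "w \<in> N" for w
        using that by (simp add: N_def)
    qed
    have "act \<nu> w \<in> N" for w
      using \<nu>(2) by blast
    then have x\<nu>: "x * \<nu> = 0" and y\<nu>: "y * \<nu> = 0"
      by (auto intro!: endo_eqI simp: N_def)
    have "u \<in> N"
      using u by (simp add: N_def)
    then have \<nu>0: "\<nu> \<noteq> 0"
      using \<nu>(2) u(1) by auto
    have fix_N: "act \<nu> w = w" if w: "w \<in> N" for w
    proof -
      obtain t where "w = act \<nu> t"
        using \<nu>(2) w by blast
      then show ?thesis
        using iso_simps(1)[OF e \<nu>(1)] by (simp flip: act_mult)
    qed
    have kernel: "act \<nu> w = w" if "act (pb * e) w = w" "act x w = 0" "act y w = 0" for w
    proof -
      have "A * (pb * e) = pb * e" "e * (pb * e) = pb * e"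
        by (simp_all add: mult_ext[OF pa_pb(9)] mult_ext[OF even_pb[OF goodD(3)[OF e]]] mult.assoc goodD(1)[OF e])
      then have "act A (act (pb * e) w) = act (pb * e) w" "act e (act (pb * e) w) = act (pb * e) w"
        by (simp_all only: act_mult[symmetric])
      then have "act A w = w" "act e w = w"
        by (simp_all only: that(1))
      then show ?thesis
        using that fix_N by (simp add: N_def)
    qed
    show ?thesis
    proof (cases "pb * core e \<nu> = 0")
      case False
      then show ?thesis
        using vanish_core[OF e \<nu>(1) xy x\<nu> y\<nu> kernel F IH _ \<nu>0] by blast
    next
      case True
      then have "pb * e = \<nu> + star \<nu>"
        by (simp add: core_def[OF e \<nu>(1)] right_diff_distrib iso_simps[OF e \<nu>(1)] algebra_simps)
      then show ?thesis
        using vanish_lagrangian[OF e \<nu>(1) \<nu>0 xy x\<nu> y\<nu> kernel _ F IH inner] by blast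
    qed
  qed
qed

text \<open>Passing to \<open>- A\<close> exchanges the eigenspaces and leaves the notions of the
  statement unchanged, so kernel vectors in \<open>V\<^sub>b\<close> suffice.\<close>

lemma vanish_homogeneous_kernel:
  assumes F: "vanishing e F" and e: "good e" and IH: "dense_below e" and xy: "commuting e x y"
    and inner: "\<And>x' y'. commuting e x' y' \<Longrightarrow>
      vec.dim (joint_kernel e x' y') < vec.dim (joint_kernel e x y) \<Longrightarrow> F x' y' = 0"
    and u: "u \<noteq> 0" "act e u = u" "act A u = u \<or> act A u = - u" "act x u = 0" "act y u = 0"
  shows "F x y = 0"
  using u(3)
proof
  assume "act A u = u"
  then show ?thesis
    using vanish_even_kernel[OF F e IH xy inner u(1,2) _ u(4,5)] by blast
next
  assume Au: "act A u = - u"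
  interpret neg: quadratic_involution b "- A"
    by unfold_locales (simp_all add: b_simps b_A b_nondeg, metis b_sym)
  have good: "neg.good e' \<longleftrightarrow> good e'" for e'
    by (simp add: good_def neg.good_def)
  have odds: "neg.odds e' = odds e'" for e'
  proof -
    have "(- A * z = - (z * - A)) = (A * z = - (z * A))" for z
      by (metis minus_minus mult_minus_left mult_minus_right)
    then show ?thesis
      unfolding odds_def neg.odds_def by (simp only:)
  qed
  have comm: "neg.commuting e' x' y' \<longleftrightarrow> commuting e' x' y'" for e' x' y'
    by (simp add: commuting_def neg.commuting_def odds)
  have vanishing: "neg.vanishing e' F' \<longleftrightarrow> vanishing e' F'" for e' F'
    by (simp add: vanishing_def neg.vanishing_def odds)
  have "neg.dense_oddpoly e' \<longleftrightarrow> dense_oddpoly e'" for e'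
    by (simp add: dense_oddpoly_iff neg.dense_oddpoly_iff vanishing comm)
  then have "neg.dense_below e"
    using IH by (simp add: dense_below_def neg.dense_below_def good)
  then show ?thesis
    using neg.vanish_even_kernel[of e F x y u] F e xy inner u Au
    by (simp add: vanishing good comm)
qed

text \<open>The inner induction, on the dimension of the common kernel, serves only the case
  \<open>V\<^sub>0 = 0\<close>.\<close>

lemma dense_oddpoly_all: "good e \<Longrightarrow> dense_oddpoly e"
proof (induction "rk e" arbitrary: e rule: less_induct)
  case less
  note e = \<open>good e\<close>
  have IH: "dense_below e"
    using less.hyps by (simp add: dense_below_def)
  show ?case
    unfolding dense_oddpoly_iff
  proof (intro allI impI)
    fix F x y
    assume F: "vanishing e F" and "commuting e x y"
    then show "F x y = 0"
    proof (induction "vec.dim (joint_kernel e x y)" arbitrary: x y rule: less_induct)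
      case less
      note xy = \<open>commuting e x y\<close>
      have x: "x \<in> odds e" and y: "y \<in> odds e" and comm: "x * y = y * x"
        using xy unfolding commuting_def by blast+
      have inner: "F x' y' = 0" if "commuting e x' y'"
        "vec.dim (joint_kernel e x' y') < vec.dim (joint_kernel e x y)" for x' y'
        using less.hyps[OF that(2) F that(1)] .
      show ?case
      proof (cases "\<forall>k. x ^ k \<noteq> 0")
        case True
        then show ?thesis
          using vanish_nonnilpotent[OF F e IH xy] by blast
      next
        case False
        then obtain k where k: "x ^ k = 0"
          by blast
        show ?thesis
        proof (cases "\<forall>l. y ^ l \<noteq> 0")
          case True
          \<comment> \<open>For \<open>s \<noteq> 0\<close> the operator \<open>X s\<close> is not
            nilpotent: it commutes with the nilpotent \<open>x\<close> and differs from it by a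
            multiple of the nonnilpotent \<open>y\<close>.\<close>
          define X where "X s = x + s *e y" for s
          have "(\<lambda>s. F (X s) y) \<in> linefuns"
            unfolding X_def using F
            by (intro polyfun_compose[OF _ funring_linefuns] entries_add[OF funring_linefuns]
                entries_smul[OF funring_linefuns] entries_const[OF funring_linefuns] linefuns_id)
              (simp add: vanishing_def)
          moreover have "F (X s) y = 0" if s: "s \<notin> {0}" for s
          proof (rule vanish_nonnilpotent[OF F e IH])
            show "commuting e (X s) y"
              using x y comm unfolding X_def commuting_def
              by (simp add: odds_add odds_smul distrib_left distrib_right)
            show "X s ^ j \<noteq> 0" for j
            proof
              assume "X s ^ j = 0"
              moreover have "(- x) ^ k = 0"
                using k by (simp add: power_minus[of x k])
              moreover have "X s * (- x) = - x * X s"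
                using comm by (simp add: X_def distrib_left distrib_right)
              ultimately obtain n where "(X s + - x) ^ n = 0"
                using nilpotent_add by blast
              then have "(s *e y) ^ n = 0"
                by (simp add: X_def)
              moreover have "(s *e y) ^ n = (s ^ n) *e y ^ n"
                by (induction n) (simp_all add: mult.commute)
              ultimately show False
                using True s by simp
            qed
          qed
          ultimately have "F (X 0) y = 0"
            using linefuns_vanish[of _ "{0}"] by blast
          then show ?thesis
            by (simp add: X_def)
        next
          case False
          then obtain l where l: "y ^ l = 0"
            by blast
          show ?thesis
          proof (cases "e = 0")
            case True
            then have "x = 0" "y = oddpoly 0 x"
              using oddsD(3)[OF x] oddsD(3)[OF y] by simp_all
            then show ?thesis
              using F x unfolding vanishing_def by blast
          next
            case False
            then obtain t where t: "act e t \<noteq> 0"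
              using endo_eqI[of e 0] by auto
            obtain i where i: "act (x ^ i) (act e t) \<noteq> 0" "act x (act (x ^ i) (act e t)) = 0"
              using nilpotent_kernel[OF k t] by blast
            obtain j where j: "act (y ^ j) (act (x ^ i) (act e t)) \<noteq> 0"
              "act y (act (y ^ j) (act (x ^ i) (act e t))) = 0"
              using nilpotent_kernel[OF l i(1)] by blast
            define u where "u = act (y ^ j) (act (x ^ i) (act e t))"
            have cx: "x * y ^ j = y ^ j * x" and ce: "e * y ^ j = y ^ j * e" "e * x ^ i = x ^ i * e"
              using power_commuting_commutes[of y x j] power_commuting_commutes[of y e j]
                power_commuting_commutes[of x e i] comm oddsD(3)[OF x] oddsD(3)[OF y]
                odds_left[OF e x] odds_left[OF e y] by simp_all
            have "act x u = act (y ^ j) (act x (act (x ^ i) (act e t)))"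
              unfolding u_def using cx by (metis act_mult)
            moreover have "act e u = act (y ^ j) (act (x ^ i) (act (e * e) t))"
              unfolding u_def using ce by (metis act_mult)
            ultimately have u: "u \<noteq> 0" "act e u = u" "act x u = 0" "act y u = 0"
              using i j goodD(1)[OF e] by (simp_all add: u_def)
            \<comment> \<open>Odd operators exchange the eigenspaces, so both components of a common
              kernel vector are again killed.\<close>
            have "act pa u + act pb u = u"
              using pa_add_pb by (metis act_1 act_simps(2))
            then have "act pa u \<noteq> 0 \<or> act pb u \<noteq> 0"
              using u(1) by auto
            moreover have "act z (act pa u) = 0" "act z (act pb u) = 0" if z: "z \<in> odds e" "act z u = 0" for z
              using odd_pa[OF oddsD(2)[OF z(1)]] odd_pb[OF oddsD(2)[OF z(1)]] z(2)
              by (simp_all flip: act_mult) simp_all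
            moreover have "act e (act pa u) = act pa u" "act e (act pb u) = act pb u"
              using even_pa[OF goodD(3)[OF e]] even_pb[OF goodD(3)[OF e]] u(2) by (metis act_mult)+
            moreover have "act A (act pa u) = - act pa u" "act A (act pb u) = act pb u"
              by (simp_all flip: act_mult)
            ultimately obtain w where "w \<noteq> 0" "act e w = w" "act A w = w \<or> act A w = - w" "act x w = 0" "act y w = 0"
              using x y u(3,4) by metis
            then show ?thesis
              using vanish_homogeneous_kernel[OF F e IH xy inner] by blast
          qed
        qed
      qed
    qed
  qed
qed

section \<open>From density to irreducibility\<close>

lemma good_1: "good 1"
  by (simp add: good_def)

text \<open>Any two points \<open>(x, oddpoly r x)\<close> lie on a polynomial curve of such points.\<close>

lemma oddpoly_points_irreducible:
  assumes F: "polyfun F" "x \<in> odds e" "F x (oddpoly r x) \<noteq> 0"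
    and G: "polyfun G" "x' \<in> odds e" "G x' (oddpoly r' x') \<noteq> 0"
  obtains z t where "z \<in> odds e" "F z (oddpoly t z) \<noteq> 0" "G z (oddpoly t z) \<noteq> 0"
proof -
  define X where "X s = x + s *e (x' - x)" for s
  define t where "t s = r + smult s (r' - r)" for s
  have X: "X s \<in> odds e" for s
    unfolding X_def using F(2) G(2) by (intro odds_add odds_smul odds_diff)
  have X_line: "entries_in linefuns X"
    unfolding X_def by (intro entries_add[OF funring_linefuns]
        entries_smul[OF funring_linefuns] entries_const[OF funring_linefuns] linefuns_id)
  have Y: "oddpoly (t s) (X s) = X s * (meval r (X s * X s) + s *e meval (r' - r) (X s * X s))" for s
    by (simp add: oddpoly_def t_def meval_add meval_smult)
  have line: "(\<lambda>s. H (X s) (oddpoly (t s) (X s))) \<in> linefuns" if "polyfun H" for H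
    unfolding Y by (intro polyfun_compose[OF that funring_linefuns] entries_add[OF funring_linefuns]
        entries_mult[OF funring_linefuns] entries_meval[OF funring_linefuns]
        entries_smul[OF funring_linefuns] linefuns_id X_line)
  have "finite {s. F (X s) (oddpoly (t s) (X s)) = 0}"
    by (rule linefuns_finite_zeros[OF line[OF F(1)], of 0]) (use F(3) in \<open>simp add: X_def t_def\<close>)
  moreover have "finite {s. G (X s) (oddpoly (t s) (X s)) = 0}"
    by (rule linefuns_finite_zeros[OF line[OF G(1)], of 1]) (use G(3) in \<open>simp add: X_def t_def\<close>)
  ultimately have "finite ({s. F (X s) (oddpoly (t s) (X s)) = 0} \<union> {s. G (X s) (oddpoly (t s) (X s)) = 0})"
    by simp
  then obtain s where "s \<notin> {s. F (X s) (oddpoly (t s) (X s)) = 0} \<union> {s. G (X s) (oddpoly (t s) (X s)) = 0}"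
    using ex_new_if_finite[OF infinite_UNIV_char_0] by blast
  then show thesis
    using that[OF X] by blast
qed

lemma polyfun_of_polynomial: "f \<in> polynomial_functions \<Longrightarrow> polyfun (\<lambda>x y. f (matrix_of x, matrix_of y))"
  by (simp add: polyfun_def)

text \<open>By density a proper closed subset misses some point \<open>(x, oddpoly r x)\<close>. A
  curve joining such points for two proper closed subsets contains a point outside both, so they
  cannot cover.\<close>

lemma irreducible_commuting:
  "irreducible_space (subtopology zariski {(X, Y). commuting 1 (Endo X) (Endo Y)})"
    (is "irreducible_space (subtopology zariski ?V)")
  unfolding irreducible_space_def
proof (intro conjI allI impI)
  have "(0, 0) \<in> ?V"
    by (simp add: commuting_def flip: zero_endo.abs_eq)
  then show "topspace (subtopology zariski ?V) \<noteq> {}"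
    by auto
next
  fix C D
  assume C: "closedin (subtopology zariski ?V) C" and D: "closedin (subtopology zariski ?V) D"
    and CD: "topspace (subtopology zariski ?V) = C \<union> D"
  have separate: "\<exists>F. polyfun F \<and> (\<forall>(X, Y)\<in>C. F (Endo X) (Endo Y) = 0) \<and>
      (\<exists>x\<in>odds 1. \<exists>r. F x (oddpoly r x) \<noteq> 0)"
    if C: "closedin (subtopology zariski ?V) C" and "C \<noteq> ?V" for C
  proof -
    obtain P where P: "P \<subseteq> polynomial_functions" "C = {p. \<forall>f\<in>P. f p = 0} \<inter> ?V"
      using C unfolding closedin_subtopology closedin_zariski by blast
    have "C \<subseteq> ?V"
      using P(2) by blast
    then obtain X Y where XY: "(X, Y) \<in> ?V" "(X, Y) \<notin> C"
      using \<open>C \<noteq> ?V\<close> by (metis subsetI subset_antisym surj_pair)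
    then obtain f where f: "f \<in> P" "f (X, Y) \<noteq> 0"
      using P(2) by blast
    define F where "F x y = f (matrix_of x, matrix_of y)" for x y
    have polyF: "polyfun F"
      unfolding F_def using f(1) P(1) by (intro polyfun_of_polynomial) blast
    have "F (Endo X) (Endo Y) \<noteq> 0" "commuting 1 (Endo X) (Endo Y)"
      using f(2) XY(1) by (simp_all add: F_def)
    then have "\<not> vanishing 1 F"
      using dense_oddpoly_all[OF good_1] unfolding dense_oddpoly_iff by blast
    moreover have "\<forall>(X, Y)\<in>C. F (Endo X) (Endo Y) = 0"
      using f(1) P(2) by (auto simp: F_def)
    ultimately show ?thesis
      using polyF unfolding vanishing_def by blast
  qed
  show "C = topspace (subtopology zariski ?V) \<or> D = topspace (subtopology zariski ?V)"
  proof (rule ccontr)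
    assume "\<not> ?thesis"
    then have neq: "C \<noteq> ?V" "D \<noteq> ?V"
      by simp_all
    obtain F x r where F: "polyfun F" "\<forall>(X, Y)\<in>C. F (Endo X) (Endo Y) = 0" "x \<in> odds 1" "F x (oddpoly r x) \<noteq> 0"
      using separate[OF C neq(1)] by blast
    obtain G x' r' where G: "polyfun G" "\<forall>(X, Y)\<in>D. G (Endo X) (Endo Y) = 0" "x' \<in> odds 1" "G x' (oddpoly r' x') \<noteq> 0"
      using separate[OF D neq(2)] by blast
    obtain z t where z: "z \<in> odds 1" "F z (oddpoly t z) \<noteq> 0" "G z (oddpoly t z) \<noteq> 0"
      using oddpoly_points_irreducible[OF F(1,3,4) G(1,3,4)] by blast
    have "(matrix_of z, matrix_of (oddpoly t z)) \<in> ?V"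
      using commuting_oddpoly[OF good_1 z(1)] by (simp add: matrix_of_inverse)
    moreover have "?V = C \<union> D"
      using CD by simp
    ultimately have "(matrix_of z, matrix_of (oddpoly t z)) \<in> C \<union> D"
      by (simp only:)
    then show False
      using F(2) G(2) z(2,3) by (auto simp: matrix_of_inverse)
  qed
qed

end

theorem theorem2p4:
  fixes B :: "'k::{alg_closed_field,field_char_0}^'d \<Rightarrow> 'k^'d \<Rightarrow> 'k"
    and Va Vb :: "('k^'d) set"
    and A :: "'k^'d^'d"
    and n m :: nat
  assumes "n \<ge> 1" and "m \<ge> 1"
    and "CARD('d) = n + m"
    and "bilinear_form B" and "symmetric_form B" and "nondegenerate_form B"
    and "orthogonal_decomposition B Va Vb"
    and "vec.dim Va = n" and "vec.dim Vb = m"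
    and "A \<in> orthogonal_group B"
    and "\<And>v. v \<in> Va \<Longrightarrow> A *v v = - v"
    and "\<And>v. v \<in> Vb \<Longrightarrow> A *v v = v"
  shows "irreducible_space
           (subtopology zariski
             (commuting_variety (minus_eigenspace (so B) (conjugation A))))"
proof -
  have lin: "Vector_Spaces.linear (*s) (*) (\<lambda>v. B u v)" "Vector_Spaces.linear (*s) (*) (\<lambda>u. B u v)" for u v
    using assms(4) by (simp_all add: bilinear_form_def)
  have B: "B (u + v) w = B u w + B v w" "B (c *s u) w = c * B u w" for u v w c
    using lin(2)[of w] unfolding Vector_Spaces.linear_def module_hom_def module_hom_axioms_def by blast+
  have B_sym: "B u v = B v u" for u v
    using assms(5) by (simp add: symmetric_form_def)
  have B_minus: "B (- u) w = - B u w" "B w (- u) = - B w u" for u w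
    using B(2)[of "-1" u w] by (simp_all add: B_sym[of w] vec.scale_minus_left)
  have AAv: "A *v (A *v v) = v" for v
  proof -
    obtain a c where "v = a + c" "a \<in> Va" "c \<in> Vb"
      using assms(7) unfolding orthogonal_decomposition_def by blast
    then show ?thesis
      using assms(11,12) by (simp add: matrix_vector_right_distrib matrix_vector_mult_diff_distrib)
  qed
  then have involutive: "A ** A = mat 1"
    by (simp add: matrix_eq flip: matrix_vector_mul_assoc)
  have inv: "matrix_inv A = A"
  proof -
    have "A ** matrix_inv A = mat 1 \<and> matrix_inv A ** A = mat 1"
      unfolding matrix_inv_def by (rule someI[of _ A]) (simp add: involutive)
    moreover have "matrix_inv A = A ** (A ** matrix_inv A)"
      by (simp add: matrix_mul_assoc involutive)
    ultimately show ?thesis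
      by simp
  qed
  have BA: "B (A *v u) (A *v v) = B u v" for u v
    using assms(10) by (simp add: orthogonal_group_def)
  interpret quadratic_involution "\<lambda>u v. B (A *v u) v" "Endo A"
  proof
    fix u v w :: "'k^'d" and c :: 'k
    show "B (A *v (u + v)) w = B (A *v u) w + B (A *v v) w"
      by (simp add: matrix_vector_right_distrib B)
    show "B (A *v (c *s u)) w = c * B (A *v u) w"
      by (simp add: vector_scalar_commute B)
    show sym: "B (A *v u) v = B (A *v v) u" for u v
      using BA[of u "A *v v"] by (simp add: AAv B_sym)
    show "u = 0" if "\<And>v. B (A *v u) v = 0"
    proof -
      have "A *v u = 0"
        using assms(6) that by (simp add: nondegenerate_form_def)
      then show ?thesis
        using AAv[of u] by simp
    qed
    show "Endo A * Endo A = 1"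
      by (simp add: times_endo.abs_eq one_endo.abs_eq involutive)
    show "B (A *v act (Endo A) u) v = B (A *v u) (act (Endo A) v)"
      by (simp add: act.abs_eq AAv BA)
  qed
  have "commuting_variety (minus_eigenspace (so B) (conjugation A))
      = {(X, Y). commuting 1 (Endo X) (Endo Y)}"
  proof -
    have anti: "conjugation A X = - X \<longleftrightarrow> Endo A * Endo X = - (Endo X * Endo A)" for X
    proof -
      have "conjugation A X = - X \<longleftrightarrow> A ** X ** A ** A = - X ** A"
      proof
        assume "A ** X ** A ** A = - X ** A"
        then have "A ** X ** A ** A ** A = - X ** A ** A"
          by simp
        then show "conjugation A X = - X"
          by (simp add: conjugation_def inv involutive flip: matrix_mul_assoc)
      qed (simp add: conjugation_def inv)
      also have "A ** X ** A ** A = A ** X"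
        by (simp add: involutive flip: matrix_mul_assoc)
      also have "A ** X = - X ** A \<longleftrightarrow> Endo A * Endo X = - (Endo X * Endo A)"
        by (simp add: times_endo.abs_eq uminus_endo.abs_eq Endo_inject matrix_matrix_mult_def vec_eq_iff sum_negf)
      finally show ?thesis .
    qed
    \<comment> \<open>For \<open>X\<close> anticommuting with \<open>A\<close>, the substitution of
      \<open>A u\<close> for \<open>u\<close>, a bijection, turns self-adjointness for
      \<open>B (A u) v\<close> into skewness for \<open>B\<close>.\<close>
    have "X \<in> so B \<longleftrightarrow> star (Endo X) = Endo X" if "Endo A * Endo X = - (Endo X * Endo A)" for X
    proof -
      have AX: "A *v (X *v u) = - (X *v (A *v u))" for u
        using arg_cong[OF that, of "\<lambda>z. act z u"] by (simp add: act.abs_eq)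
      have "star (Endo X) = Endo X \<longleftrightarrow> (\<forall>u v. B (A *v (X *v u)) v = B (A *v u) (X *v v))"
        using b_star[of "Endo X"] star_eqI[of "Endo X" "Endo X"] by (auto simp: act.abs_eq)
      also have "\<dots> \<longleftrightarrow> (\<forall>u v. B (X *v (A *v u)) v + B (A *v u) (X *v v) = 0)"
        by (simp add: AX B_minus eq_commute[of "- _"] eq_neg_iff_add_eq_0 add.commute)
      also have "\<dots> \<longleftrightarrow> (\<forall>u v. B (X *v u) v + B u (X *v v) = 0)"
        by (metis AAv)
      finally show ?thesis
        by (simp add: so_def)
    qed
    then have "minus_eigenspace (so B) (conjugation A) = {X. Endo X \<in> odds 1}"
      by (auto simp: minus_eigenspace_def anti odds_def)
    moreover have "lie_bracket X Y = 0 \<longleftrightarrow> Endo X * Endo Y = Endo Y * Endo X" for X Y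
      by (simp add: lie_bracket_def times_endo.abs_eq Endo_inject)
    ultimately show ?thesis
      by (auto simp: commuting_variety_def commuting_def)
  qed
  then show ?thesis
    using irreducible_commuting by simp
qed

end
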